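(* Let $(M^m,g)$ be a compact, orientable Riemannian manifold without boundary of dimension $m$, and let $\alpha$ be a constant with $\alpha>2$. Assume that there exists a non-isometric conformal vector field $W$ on $M$. If $2\alpha<m-1$, then $M$ is ($\alpha$-)unstable.
   Context: A smooth vector field $W$ on $(M,g)$ is conformal with potential function $\lambda\in C^\infty(M)$ if $\mathcal L_Wg=2\lambda g$; it is Killing if $\lambda=0$ (its flow consists of isometries), and non-isometric if it is not Killing. For a smooth map $\psi:(M,g)\to(N,h)$ the $\alpha$-energy is $E_\alpha(\psi)=\int_M(1+|d\psi|^2)^\alpha\,dV_g$, with $|d\psi|^2$ the squared Hilbert-Schmidt norm, and $\psi$ is $\alpha$-harmonic if it is a critical point of $E_\alpha$; the identity map $\mathrm{id}:(M,g)\to(M,g)$ is $\alpha$-harmonic. For an $\alpha$-harmonic $\psi$ and vector fields $\upsilon,\omega$ along $\psi$, let $I_{\alpha,\psi}(\upsilon,\omega)=\frac{\partial^2}{\partial t\,\partial s}E_\alpha(\psi_{t,s})\big|_{s=t=0}$, where $\psi_{t,s}$ is a smooth 2-parameter variation of $\psi=\psi_{0,0}$ with $\frac{\partial\psi_{t,s}}{\partial t}|_{0,0}=\upsilon$, $\frac{\partial\psi_{t,s}}{\partial s}|_{0,0}=\omega$. The map $\psi$ is $\alpha$-stable if $I_{\alpha,\psi}(\omega,\omega)\ge0$ for every vector field $\omega$ along $\psi$, and $\alpha$-unstable otherwise. The manifold $(M,g)$ is $\alpha$-stable (stable) if $\mathrm{id}:(M,g)\to(M,g)$ is $\alpha$-stable,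 and unstable otherwise. *)

theory Defs
  imports "HOL-Analysis.Analysis"
begin

section \<open>Smooth maps between open sets of Euclidean spaces\<close>

fun Ck_on :: "nat \<Rightarrow> 'e::euclidean_space set \<Rightarrow> ('e \<Rightarrow> 'f::real_normed_vector) \<Rightarrow> bool" where
  "Ck_on 0 S f \<longleftrightarrow> continuous_on S f"
| "Ck_on (Suc k) S f \<longleftrightarrow>
     (\<forall>x\<in>S. f differentiable (at x)) \<and>
     (\<forall>v. Ck_on k S (\<lambda>x. frechet_derivative f (at x) v))"

text \<open>Only used for open sets \<open>S\<close>.\<close>
definition smooth_on :: "'e::euclidean_space set \<Rightarrow> ('e \<Rightarrow> 'f::real_normed_vector) \<Rightarrow> bool" where
  "smooth_on S f \<longleftrightarrow> (\<forall>k. Ck_on k S f)"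

definition partial_deriv :: "'m::finite \<Rightarrow> (real^'m \<Rightarrow> real) \<Rightarrow> real^'m \<Rightarrow> real" where
  "partial_deriv k f x = frechet_derivative f (at x) (axis k 1)"


section \<open>Smooth manifolds\<close>

text \<open>The points of a manifold are all elements of a Hausdorff, second countable type \<open>'a\<close>.
  The model space is \<open>real^'m\<close>, so the dimension is \<open>CARD('m)\<close>; since charts map onto open
  subsets of \<open>real^'m\<close>, there is no boundary. The smooth structure is the one generated by an
  atlas, which need not be maximal. Connectedness is not required.\<close>

type_synonym ('a, 'm) chart = "'a set \<times> ('a \<Rightarrow> real^'m)"

definition chart_dom :: "('a, 'm::finite) chart \<Rightarrow> 'a set" where
  "chart_dom c = fst c"

definition coord :: "('a, 'm::finite) chart \<Rightarrow> 'a \<Rightarrow> real^'m" where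
  "coord c = snd c"

definition chart_img :: "('a, 'm::finite) chart \<Rightarrow> (real^'m) set" where
  "chart_img c = coord c ` chart_dom c"

definition param :: "('a, 'm::finite) chart \<Rightarrow> real^'m \<Rightarrow> 'a" where
  "param c = inv_into (chart_dom c) (coord c)"

definition is_chart :: "('a::topological_space, 'm::finite) chart \<Rightarrow> bool" where
  "is_chart c \<longleftrightarrow> open (chart_dom c) \<and> open (chart_img c) \<and>
     homeomorphism (chart_dom c) (chart_img c) (coord c) (param c)"

definition smooth_atlas ::
    "('a::{t2_space,second_countable_topology}, 'm::finite) chart set \<Rightarrow> bool" where
  "smooth_atlas A \<longleftrightarrow>
     (\<forall>c\<in>A. is_chart c) \<and> (\<Union>c\<in>A. chart_dom c) = UNIV \<and>
     (\<forall>c\<in>A. \<forall>d\<in>A. smooth_on (coord c ` (chart_dom c \<inter> chart_dom d)) (coord d \<circ> param c))"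

definition chart_at :: "('a, 'm::finite) chart set \<Rightarrow> 'a \<Rightarrow> ('a, 'm) chart" where
  "chart_at A p = (SOME c. c \<in> A \<and> p \<in> chart_dom c)"

definition transition_jacobian ::
    "('a, 'm::finite) chart \<Rightarrow> ('a, 'm) chart \<Rightarrow> 'a \<Rightarrow> real^'m^'m" where
  "transition_jacobian c d p = jacobian (coord d \<circ> param c) (at (coord c p))"

text \<open>\<open>A \<union> B\<close> being a smooth atlas says that \<open>B\<close> defines the same smooth structure as \<open>A\<close>.\<close>
definition orientable ::
    "('a::{t2_space,second_countable_topology}, 'm::finite) chart set \<Rightarrow> bool" where
  "orientable A \<longleftrightarrow>
     (\<exists>B. smooth_atlas B \<and> smooth_atlas (A \<union> B) \<and>
        (\<forall>c\<in>B. \<forall>d\<in>B. \<forall>p\<in>chart_dom c \<inter> chart_dom d. det (transition_jacobian c d p) > 0))"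

definition smooth_fun :: "('a, 'm::finite) chart set \<Rightarrow> ('a \<Rightarrow> real) \<Rightarrow> bool" where
  "smooth_fun A f \<longleftrightarrow> (\<forall>c\<in>A. smooth_on (chart_img c) (f \<circ> param c))"


section \<open>Tangent vectors and Riemannian metrics\<close>

text \<open>A tangent vector at \<open>p\<close> is a family of coordinate vectors, indexed by the charts around
  \<open>p\<close>, that transforms by the Jacobians of the transition maps. The values at charts not
  containing \<open>p\<close> are irrelevant.\<close>

type_synonym ('a, 'm) tangent = "('a, 'm) chart \<Rightarrow> real^'m"

definition tangent_vector ::
    "('a, 'm::finite) chart set \<Rightarrow> 'a \<Rightarrow> ('a, 'm) tangent \<Rightarrow> bool" where
  "tangent_vector A p v \<longleftrightarrow>
     (\<forall>c\<in>A. \<forall>d\<in>A. p \<in> chart_dom c \<inter> chart_dom d \<longrightarrow> v d = transition_jacobian c d p *v v c)"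

definition vector_field_along ::
    "('a, 'm::finite) chart set \<Rightarrow> ('b, 'n::finite) chart set \<Rightarrow> ('a \<Rightarrow> 'b) \<Rightarrow>
     ('a \<Rightarrow> ('b, 'n) tangent) \<Rightarrow> bool" where
  "vector_field_along A B \<psi> \<omega> \<longleftrightarrow>
     (\<forall>p. tangent_vector B (\<psi> p) (\<omega> p)) \<and>
     (\<forall>c\<in>A. \<forall>d\<in>B. smooth_on (coord c ` (chart_dom c \<inter> \<psi> -` chart_dom d))
        (\<lambda>x. \<omega> (param c x) d))"

abbreviation vector_field ::
    "('a, 'm::finite) chart set \<Rightarrow> ('a \<Rightarrow> ('a, 'm) tangent) \<Rightarrow> bool" where
  "vector_field A W \<equiv> vector_field_along A A id W"

text \<open>\<open>g p c\<close> is the Gram matrix of the metric at \<open>p\<close> in the coordinate frame of the chart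
  \<open>c\<close>.\<close>

type_synonym ('a, 'm) metric = "'a \<Rightarrow> ('a, 'm) chart \<Rightarrow> real^'m^'m"

definition riemannian_metric ::
    "('a, 'm::finite) chart set \<Rightarrow> ('a, 'm) metric \<Rightarrow> bool" where
  "riemannian_metric A g \<longleftrightarrow>
     (\<forall>c\<in>A. smooth_on (chart_img c) (\<lambda>x. g (param c x) c)) \<and>
     (\<forall>c\<in>A. \<forall>p\<in>chart_dom c. transpose (g p c) = g p c \<and>
        (\<forall>v. v \<noteq> 0 \<longrightarrow> v \<bullet> (g p c *v v) > 0)) \<and>
     (\<forall>c\<in>A. \<forall>d\<in>A. \<forall>p\<in>chart_dom c \<inter> chart_dom d.
        g p c = transpose (transition_jacobian c d p) ** g p d ** transition_jacobian c d p)"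

text \<open>The components
  \<open>(L\<^sub>W g)\<^sub>i\<^sub>j = W\<^sup>k \<partial>\<^sub>k g\<^sub>i\<^sub>j + g\<^sub>k\<^sub>j \<partial>\<^sub>i W\<^sup>k + g\<^sub>i\<^sub>k \<partial>\<^sub>j W\<^sup>k\<close> of the Lie derivative of the metric.\<close>
definition lie_derivative_metric ::
    "('a, 'm::finite) metric \<Rightarrow> ('a \<Rightarrow> ('a, 'm) tangent) \<Rightarrow> ('a, 'm) metric" where
  "lie_derivative_metric g W p c = (\<chi> i j. \<Sum>k\<in>UNIV.
       W p c $ k * partial_deriv k (\<lambda>x. g (param c x) c $ i $ j) (coord c p)
     + g p c $ k $ j * partial_deriv i (\<lambda>x. W (param c x) c $ k) (coord c p)
     + g p c $ i $ k * partial_deriv j (\<lambda>x. W (param c x) c $ k) (coord c p))"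

definition conformal_field ::
    "('a, 'm::finite) chart set \<Rightarrow> ('a, 'm) metric \<Rightarrow> ('a \<Rightarrow> ('a, 'm) tangent) \<Rightarrow>
     ('a \<Rightarrow> real) \<Rightarrow> bool" where
  "conformal_field A g W l \<longleftrightarrow> vector_field A W \<and> smooth_fun A l \<and>
     (\<forall>c\<in>A. \<forall>p\<in>chart_dom c. lie_derivative_metric g W p c = (2 * l p) *\<^sub>R g p c)"

definition killing_field ::
    "('a, 'm::finite) chart set \<Rightarrow> ('a, 'm) metric \<Rightarrow> ('a \<Rightarrow> ('a, 'm) tangent) \<Rightarrow> bool" where
  "killing_field A g W \<longleftrightarrow> conformal_field A g W (\<lambda>_. 0)"

text \<open>The Riemannian measure \<open>dV\<^sub>g\<close> is the unique Borel measure that is given in each chart by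
  the density \<open>sqrt (det g)\<close>.\<close>
definition volume_measure ::
    "('a::topological_space, 'm::finite) chart set \<Rightarrow> ('a, 'm) metric \<Rightarrow> 'a measure" where
  "volume_measure A g = (THE \<mu>. sets \<mu> = sets borel \<and>
     (\<forall>c\<in>A. \<forall>S\<in>sets borel. S \<subseteq> chart_dom c \<longrightarrow>
        emeasure \<mu> S = (\<integral>\<^sup>+x\<in>coord c ` S. ennreal (sqrt (det (g (param c x) c))) \<partial>lborel)))"


section \<open>The \<open>\<alpha>\<close>-energy and its second variation\<close>

text \<open>The squared Hilbert-Schmidt norm \<open>g\<^sup>i\<^sup>j h\<^sub>a\<^sub>b \<partial>\<^sub>i \<psi>\<^sup>a \<partial>\<^sub>j \<psi>\<^sup>b\<close> of \<open>d\<psi>\<close> at \<open>p\<close>; for metrics \<open>g\<close>, \<open>h\<close>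
  it does not depend on the charts chosen around \<open>p\<close> and \<open>\<psi> p\<close>.\<close>
definition norm_sq_differential ::
    "('a, 'm::finite) chart set \<Rightarrow> ('a, 'm) metric \<Rightarrow>
     ('b, 'n::finite) chart set \<Rightarrow> ('b, 'n) metric \<Rightarrow> ('a \<Rightarrow> 'b) \<Rightarrow> 'a \<Rightarrow> real" where
  "norm_sq_differential A g B h \<psi> p =
     (let c = chart_at A p; d = chart_at B (\<psi> p);
          J = jacobian (coord d \<circ> \<psi> \<circ> param c) (at (coord c p))
      in trace (matrix_inv (g p c) ** transpose J ** h (\<psi> p) d ** J))"

definition alpha_energy ::
    "real \<Rightarrow> ('a::topological_space, 'm::finite) chart set \<Rightarrow> ('a, 'm) metric \<Rightarrow>
     ('b, 'n::finite) chart set \<Rightarrow> ('b, 'n) metric \<Rightarrow> ('a \<Rightarrow> 'b) \<Rightarrow> real" where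
  "alpha_energy \<alpha> A g B h \<psi> =
     (LINT p|volume_measure A g. (1 + norm_sq_differential A g B h \<psi> p) powr \<alpha>)"

text \<open>Smooth families of maps, with parameters in a neighbourhood of \<open>(0, 0)\<close>.\<close>
definition smooth_two_param_variation ::
    "('a::topological_space, 'm::finite) chart set \<Rightarrow>
     ('b::topological_space, 'n::finite) chart set \<Rightarrow>
     ('a \<Rightarrow> 'b) \<Rightarrow> (real \<Rightarrow> real \<Rightarrow> 'a \<Rightarrow> 'b) \<Rightarrow> bool" where
  "smooth_two_param_variation A B \<psi> \<Psi> \<longleftrightarrow> \<Psi> 0 0 = \<psi> \<and>
     (\<exists>\<epsilon>>0.
        continuous_on ({-\<epsilon><..<\<epsilon>} \<times> {-\<epsilon><..<\<epsilon>} \<times> UNIV) (\<lambda>(t, s, p). \<Psi> t s p) \<and>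
        (\<forall>c\<in>A. \<forall>d\<in>B. smooth_on
           {(t, s, x). t \<in> {-\<epsilon><..<\<epsilon>} \<and> s \<in> {-\<epsilon><..<\<epsilon>} \<and> x \<in> chart_img c \<and>
                       \<Psi> t s (param c x) \<in> chart_dom d}
           (\<lambda>(t, s, x). coord d (\<Psi> t s (param c x)))))"

text \<open>\<open>v\<close> is the velocity at time \<open>0\<close> of the curve of maps \<open>\<gamma>\<close>.\<close>
definition has_initial_velocity ::
    "('b, 'n::finite) chart set \<Rightarrow> (real \<Rightarrow> 'a \<Rightarrow> 'b) \<Rightarrow>
     ('a \<Rightarrow> ('b, 'n) tangent) \<Rightarrow> bool" where
  "has_initial_velocity B \<gamma> v \<longleftrightarrow>
     (\<forall>p. \<forall>d\<in>B. \<gamma> 0 p \<in> chart_dom d \<longrightarrow>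
        ((\<lambda>t. coord d (\<gamma> t p)) has_vector_derivative v p d) (at 0))"

text \<open>The second variation \<open>I\<^sub>\<alpha>\<^sub>,\<^sub>\<psi>(v, w)\<close>. When \<open>\<psi>\<close> is \<open>\<alpha>\<close>-harmonic, as the identity is, every
  variation with the velocities \<open>v\<close> and \<open>w\<close> yields the same value; the description operator
  expresses this independence.\<close>
definition alpha_index_form ::
    "real \<Rightarrow> ('a::topological_space, 'm::finite) chart set \<Rightarrow> ('a, 'm) metric \<Rightarrow>
     ('b::topological_space, 'n::finite) chart set \<Rightarrow> ('b, 'n) metric \<Rightarrow> ('a \<Rightarrow> 'b) \<Rightarrow>
     ('a \<Rightarrow> ('b, 'n) tangent) \<Rightarrow> ('a \<Rightarrow> ('b, 'n) tangent) \<Rightarrow> real" where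
  "alpha_index_form \<alpha> A g B h \<psi> v w = (THE r. \<exists>\<Psi>.
     smooth_two_param_variation A B \<psi> \<Psi> \<and>
     has_initial_velocity B (\<lambda>t. \<Psi> t 0) v \<and>
     has_initial_velocity B (\<lambda>s. \<Psi> 0 s) w \<and>
     r = deriv (\<lambda>t. deriv (\<lambda>s. alpha_energy \<alpha> A g B h (\<Psi> t s)) 0) 0)"

definition alpha_stable_map ::
    "real \<Rightarrow> ('a::topological_space, 'm::finite) chart set \<Rightarrow> ('a, 'm) metric \<Rightarrow>
     ('b::topological_space, 'n::finite) chart set \<Rightarrow> ('b, 'n) metric \<Rightarrow> ('a \<Rightarrow> 'b) \<Rightarrow> bool" where
  "alpha_stable_map \<alpha> A g B h \<psi> \<longleftrightarrow>
     (\<forall>\<omega>. vector_field_along A B \<psi> \<omega> \<longrightarrow> alpha_index_form \<alpha> A g B h \<psi> \<omega> \<omega> \<ge> 0)"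

definition alpha_stable ::
    "real \<Rightarrow> ('a::topological_space, 'm::finite) chart set \<Rightarrow> ('a, 'm) metric \<Rightarrow> bool" where
  "alpha_stable \<alpha> A g \<longleftrightarrow> alpha_stable_map \<alpha> A g A g id"

abbreviation alpha_unstable ::
    "real \<Rightarrow> ('a::topological_space, 'm::finite) chart set \<Rightarrow> ('a, 'm) metric \<Rightarrow> bool" where
  "alpha_unstable \<alpha> A g \<equiv> \<not> alpha_stable \<alpha> A g"

end

theory Submission
  imports Defs
begin

text \<open>Let \<open>\<Psi>\<close> be a variation of the identity, both of whose velocities are the conformal field \<open>W\<close>, and
  differentiate its energy under the integral. In a chart, the second derivative of the energy
  density is the one that the flow of \<open>W\<close> would give, computed from \<open>L\<^sub>W g = 2 \<lambda> g\<close>, plus a multiple of the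
  divergence of the vector field \<open>Y\<close> by which the acceleration \<open>\<partial>\<^sub>t \<partial>\<^sub>s \<Psi>\<close> exceeds that of the flow. By
  the divergence theorem every such variation gives the same value,
  \<open>2 m \<alpha> (1 + m)\<^bsup>\<alpha> - 2\<^esup> (2 + 2 m \<alpha> - m - m\<^sup>2) \<integral> \<lambda>\<^sup>2\<close>, which is negative if \<open>2 \<alpha> < m - 1\<close>.
  A variation exists without solving an ODE: compose the maps \<open>x \<mapsto> x + t \<rho>\<^sub>i(x) W(x)\<close>, each
  defined in one chart, over a partition of unity \<open>\<rho>\<^sub>i\<close>.\<close>

section \<open>Calculus of smooth maps\<close>

text \<open>The obstacle is the divergence theorem for \<open>Y\<close>, which is given by
  coefficient functions in each chart, built from an acceleration that depends on the chart. In
  place of a transformation law, the derivative of a function \<open>h\<close> in the direction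
  \<open>Y\<close> is written without charts: the mixed parameter derivative of
  \<open>h (\<Psi> u p)\<close> minus the second derivative of \<open>h\<close> along
  \<open>W\<close>. Over a partition of unity these derivatives cancel, because the functions add up
  to 1. Multiplying by the partition therefore costs nothing in total, and each piece is a sum of
  coordinate derivatives with compact support in one chart. The field integrated is \<open>Y\<close>
  plus m \<lambda> \<open>W\<close>. The second derivative of the density contains the derivative
  W(\<lambda>); since \<open>W\<close> has divergence m \<lambda>, the divergence of \<lambda>
  \<open>W\<close> is W(\<lambda>) + m \<lambda>^2, so W(\<lambda>) may be traded for - m
  \<lambda>^2. This produces the terms - m - m^2 of the constant, hence its sign. Neither connection
  nor curvature enters: \<open>L_W g = 2 \<lambda> g\<close> and its derivative along
  \<open>W\<close> are identities between partial derivatives in a chart.\<close>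

lemma Ck_on_cong_imp:
  assumes "open S" "\<And>x. x \<in> S \<Longrightarrow> f x = g x" "Ck_on k S f"
  shows "Ck_on k S g"
  using assms(2,3)
proof (induction k arbitrary: f g)
  case 0
  then show ?case by (simp cong: continuous_on_cong)
next
  case (Suc k)
  have d: "(g has_derivative frechet_derivative f (at x)) (at x)" if "x \<in> S" for x
    by (rule has_derivative_transform_within_open[of f _ x UNIV S])
      (use Suc.prems that \<open>open S\<close> in \<open>auto simp: frechet_derivative_works\<close>)
  have eq: "frechet_derivative f (at x) v = frechet_derivative g (at x) v" if "x \<in> S" for x v
    using frechet_derivative_at[OF d[OF that]] by simp
  show ?case
    unfolding Ck_on.simps
  proof (intro conjI ballI allI)
    show "g differentiable at x" if "x \<in> S" for x
      using d[OF that] by (rule differentiableI)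
    show "Ck_on k S (\<lambda>x. frechet_derivative g (at x) v)" for v
      by (rule Suc.IH[OF eq]) (use Suc.prems in auto)
  qed
qed

text \<open>By uniqueness of derivatives an explicit derivative \<open>f'\<close> may stand in for
  \<open>frechet_derivative\<close>; the sum, product and chain rules enter in this form.\<close>

lemma Ck_onI:
  assumes "open S" "\<And>x. x \<in> S \<Longrightarrow> (f has_derivative f' x) (at x)" "\<And>v. Ck_on k S (\<lambda>x. f' x v)"
  shows "Ck_on (Suc k) S f"
  unfolding Ck_on.simps
proof (intro conjI ballI allI)
  show "f differentiable at x" if "x \<in> S" for x
    using assms(2)[OF that] by (rule differentiableI)
  show "Ck_on k S (\<lambda>x. frechet_derivative f (at x) v)" for v
  proof (rule Ck_on_cong_imp[OF assms(1) _ assms(3)])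
    show "f' x v = frechet_derivative f (at x) v" if "x \<in> S" for x
      using frechet_derivative_at[OF assms(2)[OF that]] by simp
  qed
qed

lemma Ck_on_Suc_imp: "Ck_on (Suc k) S f \<Longrightarrow> Ck_on k S f"
proof (induction k arbitrary: f)
  case 0
  then show ?case
    by (simp add: differentiable_imp_continuous_on differentiable_at_imp_differentiable_on)
next
  case (Suc k)
  then show ?case by (metis Ck_on.simps(2))
qed

lemma Ck_on_subset: "Ck_on k S f \<Longrightarrow> T \<subseteq> S \<Longrightarrow> Ck_on k T f"
  by (induction k arbitrary: f) (auto intro: continuous_on_subset)

lemma Ck_on_has_derivative:
  "Ck_on (Suc k) S f \<Longrightarrow> x \<in> S \<Longrightarrow> (f has_derivative frechet_derivative f (at x)) (at x)"
  by (auto simp: frechet_derivative_works)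

lemma Ck_on_local:
  assumes "\<And>x. x \<in> S \<Longrightarrow> \<exists>T. open T \<and> x \<in> T \<and> Ck_on k T f"
  shows "Ck_on k S f"
  using assms
proof (induction k arbitrary: f)
  case 0
  have "isCont f x" if "x \<in> S" for x
    using 0[OF that] by (auto simp: continuous_on_eq_continuous_at)
  then show ?case by (simp add: continuous_at_imp_continuous_on)
next
  case (Suc k)
  show ?case
    unfolding Ck_on.simps
  proof (intro conjI ballI allI)
    show "f differentiable at x" if "x \<in> S" for x
      using Suc.prems[OF that] by auto
    show "Ck_on k S (\<lambda>x. frechet_derivative f (at x) v)" for v
      by (rule Suc.IH) (use Suc.prems in force)
  qed
qed

lemma Ck_on_const: "Ck_on k S (\<lambda>x. c)"
  by (induction k arbitrary: c) auto

lemma Ck_on_linear: "bounded_linear f \<Longrightarrow> Ck_on k S f"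
proof (induction k)
  case 0
  then show ?case by (simp add: linear_continuous_on)
next
  case (Suc k)
  then have "frechet_derivative f (at x) = f" for x
    by (metis bounded_linear_imp_has_derivative frechet_derivative_at)
  with Suc show ?case
    by (auto simp: Ck_on_const bounded_linear_imp_differentiable)
qed

lemma Ck_on_add:
  assumes "open S"
  shows "Ck_on k S f \<Longrightarrow> Ck_on k S g \<Longrightarrow> Ck_on k S (\<lambda>x. f x + g x)"
proof (induction k arbitrary: f g)
  case 0
  then show ?case by (simp add: continuous_on_add)
next
  case (Suc k)
  show ?case
    by (rule Ck_onI[OF \<open>open S\<close> has_derivative_add[OF Ck_on_has_derivative Ck_on_has_derivative]])
      (use Suc in auto)
qed

lemma Ck_on_sum:
  assumes "open S" "\<And>i. i \<in> I \<Longrightarrow> Ck_on k S (f i)"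
  shows "Ck_on k S (\<lambda>x. \<Sum>i\<in>I. f i x)"
  using assms(2)
  by (induction I rule: infinite_finite_induct) (auto intro: Ck_on_add[OF \<open>open S\<close>] Ck_on_const)

lemma Ck_on_bilinear:
  assumes "open S" "bounded_bilinear B"
  shows "Ck_on k S f \<Longrightarrow> Ck_on k S g \<Longrightarrow> Ck_on k S (\<lambda>x. B (f x) (g x))"
proof (induction k arbitrary: f g)
  case 0
  then show ?case by (simp add: bounded_bilinear.continuous_on[OF assms(2)])
next
  case (Suc k)
  show ?case
    by (rule Ck_onI[OF \<open>open S\<close> bounded_bilinear.FDERIV[OF assms(2) Ck_on_has_derivative Ck_on_has_derivative]])
      (use Suc Ck_on_Suc_imp[OF Suc.prems(1)] Ck_on_Suc_imp[OF Suc.prems(2)] in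
        \<open>auto intro!: Ck_on_add[OF \<open>open S\<close>]\<close>)
qed

text \<open>\<open>Ck_on\<close> controls the derivative of \<open>f\<close> in fixed directions
  only, while the chain rule applies it to the varying vector
  \<open>frechet_derivative g (at x) v\<close>. Expanding that vector over \<open>Basis\<close>
  leaves fixed directions with scalar coefficients, to which the induction hypothesis and the
  product rule apply.\<close>

lemma Ck_on_compose:
  fixes f :: "'b::euclidean_space \<Rightarrow> 'c::real_normed_vector" and g :: "'a::euclidean_space \<Rightarrow> 'b"
  assumes "open S" "open T" "g ` S \<subseteq> T"
  shows "Ck_on k T f \<Longrightarrow> Ck_on k S g \<Longrightarrow> Ck_on k S (\<lambda>x. f (g x))"
  using assms(3)
proof (induction k arbitrary: f g)
  case 0
  then show ?case using continuous_on_compose2[of T f S g] by simp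
next
  case (Suc k)
  have d: "((\<lambda>x. f (g x)) has_derivative
       (\<lambda>v. \<Sum>b\<in>Basis. (frechet_derivative g (at x) v \<bullet> b) *\<^sub>R frechet_derivative f (at (g x)) b)) (at x)"
    if "x \<in> S" for x
  proof -
    have *: "(f has_derivative frechet_derivative f (at (g x))) (at (g x))"
      by (rule Ck_on_has_derivative[OF Suc.prems(1)]) (use Suc.prems(3) that in blast)
    then have lin: "linear (frechet_derivative f (at (g x)))"
      by (rule has_derivative_linear)
    have rep: "frechet_derivative f (at (g x)) w = (\<Sum>b\<in>Basis. (w \<bullet> b) *\<^sub>R frechet_derivative f (at (g x)) b)" for w
    proof -
      have "frechet_derivative f (at (g x)) w = frechet_derivative f (at (g x)) (\<Sum>b\<in>Basis. (w \<bullet> b) *\<^sub>R b)"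
        by (simp only: euclidean_representation)
      then show ?thesis by (simp only: linear_sum[OF lin] linear_scale[OF lin])
    qed
    show ?thesis
      by (rule has_derivative_eq_rhs[OF has_derivative_compose[OF Ck_on_has_derivative[OF Suc.prems(2) that] *]])
        (rule ext, rule rep)
  qed
  have comp: "Ck_on k S (\<lambda>x. frechet_derivative g (at x) v \<bullet> b)" for v b
    using Suc.prems(2) by (intro Ck_on_bilinear[OF \<open>open S\<close> bounded_bilinear_inner] Ck_on_const) simp
  show ?case
  proof (rule Ck_onI[OF \<open>open S\<close> d], assumption)
    fix v
    show "Ck_on k S (\<lambda>x. \<Sum>b\<in>Basis. (frechet_derivative g (at x) v \<bullet> b) *\<^sub>R frechet_derivative f (at (g x)) b)"
    proof (intro Ck_on_sum[OF \<open>open S\<close>] Ck_on_bilinear[OF \<open>open S\<close> bounded_bilinear_scaleR] comp)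
      fix b
      show "Ck_on k S (\<lambda>x. frechet_derivative f (at (g x)) b)"
      proof (rule Suc.IH[OF _ Ck_on_Suc_imp[OF Suc.prems(2)] Suc.prems(3)])
        show "Ck_on k T (\<lambda>y. frechet_derivative f (at y) b)"
          using Suc.prems(1) by simp
      qed
    qed
  qed
qed

lemma smooth_on_cong:
  assumes "open S" "\<And>x. x \<in> S \<Longrightarrow> f x = g x"
  shows "smooth_on S f \<longleftrightarrow> smooth_on S g"
  unfolding smooth_on_def by (metis Ck_on_cong_imp assms)

lemma smooth_on_subset: "smooth_on S f \<Longrightarrow> T \<subseteq> S \<Longrightarrow> smooth_on T f"
  by (auto simp: smooth_on_def intro: Ck_on_subset)

lemma smooth_on_local:
  assumes "\<And>x. x \<in> S \<Longrightarrow> \<exists>T. open T \<and> x \<in> T \<and> smooth_on T f"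
  shows "smooth_on S f"
  using assms by (auto simp: smooth_on_def intro!: Ck_on_local)

lemma smooth_on_has_derivative:
  "smooth_on S f \<Longrightarrow> x \<in> S \<Longrightarrow> (f has_derivative frechet_derivative f (at x)) (at x)"
  unfolding smooth_on_def by (blast intro: Ck_on_has_derivative[of 0])

lemma smooth_on_continuous_on: "smooth_on S f \<Longrightarrow> continuous_on S f"
  unfolding smooth_on_def by (metis Ck_on.simps(1))

lemma smooth_on_frechet_derivative:
  "smooth_on S f \<Longrightarrow> smooth_on S (\<lambda>x. frechet_derivative f (at x) v)"
  unfolding smooth_on_def by (metis Ck_on.simps(2))

lemma smooth_on_const: "smooth_on S (\<lambda>x. c)"
  by (simp add: smooth_on_def Ck_on_const)

lemma smooth_on_linear: "bounded_linear f \<Longrightarrow> smooth_on S f"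
  by (simp add: smooth_on_def Ck_on_linear)

lemma smooth_on_add: "open S \<Longrightarrow> smooth_on S f \<Longrightarrow> smooth_on S g \<Longrightarrow> smooth_on S (\<lambda>x. f x + g x)"
  by (simp add: smooth_on_def Ck_on_add)

lemma smooth_on_sum:
  "open S \<Longrightarrow> (\<And>i. i \<in> I \<Longrightarrow> smooth_on S (f i)) \<Longrightarrow> smooth_on S (\<lambda>x. \<Sum>i\<in>I. f i x)"
  by (simp add: smooth_on_def Ck_on_sum)

lemma smooth_on_bilinear:
  "open S \<Longrightarrow> bounded_bilinear B \<Longrightarrow> smooth_on S f \<Longrightarrow> smooth_on S g \<Longrightarrow> smooth_on S (\<lambda>x. B (f x) (g x))"
  by (simp add: smooth_on_def Ck_on_bilinear)

lemmas smooth_on_mult = smooth_on_bilinear[OF _ bounded_bilinear_mult]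
lemmas smooth_on_scaleR = smooth_on_bilinear[OF _ bounded_bilinear_scaleR]
lemmas smooth_on_inner = smooth_on_bilinear[OF _ bounded_bilinear_inner]

lemma smooth_on_compose:
  fixes f :: "'b::euclidean_space \<Rightarrow> 'c::real_normed_vector" and g :: "'a::euclidean_space \<Rightarrow> 'b"
  shows "open S \<Longrightarrow> open T \<Longrightarrow> smooth_on T f \<Longrightarrow> smooth_on S g \<Longrightarrow> g ` S \<subseteq> T \<Longrightarrow> smooth_on S (\<lambda>x. f (g x))"
  unfolding smooth_on_def using Ck_on_compose by blast

lemma smooth_on_linear_compose:
  fixes f :: "'b::euclidean_space \<Rightarrow> 'c::real_normed_vector" and g :: "'a::euclidean_space \<Rightarrow> 'b"
  shows "open S \<Longrightarrow> bounded_linear f \<Longrightarrow> smooth_on S g \<Longrightarrow> smooth_on S (\<lambda>x. f (g x))"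
  by (rule smooth_on_compose[of _ UNIV]) (auto intro: smooth_on_linear)

lemma smooth_on_minus:
  fixes f :: "'a::euclidean_space \<Rightarrow> 'b::real_normed_vector"
  shows "open S \<Longrightarrow> smooth_on S f \<Longrightarrow> smooth_on S (\<lambda>x. - f x)"
  using smooth_on_scaleR[of S "\<lambda>_. -1" f] by (simp add: smooth_on_const)

lemma smooth_on_diff:
  fixes f :: "'a::euclidean_space \<Rightarrow> 'b::real_normed_vector"
  shows "open S \<Longrightarrow> smooth_on S f \<Longrightarrow> smooth_on S g \<Longrightarrow> smooth_on S (\<lambda>x. f x - g x)"
  using smooth_on_add[of S f "\<lambda>x. - g x"] by (simp add: smooth_on_minus)

lemma smooth_on_prod:
  fixes f :: "_ \<Rightarrow> _ \<Rightarrow> real"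
  assumes "open S" "\<And>i. i \<in> I \<Longrightarrow> smooth_on S (f i)"
  shows "smooth_on S (\<lambda>x. \<Prod>i\<in>I. f i x)"
  using assms(2)
  by (induction I rule: infinite_finite_induct) (auto intro!: smooth_on_mult assms(1) smooth_on_const)

lemma smooth_on_vec_nth:
  fixes f :: "'a::euclidean_space \<Rightarrow> 'b::euclidean_space^'n::finite"
  shows "open S \<Longrightarrow> smooth_on S f \<Longrightarrow> smooth_on S (\<lambda>x. f x $ i)"
  by (rule smooth_on_linear_compose[where f = "\<lambda>y. y $ i"]) (auto intro: bounded_linear_vec_nth)

lemma smooth_on_Pair:
  fixes f :: "'a::euclidean_space \<Rightarrow> 'b::euclidean_space" and g :: "'a \<Rightarrow> 'c::euclidean_space"
  assumes "open S" "smooth_on S f" "smooth_on S g"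
  shows "smooth_on S (\<lambda>x. (f x, g x))"
proof -
  have "bounded_linear (\<lambda>y::'b. (y, 0::'c))" "bounded_linear (\<lambda>y::'c. (0::'b, y))"
    by (auto intro!: bounded_linear_Pair bounded_linear_ident bounded_linear_zero)
  then have "smooth_on S (\<lambda>x. (f x, 0) + (0, g x))"
    by (intro smooth_on_add smooth_on_linear_compose[of S "\<lambda>y::'b. (y, 0::'c)" f]
        smooth_on_linear_compose[of S "\<lambda>y::'c. (0::'b, y)" g] assms)
  then show ?thesis by simp
qed

lemma smooth_on_fst:
  fixes f :: "'a::euclidean_space \<Rightarrow> 'b::euclidean_space \<times> 'c::euclidean_space"
  shows "open S \<Longrightarrow> smooth_on S f \<Longrightarrow> smooth_on S (\<lambda>x. fst (f x))"
  by (rule smooth_on_linear_compose[where f = fst]) (auto intro: bounded_linear_fst)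

lemma smooth_on_snd:
  fixes f :: "'a::euclidean_space \<Rightarrow> 'b::euclidean_space \<times> 'c::euclidean_space"
  shows "open S \<Longrightarrow> smooth_on S f \<Longrightarrow> smooth_on S (\<lambda>x. snd (f x))"
  by (rule smooth_on_linear_compose[where f = snd]) (auto intro: bounded_linear_snd)

lemma smooth_on_ident: "smooth_on S (\<lambda>x. x)"
  by (rule smooth_on_linear) (rule bounded_linear_ident)

lemma Ck_on_realI:
  fixes f :: "real \<Rightarrow> real"
  assumes "open S" "\<And>x. x \<in> S \<Longrightarrow> (f has_real_derivative f' x) (at x)" "Ck_on k S f'"
  shows "Ck_on (Suc k) S f"
  by (rule Ck_onI[OF assms(1)], rule has_field_derivative_imp_has_derivative[OF assms(2)])
    (auto intro: Ck_on_bilinear[OF assms(1) bounded_bilinear_mult] assms(3) Ck_on_const)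

text \<open>The derivative is a multiple of another power, so the induction runs over all exponents
  at once.\<close>

lemma smooth_on_powr: "smooth_on {0<..} (\<lambda>x::real. x powr a)"
proof -
  have "Ck_on k {0<..} (\<lambda>x::real. x powr a)" for k
  proof (induction k arbitrary: a)
    case 0
    then show ?case by (auto intro!: continuous_intros)
  next
    case (Suc k)
    have *: "Ck_on k {0<..} (\<lambda>x::real. a * x powr (a - 1))"
      by (intro Ck_on_bilinear[OF _ bounded_bilinear_mult] Suc Ck_on_const) auto
    show ?case
      by (rule Ck_on_realI[OF _ _ *]) (auto intro!: derivative_eq_intros simp: powr_diff)
  qed
  then show ?thesis by (simp add: smooth_on_def)
qed

lemma smooth_on_inverse: "smooth_on (- {0}) (inverse :: real \<Rightarrow> real)"
proof -
  have "Ck_on k (- {0}) (inverse :: real \<Rightarrow> real)" for k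
  proof (induction k)
    case 0
    then show ?case by (auto intro!: continuous_intros)
  next
    case (Suc k)
    have *: "Ck_on k (- {0}) (\<lambda>x::real. (- 1) * (inverse x * inverse x))"
      by (intro Ck_on_bilinear[OF _ bounded_bilinear_mult] Suc Ck_on_const) auto
    show ?case
      by (rule Ck_on_realI[OF _ _ *]) (auto intro!: derivative_eq_intros simp: power2_eq_square)
  qed
  then show ?thesis by (simp add: smooth_on_def)
qed

lemma smooth_on_powr_compose:
  fixes f :: "'a::euclidean_space \<Rightarrow> real"
  shows "open S \<Longrightarrow> smooth_on S f \<Longrightarrow> (\<And>x. x \<in> S \<Longrightarrow> f x > 0) \<Longrightarrow> smooth_on S (\<lambda>x. f x powr a)"
  by (rule smooth_on_compose[OF _ _ smooth_on_powr]) auto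

lemma smooth_on_divide:
  fixes f :: "'a::euclidean_space \<Rightarrow> real"
  assumes "open S" "smooth_on S f" "smooth_on S g" "\<And>x. x \<in> S \<Longrightarrow> g x \<noteq> 0"
  shows "smooth_on S (\<lambda>x. f x / g x)"
  unfolding divide_inverse
  by (intro smooth_on_mult assms smooth_on_compose[OF _ _ smooth_on_inverse, of S g])
    (use assms in auto)

lemma smooth_on_det:
  fixes M :: "'a::euclidean_space \<Rightarrow> real^'n^'n::finite"
  assumes "open S" "\<And>i j. smooth_on S (\<lambda>x. M x $ i $ j)"
  shows "smooth_on S (\<lambda>x. det (M x))"
  unfolding det_def by (intro smooth_on_sum smooth_on_mult smooth_on_prod smooth_on_const assms)

lemma
  fixes M :: "real^'n^'n::finite"
  assumes "det M \<noteq> 0"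
  shows matrix_inv_right: "M ** matrix_inv M = mat 1" and matrix_inv_left: "matrix_inv M ** M = mat 1"
proof -
  have "\<exists>M'. M ** M' = mat 1 \<and> M' ** M = mat 1"
    using assms invertible_det_nz[of M] unfolding invertible_def by blast
  then have "M ** matrix_inv M = mat 1 \<and> matrix_inv M ** M = mat 1"
    unfolding matrix_inv_def by (rule someI_ex)
  then show "M ** matrix_inv M = mat 1" "matrix_inv M ** M = mat 1" by auto
qed

text \<open>Cramer's rule: the entries become quotients of determinants, so
  \<open>smooth_on_matrix_inv\<close> reduces to smoothness of polynomials and quotients.\<close>

lemma matrix_inv_nth:
  fixes M :: "real^'n^'n::finite"
  assumes "det M \<noteq> 0"
  shows "matrix_inv M $ i $ j = det (\<chi> k l. if l = i then axis j 1 $ k else M $ k $ l) / det M"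
proof -
  have "M *v (matrix_inv M *v axis j 1) = axis j 1"
    by (simp add: matrix_vector_mul_assoc matrix_inv_right[OF assms])
  then have "matrix_inv M *v axis j 1 = (\<chi> k. det (\<chi> i l. if l = k then axis j 1 $ i else M $ i $ l) / det M)"
    using cramer[OF assms] by blast
  moreover have "(matrix_inv M *v axis j 1) $ i = matrix_inv M $ i $ j"
    by (simp add: matrix_vector_mul_component inner_axis)
  ultimately show ?thesis by simp
qed

lemma smooth_on_matrix_inv:
  fixes M :: "'a::euclidean_space \<Rightarrow> real^'n^'n::finite"
  assumes "open S" "\<And>i j. smooth_on S (\<lambda>x. M x $ i $ j)" "\<And>x. x \<in> S \<Longrightarrow> det (M x) \<noteq> 0"
  shows "smooth_on S (\<lambda>x. matrix_inv (M x) $ i $ j)"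
proof -
  have "smooth_on S (\<lambda>x. det (\<chi> k l. if l = i then axis j 1 $ k else M x $ k $ l) / det (M x))"
  proof (intro smooth_on_divide smooth_on_det assms)
    show "smooth_on S (\<lambda>x. (\<chi> k l. if l = i then axis j 1 $ k else M x $ k $ l) $ k $ l)" for k l
      by (cases "l = i") (simp_all add: smooth_on_const assms(2))
  qed
  then show ?thesis
    using assms by (subst smooth_on_cong) (auto simp: matrix_inv_nth)
qed

section \<open>Symmetry of second derivatives\<close>

lemma has_real_derivative_along:
  fixes f :: "'a::real_normed_vector \<Rightarrow> real"
  assumes "(f has_derivative D) (at (c a))" "(c has_vector_derivative w) (at a)"
  shows "((\<lambda>a. f (c a)) has_real_derivative D w) (at a)"
proof -
  have "D (h *\<^sub>R w) = D w * h" for h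
    using linear_scale[OF has_derivative_linear[OF assms(1)], of h w] by simp
  then show ?thesis
    using has_derivative_compose[OF assms(2)[unfolded has_vector_derivative_def] assms(1)]
    unfolding has_field_derivative_def by (metis (no_types, lifting) ext)
qed

text \<open>The second difference is the increment in direction \<open>v\<close> of a function that
  is itself an increment in direction \<open>w\<close>. One application of the mean value theorem to
  each increment produces the iterated derivative at a nearby point.\<close>

lemma second_difference_mvt:
  fixes f :: "'a::euclidean_space \<Rightarrow> real"
  assumes f: "\<And>y. y \<in> ball x r \<Longrightarrow> (f has_derivative f' y) (at y)"
    and f'v: "\<And>y. y \<in> ball x r \<Longrightarrow> ((\<lambda>y. f' y v) has_derivative f'' y) (at y)"
    and s: "s > 0" "s * (norm v + norm w) < r"
  shows "\<exists>y\<in>cball x (s * (norm v + norm w)).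
    f (x + s *\<^sub>R v + s *\<^sub>R w) - f (x + s *\<^sub>R v) - f (x + s *\<^sub>R w) + f x = s * s * f'' y w"
proof -
  have dist: "dist x (x + a *\<^sub>R v + b *\<^sub>R w) \<le> s * (norm v + norm w)"
    if "0 \<le> a" "a \<le> s" "0 \<le> b" "b \<le> s" for a b
  proof -
    have "dist x (x + a *\<^sub>R v + b *\<^sub>R w) = norm (a *\<^sub>R v + b *\<^sub>R w)"
      by (metis add.assoc add_diff_cancel_left' dist_commute dist_norm)
    also have "\<dots> \<le> a * norm v + b * norm w"
      using norm_triangle_ineq[of "a *\<^sub>R v" "b *\<^sub>R w"] that by simp
    also have "\<dots> \<le> s * norm v + s * norm w"
      using that by (intro add_mono mult_right_mono) auto
    finally show ?thesis by (simp add: algebra_simps)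
  qed
  have inb: "x + a *\<^sub>R v + b *\<^sub>R w \<in> ball x r" if "0 \<le> a" "a \<le> s" "0 \<le> b" "b \<le> s" for a b
    using dist[OF that] s by simp
  define G where "G = (\<lambda>a. f (x + a *\<^sub>R v + s *\<^sub>R w) - f (x + a *\<^sub>R v + 0 *\<^sub>R w))"
  have Gd: "(G has_real_derivative (f' (x + a *\<^sub>R v + s *\<^sub>R w) v - f' (x + a *\<^sub>R v + 0 *\<^sub>R w) v)) (at a)"
    if "0 \<le> a" "a \<le> s" for a
  proof -
    have "((\<lambda>a. f (x + a *\<^sub>R v + b *\<^sub>R w)) has_real_derivative f' (x + a *\<^sub>R v + b *\<^sub>R w) v) (at a)"
      if "0 \<le> b" "b \<le> s" for b
      by (rule has_real_derivative_along[where c = "\<lambda>a. x + a *\<^sub>R v + b *\<^sub>R w", OF f[OF inb[OF \<open>0 \<le> a\<close> \<open>a \<le> s\<close> that]]])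
        (auto intro!: derivative_eq_intros simp: has_vector_derivative_def)
    from this[of s] this[of 0] show ?thesis
      unfolding G_def using s by (auto intro: DERIV_diff)
  qed
  obtain a where a: "0 < a" "a < s"
    "G s - G 0 = (s - 0) * (f' (x + a *\<^sub>R v + s *\<^sub>R w) v - f' (x + a *\<^sub>R v + 0 *\<^sub>R w) v)"
    using MVT2[of 0 s G, OF s(1) Gd] by blast
  have Hd: "((\<lambda>b. f' (x + a *\<^sub>R v + b *\<^sub>R w) v) has_real_derivative f'' (x + a *\<^sub>R v + b *\<^sub>R w) w) (at b)"
    if "0 \<le> b" "b \<le> s" for b
    by (rule has_real_derivative_along[where c = "\<lambda>b. x + a *\<^sub>R v + b *\<^sub>R w", OF f'v[OF inb]])
      (use a that in \<open>auto intro!: derivative_eq_intros simp: has_vector_derivative_def\<close>)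
  obtain b where b: "0 < b" "b < s"
    "f' (x + a *\<^sub>R v + s *\<^sub>R w) v - f' (x + a *\<^sub>R v + 0 *\<^sub>R w) v = (s - 0) * f'' (x + a *\<^sub>R v + b *\<^sub>R w) w"
    using MVT2[of 0 s, OF s(1) Hd] by blast
  have "x + a *\<^sub>R v + b *\<^sub>R w \<in> cball x (s * (norm v + norm w))"
    using dist[of a b] a b by simp
  moreover have "f (x + s *\<^sub>R v + s *\<^sub>R w) - f (x + s *\<^sub>R v) - f (x + s *\<^sub>R w) + f x = G s - G 0"
    by (simp add: G_def)
  ultimately show ?thesis using a b by (intro bexI) auto
qed

text \<open>The second difference is unchanged when \<open>v\<close> and \<open>w\<close> are
  swapped, and divided by \<open>s n * s n\<close> it tends to either iterated derivative, because
  these are continuous.\<close>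

lemma symmetric_second_derivative:
  fixes f :: "'a::euclidean_space \<Rightarrow> real"
  assumes "open S" "x \<in> S" "smooth_on S f"
  shows "frechet_derivative (\<lambda>y. frechet_derivative f (at y) v) (at x) w
       = frechet_derivative (\<lambda>y. frechet_derivative f (at y) w) (at x) v"
proof -
  let ?F = "\<lambda>v w y. frechet_derivative (\<lambda>y. frechet_derivative f (at y) v) (at y) w"
  obtain r where r: "r > 0" "ball x r \<subseteq> S"
    using assms openE by blast
  have d: "(f has_derivative frechet_derivative f (at y)) (at y)" if "y \<in> ball x r" for y
    by (rule smooth_on_has_derivative[OF assms(3)]) (use that r in blast)
  have d2: "((\<lambda>y. frechet_derivative f (at y) v) has_derivative (\<lambda>w. ?F v w y)) (at y)"
    if "y \<in> ball x r" for y v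
    by (rule smooth_on_has_derivative[OF smooth_on_frechet_derivative[OF assms(3)]]) (use that r in blast)
  have cont: "isCont (?F v w) x" for v w
    using smooth_on_continuous_on[OF smooth_on_frechet_derivative[OF smooth_on_frechet_derivative[OF assms(3)]]]
      continuous_on_eq_continuous_at[OF assms(1)] assms(2) by blast
  \<comment> \<open>Adding 1 keeps the denominator positive even if \<open>v\<close> and
    \<open>w\<close> are both 0; every step \<open>s n \<le> c\<close> then stays within the ball of
    radius \<open>r\<close>.\<close>
  define c where "c = r / (norm v + norm w + 1)"
  have p: "norm v + norm w + 1 > 0" by (auto intro!: add_nonneg_pos)
  have c: "c > 0" "c * (norm v + norm w) < r"
    using r p by (auto simp: c_def divide_less_eq)
  define s where "s = (\<lambda>n. c * inverse (real (Suc n)))"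
  have s0: "s n > 0" for n
    using c by (simp add: s_def)
  have slt: "s n * (norm v + norm w) < r" for n
  proof -
    have "s n \<le> c * 1"
      unfolding s_def using c by (intro mult_left_mono) (auto simp: inverse_le_1_iff)
    then have "s n * (norm v + norm w) \<le> c * (norm v + norm w)"
      by (intro mult_right_mono) auto
    with c show ?thesis by simp
  qed
  have slim: "s \<longlonglongrightarrow> 0"
    unfolding s_def using tendsto_mult_left[OF LIMSEQ_inverse_real_of_nat, of c] by simp
  define D where "D = (\<lambda>n. f (x + s n *\<^sub>R v + s n *\<^sub>R w) - f (x + s n *\<^sub>R v) - f (x + s n *\<^sub>R w) + f x)"
  have lim: "(\<lambda>n. D n / (s n * s n)) \<longlonglongrightarrow> ?F v w x"
    if D: "\<And>n. \<exists>y\<in>cball x (s n * (norm v + norm w)). D n = s n * s n * ?F v w y" for v w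
  proof -
    obtain y where y: "\<And>n. y n \<in> cball x (s n * (norm v + norm w))" "\<And>n. D n = s n * s n * ?F v w (y n)"
      using D by metis
    have "(\<lambda>n. s n * (norm v + norm w)) \<longlonglongrightarrow> 0"
      using tendsto_mult_right[OF slim, of "norm v + norm w"] by simp
    then have "(\<lambda>n. dist (y n) x) \<longlonglongrightarrow> 0"
      by (rule Lim_null_comparison[rotated]) (use y(1) in \<open>auto simp: dist_commute\<close>)
    then have "y \<longlonglongrightarrow> x" by (subst tendsto_dist_iff)
    then have "(\<lambda>n. ?F v w (y n)) \<longlonglongrightarrow> ?F v w x"
      by (rule isCont_tendsto_compose[OF cont])
    moreover have "?F v w (y n) = D n / (s n * s n)" for n
      unfolding y(2)[of n] using s0[of n] by (metis less_irrefl mult_eq_0_iff nonzero_mult_div_cancel_left)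
    ultimately show ?thesis by simp
  qed
  have "(\<lambda>n. D n / (s n * s n)) \<longlonglongrightarrow> ?F v w x"
    by (rule lim, unfold D_def, rule second_difference_mvt[OF d d2 s0 slt])
  moreover have "\<exists>y\<in>cball x (s n * (norm w + norm v)). D n = s n * s n * ?F w v y" for n
  proof -
    have "s n * (norm w + norm v) < r"
      using slt[of n] by (simp add: add.commute)
    from second_difference_mvt[OF d d2[of _ w] s0[of n] this]
    obtain y where "y \<in> cball x (s n * (norm w + norm v))" 
      "f (x + s n *\<^sub>R w + s n *\<^sub>R v) - f (x + s n *\<^sub>R w) - f (x + s n *\<^sub>R v) + f x = s n * s n * ?F w v y"
      by blast
    moreover have "x + s n *\<^sub>R w + s n *\<^sub>R v = x + s n *\<^sub>R v + s n *\<^sub>R w"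
      by (simp only: ac_simps)
    ultimately show ?thesis
      unfolding D_def by (intro bexI[of _ y]) simp_all
  qed
  from lim[OF this] have "(\<lambda>n. D n / (s n * s n)) \<longlonglongrightarrow> ?F w v x" .
  ultimately show ?thesis by (rule LIMSEQ_unique)
qed

section \<open>Change of variables\<close>

text \<open>The library states the change of variables theorem for index types of class
  \<open>wellorder\<close> only. Every finite type has a copy of that class, and reindexing
  coordinates preserves Lebesgue measure and determinants.\<close>

typedef 'm wo = "UNIV :: 'm::finite set" by simp

text \<open>A class instance belongs to a type constructor, so the order lives on the copy; it is
  pulled back from \<open>nat\<close> along an arbitrary injection.\<close>

definition wo_rank :: "'m::finite wo \<Rightarrow> nat" where
  "wo_rank x = (SOME f :: 'm \<Rightarrow> nat. inj f) (Rep_wo x)"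

lemma inj_wo_rank: "inj (wo_rank :: 'm::finite wo \<Rightarrow> nat)"
proof -
  obtain f :: "'m \<Rightarrow> nat" where "inj f"
    using finite_imp_inj_to_nat_seg[of "UNIV :: 'm set"] by auto
  then have "inj (SOME f :: 'm \<Rightarrow> nat. inj f)" using someI[of "\<lambda>f :: 'm \<Rightarrow> nat. inj f" f] by simp
  then have "Rep_wo x = Rep_wo y" if "wo_rank x = wo_rank y" for x y :: "'m wo"
    using that unfolding wo_rank_def by (rule injD)
  then show ?thesis
    by (intro injI) (simp only: Rep_wo_inject)
qed

instantiation wo :: (finite) wellorder
begin

definition "x \<le> y \<longleftrightarrow> wo_rank x \<le> wo_rank (y :: 'a wo)"
definition "x < y \<longleftrightarrow> wo_rank x < wo_rank (y :: 'a wo)"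

instance
proof
  fix P :: "'a wo \<Rightarrow> bool" and a
  assume *: "\<And>x. (\<And>y. y < x \<Longrightarrow> P y) \<Longrightarrow> P x"
  show "P a"
    by (induction "wo_rank a" arbitrary: a rule: less_induct) (auto intro: * simp: less_wo_def)
qed (use inj_wo_rank in \<open>auto simp: less_eq_wo_def less_wo_def inj_def\<close>)

end

instance wo :: (finite) finite
proof
  have "(UNIV :: 'a wo set) = range Abs_wo"
    using Abs_wo_cases by blast
  moreover have "finite (range (Abs_wo :: 'a \<Rightarrow> 'a wo))"
    by (rule finite_imageI) (rule finite)
  ultimately show "finite (UNIV :: 'a wo set)" by metis
qed

lemma bij_Abs_wo: "bij (Abs_wo :: 'm::finite \<Rightarrow> 'm wo)"
  by (rule bijI') (auto simp: Abs_wo_inject intro: Abs_wo_cases)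

lemma bij_Rep_wo: "bij (Rep_wo :: 'm::finite wo \<Rightarrow> 'm)"
  by (rule bijI') (auto simp: Rep_wo_inject intro: Abs_wo_inverse[symmetric, OF UNIV_I])

definition to_wo :: "real^'m::finite \<Rightarrow> real^'m wo" where
  "to_wo v = (\<chi> i. v $ Rep_wo i)"

definition of_wo :: "real^'m wo \<Rightarrow> real^'m::finite" where
  "of_wo v = (\<chi> i. v $ Abs_wo i)"

lemma of_wo_to_wo [simp]: "of_wo (to_wo v) = v"
  by (simp add: of_wo_def to_wo_def Abs_wo_inverse)

lemma to_wo_of_wo [simp]: "to_wo (of_wo v) = v"
  by (simp add: of_wo_def to_wo_def Rep_wo_inverse)

lemma bounded_linear_to_wo: "bounded_linear to_wo"
  by (rule linear_conv_bounded_linear[THEN iffD1]) (auto intro!: linearI simp: to_wo_def vec_eq_iff)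

lemma bounded_linear_of_wo: "bounded_linear of_wo"
  by (rule linear_conv_bounded_linear[THEN iffD1]) (auto intro!: linearI simp: of_wo_def vec_eq_iff)

lemma borel_measurable_to_wo [measurable]: "to_wo \<in> borel_measurable borel"
  by (rule borel_measurable_continuous_onI) (rule linear_continuous_on[OF bounded_linear_to_wo])

lemma borel_measurable_of_wo [measurable]: "of_wo \<in> borel_measurable borel"
  by (rule borel_measurable_continuous_onI) (rule linear_continuous_on[OF bounded_linear_of_wo])

lemma prod_Basis_cart:
  fixes f :: "real^'n::finite \<Rightarrow> real"
  shows "(\<Prod>b\<in>Basis. f b) = (\<Prod>i\<in>UNIV. f (axis i 1))"
proof -
  have "(Basis :: (real^'n) set) = range (\<lambda>i. axis i 1)"
    by (auto simp: Basis_vec_def)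
  moreover have "inj (\<lambda>i::'n. axis i (1::real))"
    by (auto simp: inj_def axis_eq_axis)
  ultimately show ?thesis
    by (metis (no_types, lifting) prod.reindex_cong)
qed

text \<open>Lebesgue measure is determined by its values on boxes, and relabelling coordinates turns
  a box into a box with the same side lengths.\<close>

lemma distr_lborel_to_wo: "distr lborel borel (to_wo :: real^'m::finite \<Rightarrow> _) = lborel"
proof (rule lborel_eqI[symmetric])
  fix l u :: "real^'m wo" assume le: "\<And>b. b \<in> Basis \<Longrightarrow> l \<bullet> b \<le> u \<bullet> b"
  have le': "l $ i \<le> u $ i" for i
    using le[of "axis i 1"] by (simp add: inner_axis)
  have "to_wo -` box l u = box (of_wo l) (of_wo u)"
  proof (intro set_eqI iffI)
    fix x assume "x \<in> to_wo -` box l u"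
    then have "l $ i < x $ Rep_wo i \<and> x $ Rep_wo i < u $ i" for i
      by (simp add: mem_box_cart to_wo_def)
    from this[of "Abs_wo j" for j] show "x \<in> box (of_wo l) (of_wo u)"
      by (simp add: mem_box_cart of_wo_def Abs_wo_inverse)
  next
    fix x assume "x \<in> box (of_wo l) (of_wo u)"
    then have "l $ Abs_wo j < x $ j \<and> x $ j < u $ Abs_wo j" for j
      by (simp add: mem_box_cart of_wo_def)
    from this[of "Rep_wo i" for i] show "x \<in> to_wo -` box l u"
      by (simp add: mem_box_cart to_wo_def Rep_wo_inverse)
  qed
  then have "emeasure (distr lborel borel to_wo) (box l u) = emeasure lborel (box (of_wo l) (of_wo u) :: (real^'m) set)"
    by (subst emeasure_distr) auto
  also have "\<dots> = (\<Prod>b\<in>Basis. (of_wo u - of_wo l) \<bullet> b)"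
    using le' by (subst emeasure_lborel_box) (auto simp: Basis_vec_def inner_axis of_wo_def)
  also have "(\<Prod>b\<in>Basis. (of_wo u - of_wo l) \<bullet> b) = (\<Prod>i\<in>UNIV. (u - l) $ Abs_wo i)"
    by (simp add: prod_Basis_cart inner_axis of_wo_def)
  also have "\<dots> = (\<Prod>b\<in>Basis. (u - l) \<bullet> b)"
    using prod.reindex_bij_betw[OF bij_Abs_wo, of "\<lambda>i. (u - l) $ i"]
    by (simp add: prod_Basis_cart inner_axis)
  finally show "emeasure (distr lborel borel to_wo) (box l u) = (\<Prod>b\<in>Basis. (u - l) \<bullet> b)" .
qed simp

text \<open>Conjugation by \<open>h\<close> is a bijection between the permutations of the two index
  types and preserves signs, so the Leibniz sums agree term by term.\<close>

lemma det_reindex: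
  fixes M :: "real^'n^'n::finite" and h :: "'m::finite \<Rightarrow> 'n"
  assumes "bij h"
  shows "det (\<chi> i j. M $ h i $ h j) = det M"
proof -
  have inv: "inv h (h x) = x" "h (inv h y) = y" for x y
    using assms by (auto simp: bij_is_inj bij_is_surj surj_f_inv_f)
  let ?F = "\<lambda>p. map_permutation UNIV h p"
  have F: "?F p = h \<circ> p \<circ> inv h" for p
    using bij_is_surj[OF assms] by (simp add: map_permutation_def restrict_id_def fun_eq_iff)
  have bij: "bij_betw ?F {p. p permutes UNIV} {p. p permutes UNIV}"
  proof (rule bij_betw_byWitness[where f' = "\<lambda>q. inv h \<circ> q \<circ> h"])
    show "?F ` {p. p permutes UNIV} \<subseteq> {p. p permutes UNIV}"
      using assms by (auto intro!: map_permutation_permutes)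
    show "(\<lambda>q. inv h \<circ> q \<circ> h) ` {p. p permutes UNIV} \<subseteq> {p. p permutes UNIV}"
    proof safe
      fix q :: "'n \<Rightarrow> 'n" assume "q permutes UNIV"
      then have "bij (inv h \<circ> q \<circ> h)"
        by (intro bij_comp bij_imp_bij_inv assms permutes_bij)
      then show "(inv h \<circ> q \<circ> h) permutes UNIV"
        by (rule bij_imp_permutes) simp
    qed
  qed (auto simp: F inv fun_eq_iff)
  have "det M = (\<Sum>q\<in>{p. p permutes UNIV}. of_int (sign q) * (\<Prod>i\<in>UNIV. M $ i $ q i))"
    by (simp add: det_def)
  also have "\<dots> = (\<Sum>p\<in>{p. p permutes UNIV}. of_int (sign (?F p)) * (\<Prod>i\<in>UNIV. M $ i $ ?F p i))"
    by (rule sum.reindex_bij_betw[OF bij, symmetric])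
  also have "\<dots> = (\<Sum>p\<in>{p. p permutes UNIV}. of_int (sign p) * (\<Prod>i\<in>UNIV. M $ h i $ h (p i)))"
  proof (rule sum.cong[OF refl])
    fix p assume "p \<in> {p. p permutes (UNIV :: 'm set)}"
    then have "sign (?F p) = sign p"
      by (intro sign_map_permutation bij_is_inj assms) auto
    moreover have "(\<Prod>i\<in>UNIV. M $ i $ ?F p i) = (\<Prod>i\<in>UNIV. M $ h i $ h (p i))"
      using prod.reindex_bij_betw[OF assms, of "\<lambda>i. M $ i $ ?F p i"] by (simp add: F inv)
    ultimately show "of_int (sign (?F p)) * (\<Prod>i\<in>UNIV. M $ i $ ?F p i)
        = of_int (sign p) * (\<Prod>i\<in>UNIV. M $ h i $ h (p i))"
      by simp
  qed
  also have "\<dots> = det (\<chi> i j. M $ h i $ h j)"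
    by (simp add: det_def)
  finally show ?thesis ..
qed

text \<open>\<open>has_measure_differentiable_image\<close> relates finite values. If the image has
  infinite measure the argument is indirect: a finite integral of the Jacobian would make the
  measure of the image finite.\<close>

lemma emeasure_differentiable_image_wo:
  fixes f :: "real^'n::{finite,wellorder} \<Rightarrow> real^'n::_"
  assumes S: "S \<in> sets borel" and fS: "f ` S \<in> sets borel"
    and f: "\<And>x. x \<in> S \<Longrightarrow> (f has_derivative f' x) (at x within S)" "inj_on f S"
    and meas: "(\<lambda>x. indicator S x * \<bar>det (matrix (f' x))\<bar>) \<in> borel_measurable borel"
  shows "emeasure lborel (f ` S) = (\<integral>\<^sup>+x. ennreal (indicator S x * \<bar>det (matrix (f' x))\<bar>) \<partial>lborel)"
proof -
  have S': "S \<in> sets lebesgue" using S by simp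
  note iff = has_measure_differentiable_image[OF S' f]
  have hi: "((\<lambda>x. \<bar>det (matrix (f' x))\<bar>) has_integral m) S
      \<longleftrightarrow> ((\<lambda>x. indicator S x * \<bar>det (matrix (f' x))\<bar>) has_integral m) UNIV" for m
    by (subst has_integral_restrict_UNIV[symmetric], rule has_integral_cong) (auto simp: indicator_def)
  show ?thesis
  proof (cases "emeasure lborel (f ` S) < \<infinity>")
    case True
    then have lm: "f ` S \<in> lmeasurable" using fS by (auto intro!: fmeasurableI)
    then have "((\<lambda>x. indicator S x * \<bar>det (matrix (f' x))\<bar>) has_integral measure lebesgue (f ` S)) UNIV"
      using iff[of "measure lebesgue (f ` S)"] hi by simp
    then have "(\<integral>\<^sup>+x. ennreal (indicator UNIV x * (indicator S x * \<bar>det (matrix (f' x))\<bar>)) \<partial>lborel) = measure lebesgue (f ` S)"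
      by (rule nn_integral_has_integral_lebesgue[rotated]) (simp add: indicator_def)
    then show ?thesis using True fS
      by (simp add: emeasure_eq_ennreal_measure)
  next
    case False
    have "(\<integral>\<^sup>+x. ennreal (indicator S x * \<bar>det (matrix (f' x))\<bar>) \<partial>lborel) = \<infinity>"
    proof (rule ccontr)
      assume "(\<integral>\<^sup>+x. ennreal (indicator S x * \<bar>det (matrix (f' x))\<bar>) \<partial>lborel) \<noteq> \<infinity>"
      then obtain r where r: "r \<ge> 0"
        "(\<integral>\<^sup>+x. ennreal (indicator S x * \<bar>det (matrix (f' x))\<bar>) \<partial>lborel) = ennreal r"
        by (cases "\<integral>\<^sup>+x. ennreal (indicator S x * \<bar>det (matrix (f' x))\<bar>) \<partial>lborel") auto
      then have "((\<lambda>x. indicator S x * \<bar>det (matrix (f' x))\<bar>) has_integral r) UNIV"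
        by (intro nn_integral_has_integral meas) auto
      then have "f ` S \<in> lmeasurable" using iff hi by blast
      then have "emeasure lebesgue (f ` S) < \<infinity>" by (auto simp: fmeasurable_def)
      with False fS show False by simp
    qed
    with False show ?thesis by (simp add: less_top[symmetric])
  qed
qed

lemma emeasure_differentiable_image:
  fixes f :: "real^'n::finite \<Rightarrow> real^'n"
  assumes S: "S \<in> sets borel" and fS: "f ` S \<in> sets borel"
    and f: "\<And>x. x \<in> S \<Longrightarrow> (f has_derivative f' x) (at x within S)" "inj_on f S"
    and meas: "(\<lambda>x. indicator S x * \<bar>det (matrix (f' x))\<bar>) \<in> borel_measurable borel"
  shows "emeasure lborel (f ` S) = (\<integral>\<^sup>+x. ennreal (indicator S x * \<bar>det (matrix (f' x))\<bar>) \<partial>lborel)"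
proof -
  define F where "F = (\<lambda>x. to_wo (f (of_wo x)))"
  define F' where "F' = (\<lambda>x v. to_wo (f' (of_wo x) (of_wo v)))"
  define T where "T = to_wo ` S"
  have pre: "to_wo ` X = of_wo -` X" for X :: "(real^'n) set"
  proof (intro set_eqI iffI)
    fix y assume "y \<in> of_wo -` X"
    then have "to_wo (of_wo y) \<in> to_wo ` X" by blast
    then show "y \<in> to_wo ` X" by simp
  qed auto
  have borel: "to_wo ` X \<in> sets borel" if "X \<in> sets borel" for X :: "(real^'n) set"
    unfolding pre using measurable_sets[OF borel_measurable_of_wo that] by simp
  have em: "emeasure lborel (to_wo ` X) = emeasure lborel X" if "X \<in> sets borel" for X :: "(real^'n) set"
  proof -
    have "to_wo -` to_wo ` X = X"
      unfolding pre by auto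
    moreover have "emeasure (distr lborel borel to_wo) (to_wo ` X)
        = emeasure lborel (to_wo -` to_wo ` X \<inter> space lborel)"
      by (rule emeasure_distr) (use borel[OF that] in auto)
    ultimately show ?thesis
      by (simp add: distr_lborel_to_wo)
  qed
  have det: "det (matrix (F' x)) = det (matrix (f' (of_wo x)))" for x
  proof -
    have "of_wo (axis j 1 :: real^'n wo) = axis (Rep_wo j) 1" for j :: "'n wo"
      by (auto simp: of_wo_def axis_def vec_eq_iff Abs_wo_inverse Rep_wo_inverse)
    then have "matrix (F' x) = (\<chi> i j. matrix (f' (of_wo x)) $ Rep_wo i $ Rep_wo j)"
      by (simp add: matrix_def F'_def to_wo_def)
    then show ?thesis using det_reindex[OF bij_Rep_wo] by simp
  qed
  have ind: "indicator T (x :: real^'n wo) = (indicator S (of_wo x) :: real)" for x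
    by (simp add: T_def pre indicator_def)
  have FT: "F ` T = to_wo ` f ` S"
    by (auto simp: F_def T_def image_iff)
  have "emeasure lborel (f ` S) = emeasure lborel (F ` T)"
    by (simp add: FT em[OF fS])
  also have "\<dots> = (\<integral>\<^sup>+x. ennreal (indicator T x * \<bar>det (matrix (F' x))\<bar>) \<partial>lborel)"
  proof (rule emeasure_differentiable_image_wo)
    show "T \<in> sets borel" "F ` T \<in> sets borel"
      using borel[OF S] borel[OF fS] by (simp_all add: T_def FT[unfolded T_def])
    show "(F has_derivative F' x) (at x within T)" if "x \<in> T" for x
    proof -
      have xS: "of_wo x \<in> S" using that by (auto simp: T_def)
      have "of_wo ` T = S" by (force simp: T_def)
      then have "(f has_derivative f' (of_wo x)) (at (of_wo x) within of_wo ` T)"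
        using f(1)[OF xS] by simp
      then have "((\<lambda>x. f (of_wo x)) has_derivative (\<lambda>v. f' (of_wo x) (of_wo v))) (at x within T)"
        using has_derivative_in_compose[OF bounded_linear_imp_has_derivative[OF bounded_linear_of_wo]] by blast
      then show ?thesis
        unfolding F_def F'_def
        by (rule bounded_linear.has_derivative[OF bounded_linear_to_wo])
    qed
    show "inj_on F T"
    proof (rule inj_onI)
      fix x y assume xy: "x \<in> T" "y \<in> T" "F x = F y"
      then have "f (of_wo x) = f (of_wo y)" unfolding F_def by (metis of_wo_to_wo)
      moreover have "of_wo x \<in> S" "of_wo y \<in> S"
        using xy(1,2) unfolding T_def by auto
      ultimately have "of_wo x = of_wo y" by (metis f(2) inj_onD)
      then show "x = y" by (metis to_wo_of_wo)
    qed
    show "(\<lambda>x. indicator T x * \<bar>det (matrix (F' x))\<bar>) \<in> borel_measurable borel"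
      unfolding det ind by (rule measurable_compose[OF borel_measurable_of_wo meas])
  qed
  also have "\<dots> = (\<integral>\<^sup>+x. ennreal (indicator S (of_wo x) * \<bar>det (matrix (f' (of_wo x)))\<bar>) \<partial>distr lborel borel to_wo)"
    by (simp add: det ind distr_lborel_to_wo)
  also have "\<dots> = (\<integral>\<^sup>+x. ennreal (indicator S x * \<bar>det (matrix (f' x))\<bar>) \<partial>lborel)"
    using measurable_compose[OF borel_measurable_of_wo meas]
    by (subst nn_integral_distr) auto
  finally show ?thesis .
qed

text \<open>Both sides integrate \<open>h\<close> against the same measure: the push-forward under
  \<open>f\<close> of the density \<open>\<bar>det (matrix (f' x))\<bar>\<close> on \<open>S\<close>
  is Lebesgue measure restricted to the image of \<open>S\<close>. Equality of the two measures is
  tested on Borel sets, where it is \<open>emeasure_differentiable_image\<close>.\<close>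

lemma nn_integral_change_of_variables:
  fixes f :: "real^'n::finite \<Rightarrow> real^'n" and h :: "real^'n \<Rightarrow> ennreal"
  assumes U: "open U" "continuous_on U f"
    and f: "\<And>x. x \<in> U \<Longrightarrow> (f has_derivative f' x) (at x)" "inj_on f U"
    and img: "\<And>X. X \<in> sets borel \<Longrightarrow> X \<subseteq> U \<Longrightarrow> f ` X \<in> sets borel"
    and cont: "continuous_on U (\<lambda>x. det (matrix (f' x)))"
    and S: "S \<in> sets borel" "S \<subseteq> U"
    and h: "(\<lambda>y. h y * indicator (f ` S) y) \<in> borel_measurable borel"
  shows "(\<integral>\<^sup>+y\<in>f ` S. h y \<partial>lborel) = (\<integral>\<^sup>+x\<in>S. ennreal \<bar>det (matrix (f' x))\<bar> * h (f x) \<partial>lborel)"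
proof -
  define D where "D = (\<lambda>x. ennreal (indicator S x * \<bar>det (matrix (f' x))\<bar>))"
  \<comment> \<open>The value 0 off \<open>S\<close> only serves to make the map Borel on the whole
    space; the density \<open>D\<close> vanishes there.\<close>
  define F where "F = (\<lambda>x. if x \<in> S then f x else 0)"
  have [measurable]: "S \<in> sets borel" by (fact S)
  have [measurable]: "F \<in> borel_measurable borel"
  proof -
    have "f \<in> borel_measurable (restrict_space borel S)"
      by (rule borel_measurable_continuous_on_restrict) (rule continuous_on_subset[OF U(2) S(2)])
    then show ?thesis
      unfolding F_def by (subst measurable_If_restrict_space_iff) auto
  qed
  have dmeas: "(\<lambda>x. indicator X x * \<bar>det (matrix (f' x))\<bar>) \<in> borel_measurable borel"
    if "X \<in> sets borel" "X \<subseteq> U" for X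
  proof -
    have "continuous_on X (\<lambda>x. \<bar>det (matrix (f' x))\<bar>)"
      using continuous_on_subset[OF cont that(2)] by (rule continuous_on_rabs)
    then show ?thesis
      using borel_measurable_continuous_on_indicator[OF that(1)] by fastforce
  qed
  have [measurable]: "D \<in> borel_measurable borel"
    unfolding D_def using dmeas[OF S] by simp
  have fS: "f ` S \<in> sets borel" using img S by blast
  have eq: "distr (density lborel D) borel F = density lborel (indicator (f ` S))"
  proof (rule measure_eqI)
    fix B assume "B \<in> sets (distr (density lborel D) borel F)"
    then have B [measurable]: "B \<in> sets borel" by simp
    define X where "X = S \<inter> F -` B"
    have X: "X \<in> sets borel" "X \<subseteq> U"
      using measurable_sets[OF \<open>F \<in> borel_measurable borel\<close> B] S by (auto simp: X_def)
    have fX: "f ` X = f ` S \<inter> B"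
      by (auto simp: X_def F_def)
    have "emeasure (distr (density lborel D) borel F) B = emeasure (density lborel D) (F -` B)"
      by (subst emeasure_distr) auto
    also have "\<dots> = (\<integral>\<^sup>+x. D x * indicator (F -` B) x \<partial>lborel)"
      using measurable_sets[OF \<open>F \<in> borel_measurable borel\<close> B] by (subst emeasure_density) auto
    also have "\<dots> = (\<integral>\<^sup>+x. ennreal (indicator X x * \<bar>det (matrix (f' x))\<bar>) \<partial>lborel)"
      by (intro nn_integral_cong) (auto simp: D_def X_def indicator_def)
    also have "\<dots> = emeasure lborel (f ` X)"
    proof (rule emeasure_differentiable_image[symmetric])
      show "(f has_derivative f' x) (at x within X)" if "x \<in> X" for x
        using f(1) X that by (blast intro: has_derivative_at_withinI)
    qed (use X img f(2) dmeas in \<open>auto intro: inj_on_subset\<close>)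
    also have "\<dots> = emeasure (density lborel (indicator (f ` S))) B"
      using fS by (simp add: fX emeasure_density indicator_inter_arith[symmetric] Int_commute)
    finally show "emeasure (distr (density lborel D) borel F) B = emeasure (density lborel (indicator (f ` S))) B" .
  qed simp
  have "(\<integral>\<^sup>+y\<in>f ` S. h y \<partial>lborel) = (\<integral>\<^sup>+y. indicator (f ` S) y * (h y * indicator (f ` S) y) \<partial>lborel)"
    by (intro nn_integral_cong) (auto simp: indicator_def)
  also have "\<dots> = (\<integral>\<^sup>+y. h y * indicator (f ` S) y \<partial>density lborel (indicator (f ` S)))"
    using fS h by (subst nn_integral_density) auto
  also have "\<dots> = (\<integral>\<^sup>+y. h y * indicator (f ` S) y \<partial>distr (density lborel D) borel F)"
    by (simp add: eq)
  also have "\<dots> = (\<integral>\<^sup>+x. h (F x) * indicator (f ` S) (F x) \<partial>density lborel D)"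
    using h by (subst nn_integral_distr) auto
  also have "\<dots> = (\<integral>\<^sup>+x. D x * (h (F x) * indicator (f ` S) (F x)) \<partial>lborel)"
    using measurable_compose[OF \<open>F \<in> borel_measurable borel\<close> h] by (subst nn_integral_density) auto
  also have "\<dots> = (\<integral>\<^sup>+x\<in>S. ennreal \<bar>det (matrix (f' x))\<bar> * h (f x) \<partial>lborel)"
    by (intro nn_integral_cong) (auto simp: D_def F_def indicator_def)
  finally show ?thesis .
qed

section \<open>Charts and transition maps\<close>

text \<open>Every matrix on the segment from the identity to \<open>M\<close> is positive definite
  and so has trivial kernel. If \<open>det M\<close> were not positive, the intermediate value
  theorem would yield a singular matrix on that segment.\<close>

lemma det_pos_of_pos_def:
  fixes M :: "real^'n^'n::finite"
  assumes "\<And>v. v \<noteq> 0 \<Longrightarrow> v \<bullet> (M *v v) > 0"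
  shows "det M > 0"
proof (rule ccontr)
  assume "\<not> det M > 0"
  define P where "P = (\<lambda>t::real. (1 - t) *\<^sub>R mat 1 + t *\<^sub>R M)"
  have ent: "P t $ i $ j = (1 - t) * (mat 1 :: real^'n^'n) $ i $ j + t * M $ i $ j" for t i j
    by (simp add: P_def)
  have "continuous_on {0..1} (\<lambda>t. det (P t))"
    unfolding det_def ent by (intro continuous_intros)
  moreover have "det (P 1) \<le> 0" "0 \<le> det (P 0)"
    using \<open>\<not> det M > 0\<close> by (simp_all add: P_def)
  ultimately obtain t where t: "0 \<le> t" "t \<le> 1" "det (P t) = 0"
    using IVT2'[of "\<lambda>t. det (P t)" 1 0 0] by auto
  then have "\<not> invertible (P t)" by (simp add: invertible_det_nz)
  then obtain v where v: "v \<noteq> 0" "P t *v v = 0"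
    using matrix_left_invertible_ker[of "P t"] invertible_left_inverse[of "P t"] by blast
  have "v \<bullet> (P t *v v) = (1 - t) * (v \<bullet> v) + t * (v \<bullet> (M *v v))"
    by (simp add: P_def matrix_vector_mult_add_rdistrib inner_add_right scaleR_matrix_vector_assoc[symmetric])
  moreover have "\<dots> > 0"
  proof (cases "t = 0")
    case False
    then show ?thesis
      using t assms[OF v(1)] by (intro add_nonneg_pos mult_pos_pos mult_nonneg_nonneg) auto
  qed (use v in simp)
  ultimately show False using v by simp
qed

locale riemannian_manifold =
  fixes A :: "('a::{t2_space,second_countable_topology}, 'm::finite) chart set"
    and g :: "('a, 'm) metric"
  assumes atlas: "smooth_atlas A" and metric: "riemannian_metric A g"
begin

lemma is_chart: "c \<in> A \<Longrightarrow> is_chart c"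
  using atlas by (auto simp: smooth_atlas_def)

lemma open_chart_dom [simp]: "c \<in> A \<Longrightarrow> open (chart_dom c)"
  and open_chart_img [simp]: "c \<in> A \<Longrightarrow> open (chart_img c)"
  and chart_homeomorphism: "c \<in> A \<Longrightarrow> homeomorphism (chart_dom c) (chart_img c) (coord c) (param c)"
  using is_chart by (auto simp: is_chart_def)

lemma param_coord [simp]: "c \<in> A \<Longrightarrow> p \<in> chart_dom c \<Longrightarrow> param c (coord c p) = p"
  and coord_param [simp]: "c \<in> A \<Longrightarrow> x \<in> chart_img c \<Longrightarrow> coord c (param c x) = x"
  and continuous_coord: "c \<in> A \<Longrightarrow> continuous_on (chart_dom c) (coord c)"
  and continuous_param: "c \<in> A \<Longrightarrow> continuous_on (chart_img c) (param c)"
  and param_in [simp]: "c \<in> A \<Longrightarrow> x \<in> chart_img c \<Longrightarrow> param c x \<in> chart_dom c"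
  using chart_homeomorphism[of c] by (auto simp: homeomorphism_def)

lemma coord_in [simp]: "p \<in> chart_dom c \<Longrightarrow> coord c p \<in> chart_img c"
  by (simp add: chart_img_def)

lemma chart_at: "chart_at A p \<in> A" "p \<in> chart_dom (chart_at A p)"
proof -
  have "p \<in> (\<Union>c\<in>A. chart_dom c)"
    using atlas unfolding smooth_atlas_def by blast
  then have "\<exists>c. c \<in> A \<and> p \<in> chart_dom c" by blast
  then have "chart_at A p \<in> A \<and> p \<in> chart_dom (chart_at A p)"
    unfolding chart_at_def by (rule someI_ex)
  then show "chart_at A p \<in> A" "p \<in> chart_dom (chart_at A p)" by auto
qed

definition overlap :: "('a, 'm) chart \<Rightarrow> ('a, 'm) chart \<Rightarrow> (real^'m) set" where
  "overlap c d = coord c ` (chart_dom c \<inter> chart_dom d)"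

lemma overlap_eq: "c \<in> A \<Longrightarrow> overlap c d = {x\<in>chart_img c. param c x \<in> chart_dom d}"
  by (force simp: overlap_def chart_img_def)

lemma open_param_vimage:
  assumes "c \<in> A" "open V"
  shows "open {x\<in>chart_img c. param c x \<in> V}"
  using continuous_open_preimage[OF continuous_param[OF assms(1)] open_chart_img[OF assms(1)] assms(2)]
  by (rule back_subst[where P = "open"]) auto

lemma open_coord_vimage:
  assumes "c \<in> A" "open V"
  shows "open {p\<in>chart_dom c. coord c p \<in> V}"
  using continuous_open_preimage[OF continuous_coord[OF assms(1)] open_chart_dom[OF assms(1)] assms(2)]
  by (rule back_subst[where P = "open"]) auto

lemma open_overlap: "c \<in> A \<Longrightarrow> d \<in> A \<Longrightarrow> open (overlap c d)"
  by (simp add: overlap_eq open_param_vimage)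

definition trans :: "('a, 'm) chart \<Rightarrow> ('a, 'm) chart \<Rightarrow> real^'m \<Rightarrow> real^'m" where
  "trans c d x = coord d (param c x)"

lemma smooth_trans: "c \<in> A \<Longrightarrow> d \<in> A \<Longrightarrow> smooth_on (overlap c d) (trans c d)"
  using atlas by (auto simp: smooth_atlas_def overlap_def trans_def[abs_def] o_def)

lemma trans_overlap: "c \<in> A \<Longrightarrow> d \<in> A \<Longrightarrow> x \<in> overlap c d \<Longrightarrow> trans c d x \<in> overlap d c"
  by (auto simp: overlap_def trans_def)

lemma trans_trans: "c \<in> A \<Longrightarrow> d \<in> A \<Longrightarrow> x \<in> overlap c d \<Longrightarrow> trans d c (trans c d x) = x"
  by (auto simp: overlap_def trans_def)

lemma coord_overlap: "p \<in> chart_dom c \<Longrightarrow> p \<in> chart_dom d \<Longrightarrow> coord c p \<in> overlap c d"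
  by (auto simp: overlap_def)

lemma trans_coord: "c \<in> A \<Longrightarrow> p \<in> chart_dom c \<Longrightarrow> trans c d (coord c p) = coord d p"
  by (simp add: trans_def)

definition dtrans :: "('a, 'm) chart \<Rightarrow> ('a, 'm) chart \<Rightarrow> real^'m \<Rightarrow> real^'m \<Rightarrow> real^'m" where
  "dtrans c d x = frechet_derivative (trans c d) (at x)"

lemma trans_has_derivative:
  "c \<in> A \<Longrightarrow> d \<in> A \<Longrightarrow> x \<in> overlap c d \<Longrightarrow> (trans c d has_derivative dtrans c d x) (at x)"
  unfolding dtrans_def by (rule smooth_on_has_derivative[OF smooth_trans])

lemma transition_jacobian: "transition_jacobian c d p = matrix (dtrans c d (coord c p))"
  by (simp add: transition_jacobian_def jacobian_def dtrans_def trans_def[abs_def] o_def)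

lemma transition_jacobian_mult:
  assumes "c \<in> A" "d \<in> A" "p \<in> chart_dom c" "p \<in> chart_dom d"
  shows "transition_jacobian c d p *v v = dtrans c d (coord c p) v"
proof -
  have "linear (dtrans c d (coord c p))"
    by (rule has_derivative_linear[OF trans_has_derivative]) (use assms coord_overlap in auto)
  then show ?thesis by (simp add: transition_jacobian)
qed

lemma dtrans_dtrans:
  assumes "c \<in> A" "d \<in> A" "x \<in> overlap c d"
  shows "dtrans d c (trans c d x) (dtrans c d x v) = v"
proof -
  have "((\<lambda>x. trans d c (trans c d x)) has_derivative (\<lambda>v. dtrans d c (trans c d x) (dtrans c d x v))) (at x)"
    by (rule has_derivative_compose[OF trans_has_derivative trans_has_derivative])
      (use assms trans_overlap in auto)
  then have "((\<lambda>x. x) has_derivative (\<lambda>v. dtrans d c (trans c d x) (dtrans c d x v))) (at x)"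
    by (rule has_derivative_transform_within_open[OF _ open_overlap[OF assms(1,2)] assms(3)])
      (use assms trans_trans in auto)
  then have "(\<lambda>v. dtrans d c (trans c d x) (dtrans c d x v)) = (\<lambda>x. x)"
    using has_derivative_unique has_derivative_ident by blast
  then show ?thesis by metis
qed

lemma transition_jacobian_inverse:
  assumes "c \<in> A" "d \<in> A" "p \<in> chart_dom c" "p \<in> chart_dom d"
  shows "transition_jacobian d c p ** transition_jacobian c d p = mat 1"
proof -
  have "dtrans d c (coord d p) (dtrans c d (coord c p) v) = v" for v
    using dtrans_dtrans[OF assms(1,2) coord_overlap[OF assms(3,4)]] assms by (simp add: trans_coord)
  then have "(transition_jacobian d c p ** transition_jacobian c d p) *v v = mat 1 *v v" for v
    using assms by (simp add: matrix_vector_mul_assoc[symmetric] transition_jacobian_mult)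
  then show ?thesis by (metis matrix_eq)
qed

lemma metric_trans:
  assumes "c \<in> A" "d \<in> A" "p \<in> chart_dom c" "p \<in> chart_dom d"
  shows "g p c = transpose (transition_jacobian c d p) ** g p d ** transition_jacobian c d p"
  using metric assms unfolding riemannian_metric_def by blast

lemma metric_pos: "c \<in> A \<Longrightarrow> p \<in> chart_dom c \<Longrightarrow> v \<noteq> 0 \<Longrightarrow> v \<bullet> (g p c *v v) > 0"
  and metric_smooth: "c \<in> A \<Longrightarrow> smooth_on (chart_img c) (\<lambda>x. g (param c x) c)"
  using metric unfolding riemannian_metric_def by blast+

lemma metric_smooth_nth: "c \<in> A \<Longrightarrow> smooth_on (chart_img c) (\<lambda>x. g (param c x) c $ i $ j)"
  by (intro smooth_on_vec_nth metric_smooth) auto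

lemma det_metric_pos: "c \<in> A \<Longrightarrow> p \<in> chart_dom c \<Longrightarrow> det (g p c) > 0"
  by (rule det_pos_of_pos_def) (rule metric_pos)

section \<open>The Riemannian measure\<close>

definition dens :: "('a, 'm) chart \<Rightarrow> real^'m \<Rightarrow> real" where
  "dens c x = sqrt (det (g (param c x) c))"

lemma dens_pos: "c \<in> A \<Longrightarrow> x \<in> chart_img c \<Longrightarrow> dens c x > 0"
  by (simp add: dens_def det_metric_pos)

lemma smooth_dens: "c \<in> A \<Longrightarrow> smooth_on (chart_img c) (dens c)"
proof -
  assume c: "c \<in> A"
  have "smooth_on (chart_img c) (\<lambda>x. det (g (param c x) c) powr (1/2))"
    by (intro smooth_on_powr_compose smooth_on_det metric_smooth_nth)
      (use c in \<open>auto intro: det_metric_pos\<close>)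
  then show ?thesis
    by (subst smooth_on_cong) (use c in \<open>auto simp: dens_def powr_half_sqrt less_imp_le det_metric_pos\<close>)
qed

text \<open>The Gram determinant changes by the square of the Jacobian determinant, its root by the
  absolute value: exactly the factor in the change of variables formula.\<close>

lemma dens_trans:
  assumes "c \<in> A" "d \<in> A" "x \<in> overlap c d"
  shows "dens c x = \<bar>det (matrix (dtrans c d x))\<bar> * dens d (trans c d x)"
proof -
  have x: "x \<in> chart_img c" "param c x \<in> chart_dom d"
    using assms by (auto simp: overlap_eq)
  have "g (param c x) c = transpose (matrix (dtrans c d x)) ** g (param c x) d ** matrix (dtrans c d x)"
    using metric_trans[OF assms(1,2), of "param c x"] x assms by (simp add: transition_jacobian)
  moreover have "param d (trans c d x) = param c x"
    using x assms by (simp add: trans_def)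
  ultimately show ?thesis
    by (simp add: dens_def det_mul real_sqrt_mult mult_ac)
qed

lemma coord_image_eq: "c \<in> A \<Longrightarrow> S \<subseteq> chart_dom c \<Longrightarrow> coord c ` S = {x\<in>chart_img c. param c x \<in> S}"
  by (force simp: chart_img_def)

lemma borel_vimage_on_open:
  fixes k :: "'b::topological_space \<Rightarrow> 'c::topological_space"
  assumes "continuous_on V k" "open V" "X \<in> sets borel"
  shows "{y\<in>V. k y \<in> X} \<in> sets borel"
proof -
  have "k \<in> borel_measurable (restrict_space borel V)"
    by (rule borel_measurable_continuous_on_restrict[OF assms(1)])
  from measurable_sets[OF this assms(3)]
  have "k -` X \<inter> V \<in> sets (restrict_space borel V)" by (simp add: space_restrict_space)
  then have "k -` X \<inter> V \<in> sets borel"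
    using assms(2) by (subst (asm) sets_restrict_space_iff) auto
  moreover have "k -` X \<inter> V = {y\<in>V. k y \<in> X}" by auto
  ultimately show ?thesis by simp
qed

lemma borel_coord_image:
  assumes "c \<in> A" "S \<in> sets borel" "S \<subseteq> chart_dom c"
  shows "coord c ` S \<in> sets borel"
  unfolding coord_image_eq[OF assms(1,3)]
  by (rule borel_vimage_on_open[OF continuous_param]) (use assms in auto)

text \<open>The coordinate measure of one chart, pushed to the manifold and extended by zero. The
  value \<open>undefined\<close> merely makes the map total; the density is 0 outside the chart
  image.\<close>

definition chart_vol :: "('a, 'm) chart \<Rightarrow> 'a measure" where
  "chart_vol c = distr (density lborel (\<lambda>x. ennreal (indicator (chart_img c) x * dens c x))) borel
     (\<lambda>x. if x \<in> chart_img c then param c x else undefined)"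

lemma borel_measurable_dens:
  assumes "c \<in> A" shows "(\<lambda>x. indicator (chart_img c) x * dens c x) \<in> borel_measurable borel"
  using borel_measurable_continuous_on_indicator[OF _ smooth_on_continuous_on[OF smooth_dens[OF assms]]] assms
  by fastforce

lemma borel_measurable_param:
  assumes "c \<in> A" shows "(\<lambda>x. if x \<in> chart_img c then param c x else undefined) \<in> borel_measurable borel"
  using borel_measurable_continuous_on_restrict[OF continuous_param[OF assms]] assms
  by (subst measurable_If_restrict_space_iff) auto

lemma sets_chart_vol [simp]: "sets (chart_vol c) = sets borel"
  by (simp add: chart_vol_def)

lemma emeasure_chart_vol:
  assumes c: "c \<in> A" and S: "S \<in> sets borel"
  shows "emeasure (chart_vol c) S = (\<integral>\<^sup>+x\<in>coord c ` (S \<inter> chart_dom c). ennreal (dens c x) \<partial>lborel)"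
proof -
  let ?k = "\<lambda>x. if x \<in> chart_img c then param c x else undefined"
  note [measurable] = borel_measurable_param[OF c] borel_measurable_dens[OF c]
  have "emeasure (chart_vol c) S = emeasure (density lborel (\<lambda>x. ennreal (indicator (chart_img c) x * dens c x))) (?k -` S)"
    unfolding chart_vol_def using S by (subst emeasure_distr) auto
  also have "\<dots> = (\<integral>\<^sup>+x. ennreal (indicator (chart_img c) x * dens c x) * indicator (?k -` S) x \<partial>lborel)"
    using measurable_sets[OF borel_measurable_param[OF c] S] by (subst emeasure_density) auto
  also have "\<dots> = (\<integral>\<^sup>+x\<in>coord c ` (S \<inter> chart_dom c). ennreal (dens c x) \<partial>lborel)"
    unfolding coord_image_eq[OF c Int_lower2]
    by (intro nn_integral_cong) (use c in \<open>auto simp: indicator_def\<close>)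
  finally show ?thesis .
qed

text \<open>Change of variables along \<open>trans c d\<close>, after which
  \<open>dens_trans\<close> identifies the integrands.\<close>

lemma chart_vol_indep:
  assumes cd: "c \<in> A" "d \<in> A" and S: "S \<in> sets borel" "S \<subseteq> chart_dom c \<inter> chart_dom d"
  shows "emeasure (chart_vol c) S = emeasure (chart_vol d) S"
proof -
  have eq: "S \<inter> chart_dom c = S" "S \<inter> chart_dom d = S" using S by auto
  let ?X = "coord c ` S"
  have im: "trans c d ` ?X = coord d ` S"
    using S cd by (force simp: trans_def image_image)
  have dS: "coord d ` S \<in> sets borel" using borel_coord_image cd S by auto
  have h0: "(\<lambda>y. dens d y * indicator (coord d ` S) y) \<in> borel_measurable borel"
  proof -
    have "continuous_on (coord d ` S) (dens d)"
      by (rule continuous_on_subset[OF smooth_on_continuous_on[OF smooth_dens]]) (use cd S in auto)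
    from borel_measurable_continuous_on_indicator[OF dS this]
    show ?thesis by (simp add: mult.commute)
  qed
  have h: "(\<lambda>y. ennreal (dens d y) * indicator (coord d ` S) y) \<in> borel_measurable borel"
  proof -
    have "(\<lambda>y. ennreal (dens d y * indicator (coord d ` S) y)) \<in> borel_measurable borel"
      using h0 by simp
    moreover have "(\<lambda>y. ennreal (dens d y * indicator (coord d ` S) y)) = (\<lambda>y. ennreal (dens d y) * indicator (coord d ` S) y)"
      by (auto simp: fun_eq_iff indicator_def)
    ultimately show ?thesis by simp
  qed
  have "(\<integral>\<^sup>+y\<in>coord d ` S. ennreal (dens d y) \<partial>lborel)
      = (\<integral>\<^sup>+x\<in>?X. ennreal \<bar>det (matrix (dtrans c d x))\<bar> * ennreal (dens d (trans c d x)) \<partial>lborel)"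
    unfolding im[symmetric]
  proof (rule nn_integral_change_of_variables[OF open_overlap[OF cd]])
    show "continuous_on (overlap c d) (trans c d)"
      by (rule smooth_on_continuous_on[OF smooth_trans[OF cd]])
    show "inj_on (trans c d) (overlap c d)"
      by (rule inj_on_inverseI[of _ "trans d c"]) (use cd trans_trans in auto)
    show "trans c d ` X \<in> sets borel" if X: "X \<in> sets borel" "X \<subseteq> overlap c d" for X
    proof -
      have "trans c d ` X = {y\<in>overlap d c. trans d c y \<in> X}"
        using X(2) trans_trans[OF cd] trans_trans[OF cd(2,1)] trans_overlap[OF cd] by force
      then show ?thesis
        using borel_vimage_on_open[OF smooth_on_continuous_on[OF smooth_trans[OF cd(2,1)]] open_overlap[OF cd(2,1)] X(1)]
        by simp
    qed
    have "smooth_on (overlap c d) (\<lambda>x. det (matrix (dtrans c d x)))"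
      unfolding matrix_def dtrans_def
      by (rule smooth_on_det[OF open_overlap[OF cd]])
        (simp add: smooth_on_vec_nth smooth_on_frechet_derivative smooth_trans open_overlap cd)
    then show "continuous_on (overlap c d) (\<lambda>x. det (matrix (dtrans c d x)))"
      by (rule smooth_on_continuous_on)
    show "?X \<in> sets borel" using borel_coord_image cd S by auto
    show "?X \<subseteq> overlap c d" using S by (auto simp: overlap_def)
    show "(\<lambda>y. ennreal (dens d y) * indicator (trans c d ` coord c ` S) y) \<in> borel_measurable borel"
      using h by (simp add: im)
  qed (rule trans_has_derivative[OF cd])
  also have "\<dots> = (\<integral>\<^sup>+x\<in>?X. ennreal (dens c x) \<partial>lborel)"
  proof (intro nn_integral_cong)
    fix x
    show "ennreal \<bar>det (matrix (dtrans c d x))\<bar> * ennreal (dens d (trans c d x)) * indicator ?X x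
        = ennreal (dens c x) * indicator ?X x"
    proof (cases "x \<in> ?X")
      case True
      then have "x \<in> overlap c d" using S by (auto simp: overlap_def)
      then show ?thesis
        using dens_trans[OF cd] dens_pos[OF cd(2)] trans_overlap[OF cd, of x]
        by (auto simp: ennreal_mult' overlap_eq cd)
    qed simp
  qed
  finally show ?thesis
    by (simp add: emeasure_chart_vol cd S eq)
qed

text \<open>The property that \<open>volume_measure\<close> describes, with the coordinate integral
  replaced by the measure \<open>chart_vol c\<close>, whose additivity is then at hand.\<close>

definition is_volume :: "'a measure \<Rightarrow> bool" where
  "is_volume \<mu> \<longleftrightarrow> sets \<mu> = sets borel \<and>
     (\<forall>c\<in>A. \<forall>S\<in>sets borel. S \<subseteq> chart_dom c \<longrightarrow> emeasure \<mu> S = emeasure (chart_vol c) S)"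

end

section \<open>The volume of a compact manifold\<close>

locale compact_riemannian_manifold = riemannian_manifold A g
  for A :: "('a::{t2_space,second_countable_topology}, 'm::finite) chart set"
    and g :: "('a, 'm) metric" +
  assumes compact_UNIV: "compact (UNIV :: 'a set)"
begin

lemma finite_chart_cover: "\<exists>cs. set cs \<subseteq> A \<and> (\<Union>c\<in>set cs. chart_dom c) = UNIV"
proof -
  have "UNIV \<subseteq> (\<Union>c\<in>A. chart_dom c)"
    using atlas unfolding smooth_atlas_def by blast
  then obtain C where C: "C \<subseteq> A" "finite C" "UNIV \<subseteq> (\<Union>c\<in>C. chart_dom c)"
    by (rule compactE_image[OF compact_UNIV open_chart_dom, rotated])
  moreover obtain cs where "set cs = C" using finite_list[OF C(2)] by blast
  ultimately show ?thesis by blast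
qed

text \<open>A finite chart cover is cut into disjoint Borel pieces, and a set is measured piece by
  piece, each time in the chart of the piece. By \<open>chart_vol_indep\<close> the result agrees
  with every chart; additivity over the same pieces forces uniqueness.\<close>

lemma volume_exists_unique: "\<exists>!\<mu>. is_volume \<mu>"
proof -
  obtain cs where cs: "set cs \<subseteq> A" "(\<Union>c\<in>set cs. chart_dom c) = UNIV"
    using finite_chart_cover by blast
  define n where "n = length cs"
  \<comment> \<open>\<open>disjointed\<close> acts on sequences, so the finite list of chart domains
    is continued by empty sets.\<close>
  define U where "U = (\<lambda>i. if i < n then chart_dom (cs ! i) else {})"
  define B where "B = disjointed U"
  have cA: "cs ! i \<in> A" if "i < n" for i using cs that by (auto simp: n_def)
  have U: "range U \<subseteq> sets borel"
    using cA by (auto simp: U_def)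
  have B: "B i \<in> sets borel" "B i \<subseteq> U i" for i
    using sets.range_disjointed_sets[OF U] disjointed_subset[of U i] by (auto simp: B_def)
  have Bdom: "i < n \<Longrightarrow> B i \<subseteq> chart_dom (cs ! i)" for i
    using B(2)[of i] by (simp add: U_def)
  have disj: "disjoint_family_on B {..<n}"
    using disjoint_family_disjointed[of U] by (auto simp: B_def disjoint_family_on_def)
  have cover: "(\<Union>i<n. B i) = UNIV"
  proof -
    have "(\<Union>i. B i) = (\<Union>i. U i)" by (simp add: B_def UN_disjointed_eq)
    also have "\<dots> = UNIV"
    proof (intro set_eqI iffI UNIV_I)
      fix p :: 'a
      obtain c where "c \<in> set cs" "p \<in> chart_dom c" using cs(2) by blast
      then obtain i where "i < n" "p \<in> U i" by (metis U_def in_set_conv_nth n_def)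
      then show "p \<in> (\<Union>i. U i)" by blast
    qed
    moreover have "B i = {}" if "\<not> i < n" for i
      using B(2)[of i] that by (simp add: U_def)
    then have "(\<Union>i. B i) = (\<Union>i<n. B i)" by blast
    ultimately show ?thesis by simp
  qed
  have split: "emeasure \<mu> S = (\<Sum>i<n. emeasure \<mu> (S \<inter> B i))"
    if "sets \<mu> = sets borel" "S \<in> sets borel" for \<mu> :: "'a measure" and S
  proof -
    have "(\<Sum>i<n. emeasure \<mu> (S \<inter> B i)) = emeasure \<mu> (\<Union>i<n. S \<inter> B i)"
    proof (rule sum_emeasure)
      show "disjoint_family_on (\<lambda>i. S \<inter> B i) {..<n}"
        using disj unfolding disjoint_family_on_def by blast
    qed (use that B in auto)
    moreover have "(\<Union>i<n. S \<inter> B i) = S" using cover by auto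
    ultimately show ?thesis by simp
  qed
  define m where "m = (\<lambda>S. \<Sum>i<n. emeasure (chart_vol (cs ! i)) (S \<inter> B i))"
  define \<mu> where "\<mu> = measure_of UNIV (sets borel) m"
  have sets\<mu>: "sets \<mu> = sets borel"
    unfolding \<mu>_def using sets.sigma_sets_eq[of borel] by (subst sets_measure_of) auto
  have em: "emeasure \<mu> S = m S" if "S \<in> sets borel" for S
  proof (rule emeasure_measure_of_sigma[of UNIV "sets borel" m, folded \<mu>_def])
    show "sigma_algebra UNIV (sets (borel :: 'a measure))"
      using sets.sigma_algebra_axioms[of borel] by simp
    show "positive (sets borel) m" by (simp add: positive_def m_def)
    show "countably_additive (sets borel) m"
    proof (rule countably_additiveI)
      fix F :: "nat \<Rightarrow> 'a set"
      assume F: "range F \<subseteq> sets borel" "disjoint_family F"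
      have "(\<Sum>k. m (F k)) = (\<Sum>i<n. \<Sum>k. emeasure (chart_vol (cs ! i)) (F k \<inter> B i))"
        unfolding m_def by (rule suminf_sum) simp
      also have "\<dots> = (\<Sum>i<n. emeasure (chart_vol (cs ! i)) (\<Union>k. F k \<inter> B i))"
        by (intro sum.cong refl suminf_emeasure) (use F B in \<open>auto simp: disjoint_family_on_def\<close>)
      also have "\<dots> = m (\<Union>k. F k)" by (simp add: m_def)
      finally show "(\<Sum>k. m (F k)) = m (\<Union> (range F))" .
    qed
  qed (fact that)
  have vol: "is_volume \<mu>"
    unfolding is_volume_def
  proof (intro conjI ballI impI sets\<mu>)
    fix c S assume c: "c \<in> A" and S: "S \<in> sets borel" "S \<subseteq> chart_dom c"
    have "emeasure (chart_vol (cs ! i)) (S \<inter> B i) = emeasure (chart_vol c) (S \<inter> B i)" if "i < n" for i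
      by (rule chart_vol_indep[OF cA[OF that] c]) (use S B Bdom[OF that] in auto)
    then show "emeasure \<mu> S = emeasure (chart_vol c) S"
      by (simp add: em S m_def split[of "chart_vol c"])
  qed
  moreover have "\<nu> = \<mu>" if "is_volume \<nu>" for \<nu>
  proof (rule measure_eqI)
    show "sets \<nu> = sets \<mu>" using that sets\<mu> by (simp add: is_volume_def)
    fix S assume "S \<in> sets \<nu>"
    then have S: "S \<in> sets borel" using that by (simp add: is_volume_def)
    have "emeasure \<nu> (S \<inter> B i) = emeasure \<mu> (S \<inter> B i)" if "i < n" for i
      using \<open>is_volume \<nu>\<close> vol cA[OF that] S B(1)[of i] Bdom[OF that] unfolding is_volume_def
      by (metis (no_types, lifting) inf.coboundedI2 sets.Int)
    then show "emeasure \<nu> S = emeasure \<mu> S"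
      using that sets\<mu> S by (subst (1 2) split) (auto simp: is_volume_def)
  qed
  ultimately show ?thesis by blast
qed

abbreviation vol :: "'a measure" where
  "vol \<equiv> volume_measure A g"

lemma is_volume_vol: "is_volume vol"
proof -
  have "is_volume \<mu> \<longleftrightarrow> sets \<mu> = sets borel \<and>
     (\<forall>c\<in>A. \<forall>S\<in>sets borel. S \<subseteq> chart_dom c \<longrightarrow>
        emeasure \<mu> S = (\<integral>\<^sup>+x\<in>coord c ` S. ennreal (sqrt (det (g (param c x) c))) \<partial>lborel))" for \<mu>
    unfolding is_volume_def by (auto simp: emeasure_chart_vol Int_absorb2 dens_def)
  then have "vol = (THE \<mu>. is_volume \<mu>)"
    unfolding volume_measure_def by presburger
  then show ?thesis using theI'[OF volume_exists_unique] by simp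
qed

lemma sets_vol [simp, measurable_cong]: "sets vol = sets borel"
  and space_vol [simp]: "space vol = UNIV"
  using is_volume_vol sets_eq_imp_space_eq[of vol borel] by (auto simp: is_volume_def)

lemma emeasure_vol: "c \<in> A \<Longrightarrow> S \<in> sets borel \<Longrightarrow> S \<subseteq> chart_dom c \<Longrightarrow> emeasure vol S = emeasure (chart_vol c) S"
  using is_volume_vol by (auto simp: is_volume_def)

text \<open>Restricted to the chart domain, \<open>vol\<close> is \<open>chart_vol c\<close>, so a
  function that vanishes elsewhere is integrated in coordinates.\<close>

lemma integral_vol_chart:
  fixes h :: "'a \<Rightarrow> real"
  assumes c: "c \<in> A" and h: "h \<in> borel_measurable borel" "\<And>p. p \<notin> chart_dom c \<Longrightarrow> h p = 0"
  shows "integral\<^sup>L vol h = (LINT x|lborel. indicator (chart_img c) x * (dens c x * h (param c x)))"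
proof -
  let ?k = "\<lambda>x. if x \<in> chart_img c then param c x else undefined"
  note [measurable] = borel_measurable_param[OF c] borel_measurable_dens[OF c] h(1)
  have dom [measurable]: "chart_dom c \<in> sets borel" using c by auto
  have "density vol (\<lambda>p. ennreal (indicator (chart_dom c) p)) = chart_vol c"
  proof (rule measure_eqI)
    fix S assume "S \<in> sets (density vol (\<lambda>p. ennreal (indicator (chart_dom c) p)))"
    then have S [measurable]: "S \<in> sets borel" by simp
    have "emeasure (density vol (\<lambda>p. ennreal (indicator (chart_dom c) p))) S = (\<integral>\<^sup>+p. indicator (S \<inter> chart_dom c) p \<partial>vol)"
    proof (subst emeasure_density)
      show "(\<integral>\<^sup>+p\<in>S. ennreal (indicator (chart_dom c) p) \<partial>vol) = (\<integral>\<^sup>+p. indicator (S \<inter> chart_dom c) p \<partial>vol)"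
        by (rule nn_integral_cong) (simp split: split_indicator)
    qed auto
    also have "\<dots> = emeasure vol (S \<inter> chart_dom c)"
      by (subst nn_integral_indicator) auto
    also have "\<dots> = emeasure (chart_vol c) (S \<inter> chart_dom c)"
      by (rule emeasure_vol[OF c]) auto
    also have "\<dots> = emeasure (chart_vol c) S"
      by (simp add: emeasure_chart_vol c Int_assoc)
    finally show "emeasure (density vol (\<lambda>p. ennreal (indicator (chart_dom c) p))) S = emeasure (chart_vol c) S" .
  qed simp
  moreover have "integral\<^sup>L vol h = integral\<^sup>L (density vol (\<lambda>p. ennreal (indicator (chart_dom c) p))) h"
    by (subst integral_density) (auto intro!: Bochner_Integration.integral_cong simp: h(2) indicator_def)
  moreover have "integral\<^sup>L (chart_vol c) h
      = (LINT x|density lborel (\<lambda>x. ennreal (indicator (chart_img c) x * dens c x)). h (?k x))"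
    unfolding chart_vol_def by (rule integral_distr) auto
  moreover have "\<dots> = (LINT x|lborel. (indicator (chart_img c) x * dens c x) *\<^sub>R h (?k x))"
  proof (rule integral_density)
    show "AE x in lborel. 0 \<le> indicator (chart_img c) x * dens c x"
      by (rule AE_I2) (simp add: indicator_def less_imp_le[OF dens_pos[OF c]])
  qed measurable
  moreover have "\<dots> = (LINT x|lborel. indicator (chart_img c) x * (dens c x * h (param c x)))"
    by (rule Bochner_Integration.integral_cong) (auto simp: indicator_def)
  ultimately show ?thesis by simp
qed

text \<open>A density can be unbounded towards the edge of its chart image, but it is bounded on
  compact sets. Finiteness of \<open>vol\<close> follows by covering the manifold with finitely many
  compact sets, each inside a chart.\<close>

lemma emeasure_vol_compact_chart:
  assumes c: "c \<in> A" and K: "compact K" "K \<subseteq> chart_dom c"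
  shows "emeasure vol K < \<infinity>"
proof -
  have K': "K \<in> sets borel" using compact_imp_closed[OF K(1)] by auto
  have cK: "compact (coord c ` K)"
    by (rule compact_continuous_image[OF continuous_on_subset[OF continuous_coord[OF c] K(2)] K(1)])
  have sub: "coord c ` K \<subseteq> chart_img c" using K(2) by auto
  have "compact (dens c ` coord c ` K)"
    by (rule compact_continuous_image[OF continuous_on_subset[OF smooth_on_continuous_on[OF smooth_dens[OF c]] sub] cK])
  then obtain b where b: "\<And>x. x \<in> coord c ` K \<Longrightarrow> \<bar>dens c x\<bar> \<le> b"
    using compact_imp_bounded bounded_iff[of "dens c ` coord c ` K"] by (metis imageI real_norm_def)
  have "emeasure vol K = (\<integral>\<^sup>+x\<in>coord c ` K. ennreal (dens c x) \<partial>lborel)"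
    using emeasure_vol[OF c K' K(2)] emeasure_chart_vol[OF c K'] K(2) by (simp add: Int_absorb2)
  also have "\<dots> \<le> (\<integral>\<^sup>+x. ennreal b * indicator (coord c ` K) x \<partial>lborel)"
    by (rule nn_integral_mono) (use b in \<open>force simp: indicator_def intro: ennreal_leI\<close>)
  also have "\<dots> = ennreal b * emeasure lborel (coord c ` K)"
    by (subst nn_integral_cmult_indicator) (use borel_coord_image c K' K in auto)
  also have "\<dots> < \<infinity>"
    using emeasure_compact_finite[OF cK] by (simp add: ennreal_mult_less_top)
  finally show ?thesis .
qed

lemma compact_chart_nbhd:
  obtains c K where "c \<in> A" "compact K" "K \<subseteq> chart_dom c" "p \<in> interior K"
proof -
  let ?c = "chart_at A p"
  note c = chart_at[of p]
  obtain r where r: "r > 0" "cball (coord ?c p) r \<subseteq> chart_img ?c"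
    using open_contains_cball c by (metis coord_in open_chart_img)
  define K where "K = param ?c ` cball (coord ?c p) r"
  have "compact K"
    unfolding K_def by (rule compact_continuous_image[OF continuous_on_subset[OF continuous_param[OF c(1)] r(2)]]) simp
  moreover have "K \<subseteq> chart_dom ?c" using r c by (auto simp: K_def)
  moreover have "p \<in> interior K"
  proof (rule interiorI)
    show "open {q\<in>chart_dom ?c. coord ?c q \<in> ball (coord ?c p) r}"
      by (rule open_coord_vimage[OF c(1)]) simp
    show "p \<in> {q\<in>chart_dom ?c. coord ?c q \<in> ball (coord ?c p) r}" using c r by simp
    show "{q\<in>chart_dom ?c. coord ?c q \<in> ball (coord ?c p) r} \<subseteq> K"
    proof
      fix q assume q: "q \<in> {q\<in>chart_dom ?c. coord ?c q \<in> ball (coord ?c p) r}"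
      then have "q = param ?c (coord ?c q)" using c by simp
      then show "q \<in> K" using q unfolding K_def by (metis (no_types, lifting) ball_subset_cball image_eqI mem_Collect_eq subsetD)
    qed
  qed
  ultimately show ?thesis using that c by blast
qed

sublocale vol: finite_measure vol
proof
  have "\<exists>K. p \<in> interior K \<and> emeasure vol K < \<infinity> \<and> K \<in> sets borel" for p :: 'a
  proof -
    obtain c K where K: "c \<in> A" "compact K" "K \<subseteq> chart_dom c" "p \<in> interior K"
      by (rule compact_chart_nbhd)
    then show ?thesis
      using emeasure_vol_compact_chart[OF K(1-3)] borel_closed[OF compact_imp_closed[OF K(2)]] by blast
  qed
  then obtain K where K: "\<And>p. p \<in> interior (K p)" "\<And>p. emeasure vol (K p) < \<infinity>" "\<And>p. K p \<in> sets borel"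
    by metis
  obtain F where F: "finite F" "UNIV \<subseteq> (\<Union>p\<in>F. interior (K p))"
  proof (rule compactE_image[OF compact_UNIV, of UNIV "\<lambda>p. interior (K p)"])
    show "UNIV \<subseteq> (\<Union>p. interior (K p))" using K(1) by blast
  qed auto
  have "emeasure vol (space vol) \<le> emeasure vol (\<Union>p\<in>F. K p)"
    using F interior_subset K(3) by (intro emeasure_mono) (auto, blast)
  also have "\<dots> \<le> (\<Sum>p\<in>F. emeasure vol (K p))"
    by (rule emeasure_subadditive_finite) (use F K in auto)
  also have "\<dots> < \<infinity>" using K(2) F by simp
  finally show "emeasure vol (space vol) \<noteq> \<infinity>" by simp
qed

lemma integrable_vol_continuous:
  fixes h :: "'a \<Rightarrow> real"
  assumes "continuous_on UNIV h"
  shows "integrable vol h"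
proof -
  obtain b where "\<And>p. \<bar>h p\<bar> \<le> b"
    using compact_imp_bounded[OF compact_continuous_image[OF assms compact_UNIV]]
    by (auto simp: bounded_iff)
  then show ?thesis
    by (intro vol.integrable_const_bound[of _ b]) (use borel_measurable_continuous_onI[OF assms] in auto)
qed

text \<open>A nonempty open set meets some chart in an open set, where the density is positive. This
  makes the integral of \<lambda>^2 positive as soon as \<lambda> is nonzero at one point.\<close>

lemma emeasure_vol_open_pos:
  assumes "open V" "V \<noteq> {}"
  shows "emeasure vol V > 0"
proof -
  obtain p where "p \<in> V" using assms by auto
  let ?c = "chart_at A p"
  note c = chart_at[of p]
  let ?V = "V \<inter> chart_dom ?c"
  have V: "open ?V" "p \<in> ?V" using assms c \<open>p \<in> V\<close> by auto
  let ?X = "coord ?c ` ?V"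
  have X: "?X = {x\<in>chart_img ?c. param ?c x \<in> ?V}"
    by (rule coord_image_eq) (use c in auto)
  have "open ?X" unfolding X by (rule open_param_vimage[OF c(1) V(1)])
  moreover have "coord ?c p \<in> ?X" using V by blast
  ultimately have "\<not> negligible ?X" "?X \<in> sets borel"
    using open_not_negligible by auto
  then have pos: "emeasure lborel ?X \<noteq> 0" "?X \<in> sets borel"
    by (auto simp: negligible_iff_null_sets null_sets_def)
  have "emeasure vol ?V = (\<integral>\<^sup>+x\<in>?X. ennreal (dens ?c x) \<partial>lborel)"
    using V(1) c by (subst emeasure_vol[OF c(1)]) (auto simp: emeasure_chart_vol)
  moreover have "\<dots> \<noteq> 0"
  proof
    assume 0: "(\<integral>\<^sup>+x\<in>?X. ennreal (dens ?c x) \<partial>lborel) = 0"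
    have "(\<lambda>x. indicator (chart_img ?c) x * dens ?c x * indicator ?X x) \<in> borel_measurable borel"
      by (intro borel_measurable_times borel_measurable_dens c borel_measurable_indicator pos)
    then have "(\<lambda>x. ennreal (indicator (chart_img ?c) x * dens ?c x * indicator ?X x)) \<in> borel_measurable lborel"
      by simp
    moreover have "(\<lambda>x. ennreal (indicator (chart_img ?c) x * dens ?c x * indicator ?X x)) = (\<lambda>x. ennreal (dens ?c x) * indicator ?X x)"
      by (auto simp: fun_eq_iff X indicator_def)
    ultimately have "AE x in lborel. ennreal (dens ?c x) * indicator ?X x = 0"
      using 0 by (subst (asm) nn_integral_0_iff_AE) auto
    then have "AE x in lborel. x \<notin> ?X"
    proof eventually_elim
      case (elim x)
      show "x \<notin> ?X"
      proof
        assume x: "x \<in> ?X"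
        then have "dens ?c x > 0" using dens_pos[OF c(1)] X by blast
        with elim x show False by simp
      qed
    qed
    then have "?X \<in> null_sets lborel"
      using pos by (subst (asm) AE_iff_null_sets[symmetric]) auto
    then show False using pos by auto
  qed
  ultimately have "emeasure vol ?V > 0" by (simp add: zero_less_iff_neq_zero)
  also have "emeasure vol ?V \<le> emeasure vol V" using assms by (intro emeasure_mono) auto
  finally show ?thesis .
qed

lemma integral_square_pos:
  fixes h :: "'a \<Rightarrow> real"
  assumes "continuous_on UNIV h" "h p \<noteq> 0"
  shows "(LINT q|vol. (h q)\<^sup>2) > 0"
proof -
  have i: "integrable vol (\<lambda>q. (h q)\<^sup>2)"
    by (rule integrable_vol_continuous) (intro continuous_intros assms)
  have "(LINT q|vol. (h q)\<^sup>2) \<noteq> 0"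
  proof
    assume "(LINT q|vol. (h q)\<^sup>2) = 0"
    then have "AE q in vol. (h q)\<^sup>2 = 0"
      using integral_nonneg_eq_0_iff_AE[OF i] by simp
    then have "AE q in vol. q \<notin> {q. h q \<noteq> 0}" by simp
    moreover have o: "open {q. h q \<noteq> 0}"
      using open_vimage[OF _ assms(1), of "- {0}"] by (auto simp: vimage_def)
    ultimately have "{q. h q \<noteq> 0} \<in> null_sets vol"
      by (subst AE_iff_null_sets) auto
    then have "emeasure vol {q. h q \<noteq> 0} = 0" by (rule null_setsD1)
    moreover have "{q. h q \<noteq> 0} \<noteq> {}" using assms(2) by blast
    ultimately show False using emeasure_vol_open_pos[OF o] by simp
  qed
  moreover have "(LINT q|vol. (h q)\<^sup>2) \<ge> 0" by (rule integral_nonneg_AE) simp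
  ultimately show ?thesis by linarith
qed

end

section \<open>Bump functions and partitions of unity\<close>

text \<open>Dividing by powers of \<open>x\<close> makes the family closed under differentiation up
  to linear combinations (\<open>flat_deriv\<close>). Smoothness of the bump profile
  \<open>flat 0\<close> is then one induction over all \<open>n\<close> simultaneously.\<close>

definition flat :: "nat \<Rightarrow> real \<Rightarrow> real" where
  "flat n x = (if x > 0 then exp (- 1 / x) / x ^ n else 0)"

lemma flat_nonneg: "flat n x \<ge> 0"
  by (simp add: flat_def)

text \<open>A quadratic bound forces the derivative at 0 to vanish. With \<open>y = 1/x\<close> it
  says that \<open>y ^ (n + 2) / exp y\<close> is bounded for positive \<open>y\<close>.\<close>

lemma flat_bound: "\<exists>C. \<forall>x. \<bar>flat n x\<bar> \<le> C * x\<^sup>2"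
proof -
  have "((\<lambda>x::real. x ^ (n + 2) / exp x) \<longlongrightarrow> 0) at_top"
    by (rule tendsto_power_div_exp_0)
  then have "\<forall>\<^sub>F x in at_top. x ^ (n + 2) / exp x < (1::real)"
    by (rule order_tendstoD) simp
  then obtain N :: real where N: "\<And>x. x \<ge> N \<Longrightarrow> x ^ (n + 2) / exp x < 1"
    unfolding eventually_at_top_linorder by blast
  \<comment> \<open>Beyond \<open>N\<close> the quotient is below 1; before \<open>N\<close> it is
    at most its numerator, which the power bounds.\<close>
  define C where "C = 1 + (max N 1) ^ (n + 2)"
  have y: "y ^ (n + 2) / exp y \<le> C" if "y > 0" for y
  proof (cases "y \<ge> N")
    case True
    have "0 \<le> max N 1 ^ (n + 2)" by simp
    then show ?thesis using N[OF True] unfolding C_def by linarith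
  next
    case False
    have "y ^ (n + 2) / exp y \<le> y ^ (n + 2)"
      using that by (simp add: divide_le_eq mult_left_le)
    also have "\<dots> \<le> max N 1 ^ (n + 2)"
      using that False by (intro power_mono) auto
    finally show ?thesis by (simp add: C_def)
  qed
  have "\<bar>flat n x\<bar> \<le> C * x\<^sup>2" for x
  proof (cases "x > 0")
    case True
    have "flat n x = ((1/x) ^ (n + 2) / exp (1/x)) * x\<^sup>2"
      using True by (simp add: flat_def exp_minus field_simps power_add power2_eq_square)
    also have "\<dots> \<le> C * x\<^sup>2"
      using y[of "1/x"] True by (intro mult_right_mono) auto
    finally show ?thesis using flat_nonneg[of n x] by simp
  qed (simp add: flat_def C_def add_nonneg_nonneg)
  then show ?thesis by blast
qed

lemma flat_deriv: "(flat n has_real_derivative flat (n + 2) x - n * flat (n + 1) x) (at x)"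
proof (cases x "0::real" rule: linorder_cases)
  case less
  have "((\<lambda>_. 0) has_real_derivative 0) (at x)" by simp
  then have "(flat n has_real_derivative 0) (at x)"
    by (rule has_field_derivative_transform_within_open[of _ _ _ "{..<0}"]) (use less in \<open>auto simp: flat_def\<close>)
  then show ?thesis using less by (simp add: flat_def)
next
  case equal
  obtain C where C: "\<And>x. \<bar>flat n x\<bar> \<le> C * x\<^sup>2" using flat_bound by blast
  have "((\<lambda>y. (flat n y - flat n 0) / (y - 0)) \<longlongrightarrow> 0) (at 0)"
  proof (rule Lim_null_comparison)
    show "\<forall>\<^sub>F y in at 0. norm ((flat n y - flat n 0) / (y - 0)) \<le> C * \<bar>y\<bar>"
    proof (rule eventually_mono[OF eventually_neq_at_within[of 0]])
      fix y :: real assume "y \<noteq> 0"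
      then show "norm ((flat n y - flat n 0) / (y - 0)) \<le> C * \<bar>y\<bar>"
        using C[of y] by (simp add: flat_def[of n 0] abs_divide divide_le_eq power2_eq_square mult.assoc)
    qed
    show "((\<lambda>y. C * \<bar>y\<bar>) \<longlongrightarrow> 0) (at 0)"
      by (rule tendsto_eq_intros refl)+ simp
  qed
  then show ?thesis using equal by (simp add: has_field_derivative_iff flat_def)
next
  case greater
  have "((\<lambda>x. exp (- 1 / x) / x ^ n) has_real_derivative
      (exp (- 1 / x) * (1 / x\<^sup>2) * x ^ n - exp (- 1 / x) * (n * x ^ (n - 1))) / (x ^ n * x ^ n)) (at x)"
    using greater by (auto intro!: derivative_eq_intros simp: power2_eq_square)
  also have "(exp (- 1 / x) * (1 / x\<^sup>2) * x ^ n - exp (- 1 / x) * (n * x ^ (n - 1))) / (x ^ n * x ^ n)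
      = flat (n + 2) x - n * flat (n + 1) x"
    using greater by (cases n) (auto simp: flat_def field_simps power2_eq_square)
  finally show ?thesis
    by (rule has_field_derivative_transform_within_open[of _ _ _ "{0<..}"]) (use greater in \<open>auto simp: flat_def\<close>)
qed

lemma smooth_on_flat: "smooth_on UNIV (flat n)"
proof -
  have "Ck_on k UNIV (flat n)" for k
  proof (induction k arbitrary: n)
    case 0
    show ?case
      using flat_deriv by (auto intro!: DERIV_continuous_on simp: has_field_derivative_at_within)
  next
    case (Suc k)
    have "Ck_on k UNIV (\<lambda>x. flat (n + 2) x + (- real n) * flat (n + 1) x)"
      by (intro Ck_on_add Ck_on_bilinear[OF _ bounded_bilinear_mult] Ck_on_const Suc) auto
    then show ?case
      by (intro Ck_on_realI[OF open_UNIV]) (use flat_deriv[of n] in auto)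
  qed
  then show ?thesis by (simp add: smooth_on_def)
qed

context riemannian_manifold
begin

lemma smooth_funD: "smooth_fun A f \<Longrightarrow> c \<in> A \<Longrightarrow> smooth_on (chart_img c) (\<lambda>x. f (param c x))"
  by (auto simp: smooth_fun_def o_def)

lemma smooth_fun_continuous:
  assumes "smooth_fun A f"
  shows "continuous_on UNIV f"
proof -
  have "isCont f p" for p
  proof -
    let ?c = "chart_at A p"
    note c = chart_at[of p]
    have "continuous_on (chart_dom ?c) (\<lambda>q. f (param ?c (coord ?c q)))"
      using smooth_on_continuous_on[OF smooth_funD[OF assms c(1)]] continuous_coord[OF c(1)]
      by (rule continuous_on_compose2) (use c in auto)
    then have "continuous_on (chart_dom ?c) f"
      by (rule continuous_on_eq) (use c in auto)
    then show ?thesis using c by (auto simp: continuous_on_eq_continuous_at)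
  qed
  then show ?thesis by (simp add: continuous_at_imp_continuous_on)
qed

text \<open>Extension by zero. A point of another chart lies in the domain of \<open>c\<close>,
  where a transition map applies, or off \<open>K\<close>, where the function vanishes on a
  neighbourhood because a compact set in a Hausdorff space is closed.\<close>

lemma smooth_fun_supported:
  assumes c: "c \<in> A" and K: "compact K" "K \<subseteq> chart_dom c"
    and f: "smooth_on (chart_img c) (\<lambda>x. f (param c x))" "\<And>p. p \<notin> K \<Longrightarrow> f p = 0"
  shows "smooth_fun A f"
  unfolding smooth_fun_def
proof
  fix d assume d: "d \<in> A"
  show "smooth_on (chart_img d) (f \<circ> param d)"
  proof (rule smooth_on_local)
    fix x assume x: "x \<in> chart_img d"
    show "\<exists>T. open T \<and> x \<in> T \<and> smooth_on T (f \<circ> param d)"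
    proof (cases "param d x \<in> chart_dom c")
      case True
      have "smooth_on (overlap d c) (\<lambda>x. f (param c (trans d c x)))"
        by (rule smooth_on_compose[OF open_overlap[OF d c] _ f(1) smooth_trans[OF d c]])
          (use trans_overlap[OF d c] c d in \<open>auto simp: overlap_eq\<close>)
      then have "smooth_on (overlap d c) (f \<circ> param d)"
        by (subst smooth_on_cong[OF open_overlap[OF d c]]) (use c d in \<open>auto simp: overlap_eq trans_def\<close>)
      then show ?thesis using open_overlap[OF d c] True x d by (auto simp: overlap_eq)
    next
      case False
      let ?T = "{x\<in>chart_img d. param d x \<in> - K}"
      have T: "open ?T"
        by (rule open_param_vimage[OF d]) (use K compact_imp_closed in auto)
      have "smooth_on ?T (f \<circ> param d)"
        by (subst smooth_on_cong[OF T, of _ "\<lambda>_. 0"]) (auto simp: f(2) smooth_on_const)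
      then show ?thesis using T False K x by (intro exI[of _ ?T]) auto
    qed
  qed
qed

lemma smooth_fun_sum: "(\<And>i. i \<in> I \<Longrightarrow> smooth_fun A (f i)) \<Longrightarrow> smooth_fun A (\<lambda>p. \<Sum>i\<in>I. f i p)"
  by (auto simp: smooth_fun_def o_def intro!: smooth_on_sum)

lemma smooth_fun_divide:
  "smooth_fun A f \<Longrightarrow> smooth_fun A h \<Longrightarrow> (\<And>p. h p \<noteq> 0) \<Longrightarrow> smooth_fun A (\<lambda>p. f p / h p)"
  by (auto simp: smooth_fun_def o_def intro!: smooth_on_divide)

lemma bump_exists:
  "\<exists>b c K. c \<in> A \<and> compact K \<and> K \<subseteq> chart_dom c \<and> smooth_fun A b \<and>
     (\<forall>q. b q \<ge> 0) \<and> (\<forall>q. q \<notin> K \<longrightarrow> b q = 0) \<and> b p > 0"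
proof -
  let ?c = "chart_at A p"
  note c = chart_at[of p]
  let ?x = "coord ?c p"
  obtain r where r: "r > 0" "cball ?x r \<subseteq> chart_img ?c"
    using open_contains_cball c by (metis coord_in open_chart_img)
  define K where "K = param ?c ` cball ?x r"
  \<comment> \<open>The squared distance keeps the argument of \<open>flat 0\<close> polynomial in
    the coordinates; it is positive exactly inside the ball of radius \<open>r\<close>.\<close>
  define b where "b = (\<lambda>q. if q \<in> chart_dom ?c then flat 0 (r\<^sup>2 - (coord ?c q - ?x) \<bullet> (coord ?c q - ?x)) else 0)"
  have K: "compact K" "K \<subseteq> chart_dom ?c"
    unfolding K_def using r c
    by (auto intro!: compact_continuous_image continuous_on_subset[OF continuous_param[OF c(1)]])
  have zero: "b q = 0" if "q \<notin> K" for q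
  proof (cases "q \<in> chart_dom ?c")
    case True
    then have "q = param ?c (coord ?c q)" using c by simp
    with that have "coord ?c q \<notin> cball ?x r" unfolding K_def by (metis imageI)
    then have "r < norm (coord ?c q - ?x)" by (simp add: dist_norm norm_minus_commute)
    then have "r\<^sup>2 < (norm (coord ?c q - ?x))\<^sup>2" using r by (intro power_strict_mono) auto
    then show ?thesis by (simp add: b_def flat_def power2_norm_eq_inner)
  qed (simp add: b_def)
  have "smooth_on (chart_img ?c) (\<lambda>x. flat 0 (r\<^sup>2 - (x - ?x) \<bullet> (x - ?x)))"
    by (rule smooth_on_compose[OF _ open_UNIV smooth_on_flat])
      (use c in \<open>auto intro!: smooth_on_diff smooth_on_inner smooth_on_const smooth_on_ident\<close>)
  then have sm: "smooth_on (chart_img ?c) (\<lambda>x. b (param ?c x))"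
    by (subst smooth_on_cong) (use c in \<open>auto simp: b_def\<close>)
  have "smooth_fun A b"
    by (rule smooth_fun_supported[OF c(1) K sm zero])
  moreover have "b p > 0" using c r by (simp add: b_def flat_def)
  moreover have "b q \<ge> 0" for q by (simp add: b_def flat_nonneg)
  ultimately show ?thesis using c K zero by blast
qed

end

context compact_riemannian_manifold
begin

text \<open>Finitely many bumps, indexed by their centres and divided by their sum. Supports are
  recorded as compact sets inside one chart: this gives \<open>local_variation\<close> a uniform
  margin in time, and \<open>second_variation\<close> integrands with compact support in
  coordinates.\<close>

lemma partition_of_unity:
  obtains I :: "'a set" and \<rho> :: "'a \<Rightarrow> 'a \<Rightarrow> real" and ch K where
    "finite I" "\<And>i. i \<in> I \<Longrightarrow> ch i \<in> A" "\<And>i. i \<in> I \<Longrightarrow> compact (K i)"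
    "\<And>i. i \<in> I \<Longrightarrow> K i \<subseteq> chart_dom (ch i)" "\<And>i. i \<in> I \<Longrightarrow> smooth_fun A (\<rho> i)"
    "\<And>i p. i \<in> I \<Longrightarrow> p \<notin> K i \<Longrightarrow> \<rho> i p = 0" "\<And>p. (\<Sum>i\<in>I. \<rho> i p) = 1"
proof -
  have "\<forall>i. \<exists>b c K. c \<in> A \<and> compact K \<and> K \<subseteq> chart_dom c \<and> smooth_fun A b \<and>
     (\<forall>q. b q \<ge> 0) \<and> (\<forall>q. q \<notin> K \<longrightarrow> b q = 0) \<and> b i > 0"
    using bump_exists by blast
  then obtain b ch K where b: "\<And>i. ch i \<in> A" "\<And>i. compact (K i)" "\<And>i. K i \<subseteq> chart_dom (ch i)"
    "\<And>i. smooth_fun A (b i)" "\<And>i q. b i q \<ge> 0" "\<And>i q. q \<notin> K i \<Longrightarrow> b i q = 0" "\<And>i. b i i > 0"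
    by metis
  have "open {q. b i q > 0}" for i
    using open_vimage[OF open_greaterThan[of "0::real"] smooth_fun_continuous[OF b(4)]]
    by (simp add: vimage_def)
  then obtain I where I: "finite I" "UNIV \<subseteq> (\<Union>i\<in>I. {q. b i q > 0})"
  proof (rule compactE_image[OF compact_UNIV, of UNIV "\<lambda>i. {q. b i q > 0}"])
    show "UNIV \<subseteq> (\<Union>i. {q. b i q > 0})" using b(7) by blast
  qed auto
  define S where "S = (\<lambda>q. \<Sum>i\<in>I. b i q)"
  have S: "S q > 0" for q
  proof -
    obtain i where "i \<in> I" "b i q > 0" using I(2) by blast
    then show ?thesis unfolding S_def using I(1) b(5) by (intro sum_pos2[of I i]) auto
  qed
  have Sne: "S q \<noteq> 0" for q using S[of q] by simp
  show ?thesis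
  proof (rule that[of I ch K "\<lambda>i q. b i q / S q"])
    show "smooth_fun A (\<lambda>q. b i q / S q)" for i
      by (rule smooth_fun_divide[OF b(4) _ Sne]) (unfold S_def, rule smooth_fun_sum[OF b(4)])
    show "(\<Sum>i\<in>I. b i p / S p) = 1" for p
      using Sne[of p] by (simp add: sum_divide_distrib[symmetric] S_def)
  qed (use I b in auto)
qed

end

section \<open>Smooth families of maps\<close>

context riemannian_manifold
begin

definition family_dom :: "'e set \<Rightarrow> ('e \<Rightarrow> 'a \<Rightarrow> 'a) \<Rightarrow> ('a, 'm) chart \<Rightarrow> ('a, 'm) chart \<Rightarrow> ('e \<times> (real^'m)) set" where
  "family_dom T \<Theta> c d = {z. fst z \<in> T \<and> snd z \<in> chart_img c \<and> \<Theta> (fst z) (param c (snd z)) \<in> chart_dom d}"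

definition family_rep :: "('e \<Rightarrow> 'a \<Rightarrow> 'a) \<Rightarrow> ('a, 'm) chart \<Rightarrow> ('a, 'm) chart \<Rightarrow> 'e \<times> (real^'m) \<Rightarrow> real^'m" where
  "family_rep \<Theta> c d z = coord d (\<Theta> (fst z) (param c (snd z)))"

text \<open>The parameters lie in any Euclidean space, so the one-parameter building blocks and the
  two-parameter variations share this notion. Joint continuity is included because it makes every
  \<open>family_dom\<close> open, as \<open>smooth_on\<close> presupposes.\<close>

definition smooth_family :: "'e::euclidean_space set \<Rightarrow> ('e \<Rightarrow> 'a \<Rightarrow> 'a) \<Rightarrow> bool" where
  "smooth_family T \<Theta> \<longleftrightarrow> open T \<and> continuous_on (T \<times> UNIV) (\<lambda>z. \<Theta> (fst z) (snd z)) \<and>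
     (\<forall>c\<in>A. \<forall>d\<in>A. smooth_on (family_dom T \<Theta> c d) (family_rep \<Theta> c d))"

lemma smooth_familyD:
  assumes "smooth_family T \<Theta>"
  shows "open T" "continuous_on (T \<times> UNIV) (\<lambda>z. \<Theta> (fst z) (snd z))"
    "c \<in> A \<Longrightarrow> d \<in> A \<Longrightarrow> smooth_on (family_dom T \<Theta> c d) (family_rep \<Theta> c d)"
  using assms by (auto simp: smooth_family_def)

lemma smooth_family_continuous_param:
  assumes \<Theta>: "smooth_family T \<Theta>" and c: "c \<in> A"
  shows "continuous_on (T \<times> chart_img c) (\<lambda>z. \<Theta> (fst z) (param c (snd z)))"
proof -
  have "continuous_on (T \<times> chart_img c) (\<lambda>z. (fst z, param c (snd z)))"
    by (intro continuous_intros continuous_on_compose2[OF continuous_param[OF c]]) auto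
  from continuous_on_compose2[OF smooth_familyD(2)[OF \<Theta>] this]
  show ?thesis by force
qed

lemma open_family_vimage:
  assumes \<Theta>: "smooth_family T \<Theta>" and c: "c \<in> A" and V: "open V"
  shows "open {z. fst z \<in> T \<and> snd z \<in> chart_img c \<and> \<Theta> (fst z) (param c (snd z)) \<in> V}"
proof -
  have "open (T \<times> chart_img c)"
    using smooth_familyD(1)[OF \<Theta>] c by (auto intro: open_Times)
  from continuous_open_preimage[OF smooth_family_continuous_param[OF \<Theta> c] this V]
  show ?thesis by (rule back_subst[where P = "open"]) auto
qed

lemma open_family_dom: "smooth_family T \<Theta> \<Longrightarrow> c \<in> A \<Longrightarrow> d \<in> A \<Longrightarrow> open (family_dom T \<Theta> c d)"
  unfolding family_dom_def by (rule open_family_vimage) auto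

lemma smooth_family_subset:
  assumes "smooth_family T \<Theta>" "S \<subseteq> T" "open S"
  shows "smooth_family S \<Theta>"
  unfolding smooth_family_def
proof (intro conjI ballI assms)
  show "continuous_on (S \<times> UNIV) (\<lambda>z. \<Theta> (fst z) (snd z))"
    by (rule continuous_on_subset[OF smooth_familyD(2)[OF assms(1)]]) (use assms in auto)
  fix c d assume "c \<in> A" "d \<in> A"
  then show "smooth_on (family_dom S \<Theta> c d) (family_rep \<Theta> c d)"
    by (rule smooth_on_subset[OF smooth_familyD(3)[OF assms(1)]]) (use assms in \<open>auto simp: family_dom_def\<close>)
qed

text \<open>Locally the composition factors through a chart \<open>e\<close> around the intermediate
  point; continuity of the inner family keeps nearby points in \<open>e\<close>.\<close>

lemma smooth_family_compose:
  assumes \<Theta>: "smooth_family T \<Theta>" and \<Phi>: "smooth_family T \<Phi>"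
  shows "smooth_family T (\<lambda>t p. \<Phi> t (\<Theta> t p))"
proof -
  have cont: "continuous_on (T \<times> UNIV) (\<lambda>z. \<Phi> (fst z) (\<Theta> (fst z) (snd z)))"
  proof -
    have "continuous_on (T \<times> UNIV) (\<lambda>z. (fst z, \<Theta> (fst z) (snd z)))"
      by (intro continuous_intros smooth_familyD(2)[OF \<Theta>])
    from continuous_on_compose2[OF smooth_familyD(2)[OF \<Phi>] this]
    show ?thesis by force
  qed
  show ?thesis
    unfolding smooth_family_def
  proof (intro conjI ballI smooth_familyD(1)[OF \<Theta>] cont)
    fix c d assume c: "c \<in> A" and d: "d \<in> A"
    let ?D = "family_dom T (\<lambda>t p. \<Phi> t (\<Theta> t p)) c d" and ?F = "family_rep (\<lambda>t p. \<Phi> t (\<Theta> t p)) c d"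
    show "smooth_on ?D ?F"
    proof (rule smooth_on_local)
      fix z assume z: "z \<in> ?D"
      define e where "e = chart_at A (\<Theta> (fst z) (param c (snd z)))"
      have e: "e \<in> A" "\<Theta> (fst z) (param c (snd z)) \<in> chart_dom e"
        using chart_at by (auto simp: e_def)
      define G where "G = (\<lambda>y. (fst y, family_rep \<Theta> c e y))"
      have oc: "open (family_dom T \<Theta> c e)" by (rule open_family_dom[OF \<Theta> c e(1)])
      have sG: "smooth_on (family_dom T \<Theta> c e) G"
        unfolding G_def by (intro smooth_on_Pair oc smooth_on_fst smooth_on_ident smooth_familyD(3)[OF \<Theta>] c e)
      define S where "S = family_dom T \<Theta> c e \<inter> G -` family_dom T \<Phi> e d"
      have S: "open S"
        unfolding S_def by (rule continuous_open_preimage[OF smooth_on_continuous_on[OF sG] oc open_family_dom[OF \<Phi> e(1) d]])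
      have eq: "G y \<in> family_dom T \<Phi> e d \<longleftrightarrow> y \<in> ?D" "family_rep \<Phi> e d (G y) = ?F y"
        if "y \<in> family_dom T \<Theta> c e" for y
        using that e d by (auto simp: G_def family_dom_def family_rep_def)
      have "smooth_on S (\<lambda>y. family_rep \<Phi> e d (G y))"
        by (rule smooth_on_compose[OF S open_family_dom[OF \<Phi> e(1) d] smooth_familyD(3)[OF \<Phi> e(1) d]])
          (use smooth_on_subset[OF sG] in \<open>auto simp: S_def\<close>)
      then have "smooth_on S ?F"
        by (subst smooth_on_cong[OF S]) (use eq(2) in \<open>auto simp: S_def\<close>)
      moreover have "z \<in> S"
      proof -
        have "z \<in> family_dom T \<Theta> c e" using z e by (auto simp: family_dom_def)
        then show ?thesis using eq(1) z by (auto simp: S_def)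
      qed
      ultimately show "\<exists>S. open S \<and> z \<in> S \<and> smooth_on S ?F" using S by blast
    qed
  qed
qed

lemma smooth_family_id: "open T \<Longrightarrow> smooth_family T (\<lambda>t p. p)"
  unfolding smooth_family_def
proof (intro conjI ballI)
  fix c d assume cd: "c \<in> A" "d \<in> A"
  have dom: "family_dom T (\<lambda>t p. p) c d = T \<times> overlap c d" and rep: "family_rep (\<lambda>t p. p) c d = (\<lambda>z. trans c d (snd z))"
    using cd by (auto simp: family_dom_def overlap_eq family_rep_def trans_def)
  assume "open T"
  then have o: "open (T \<times> overlap c d)" using open_overlap[OF cd] by (rule open_Times)
  show "smooth_on (family_dom T (\<lambda>t p. p) c d) (family_rep (\<lambda>t p. p) c d)"
    unfolding dom rep
    by (rule smooth_on_compose[OF o open_overlap[OF cd] smooth_trans[OF cd]])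
      (auto intro: smooth_on_snd smooth_on_ident o)
qed (auto intro: continuous_intros)

lemma smooth_family_curve:
  assumes \<Theta>: "smooth_family T \<Theta>" and "0 \<in> T" "\<Theta> 0 p = p" "d \<in> A" "p \<in> chart_dom d"
  shows "\<forall>\<^sub>F t in nhds 0. t \<in> T \<and> \<Theta> t p \<in> chart_dom d"
proof -
  have "open {z. fst z \<in> T \<and> snd z \<in> chart_img d \<and> \<Theta> (fst z) (param d (snd z)) \<in> chart_dom d}"
    by (rule open_family_vimage[OF \<Theta>]) (use assms in auto)
  then have "open ((\<lambda>t. (t, coord d p)) -` {z. fst z \<in> T \<and> snd z \<in> chart_img d \<and> \<Theta> (fst z) (param d (snd z)) \<in> chart_dom d})"
    by (rule open_vimage) (intro continuous_intros)
  then show ?thesis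
    unfolding eventually_nhds using assms by (intro exI conjI) (assumption, auto)
qed

text \<open>At parameter 0 the outer map is the identity, so its derivative in the space variable is
  the identity (\<open>D2\<close>) and the velocities simply add.\<close>

lemma initial_velocity_compose:
  assumes \<Theta>: "smooth_family T \<Theta>" and \<Phi>: "smooth_family T \<Phi>" and T: "0 \<in> T"
    and id: "\<And>p. \<Theta> 0 p = p" "\<And>p. \<Phi> 0 p = p"
    and v: "has_initial_velocity A \<Theta> v" and w: "has_initial_velocity A \<Phi> w"
  shows "has_initial_velocity A (\<lambda>t p. \<Phi> t (\<Theta> t p)) (\<lambda>p c. v p c + w p c)"
  unfolding has_initial_velocity_def
proof (intro allI ballI impI)
  fix p d assume d: "d \<in> A" and "\<Phi> 0 (\<Theta> 0 p) \<in> chart_dom d"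
  then have p: "p \<in> chart_dom d" by (simp add: id)
  let ?F = "family_rep \<Phi> d d" and ?x = "coord d p"
  have in0: "(0, ?x) \<in> family_dom T \<Phi> d d"
    using T p d by (simp add: family_dom_def id)
  define D where "D = frechet_derivative ?F (at (0, ?x))"
  have F: "(?F has_derivative D) (at (0, ?x))"
    unfolding D_def by (rule smooth_on_has_derivative[OF smooth_familyD(3)[OF \<Phi> d d] in0])
  then have lin: "linear D" by (rule has_derivative_linear)
  have D1: "D (1, 0) = w p d"
  proof -
    have "((\<lambda>t. (t, ?x)) has_derivative (\<lambda>h. (h, 0))) (at 0)"
      by (auto intro!: derivative_eq_intros)
    from has_derivative_compose[OF this F]
    have "((\<lambda>t. coord d (\<Phi> t p)) has_derivative (\<lambda>h. D (h, 0))) (at 0)"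
      using p d by (simp add: family_rep_def)
    moreover have "((\<lambda>t. coord d (\<Phi> t p)) has_derivative (\<lambda>h. h *\<^sub>R w p d)) (at 0)"
      using w d p id unfolding has_initial_velocity_def has_vector_derivative_def by auto
    ultimately have "(\<lambda>h. D (h, 0)) = (\<lambda>h. h *\<^sub>R w p d)"
      by (rule has_derivative_unique)
    from fun_cong[OF this, of 1] show ?thesis by simp
  qed
  have D2: "D (0, u) = u" for u
  proof -
    have "((\<lambda>y. (0, y)) has_derivative (\<lambda>h. (0, h))) (at ?x)"
      by (auto intro!: derivative_eq_intros)
    from has_derivative_compose[OF this F]
    have "((\<lambda>y. ?F (0, y)) has_derivative (\<lambda>h. D (0, h))) (at ?x)" .
    then have "((\<lambda>y. y) has_derivative (\<lambda>h. D (0, h))) (at ?x)"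
      by (rule has_derivative_transform_within_open[of _ _ _ _ "chart_img d"])
        (use d p in \<open>auto simp: family_rep_def id\<close>)
    then have "(\<lambda>h. D (0, h)) = (\<lambda>h. h)"
      using has_derivative_unique has_derivative_ident by blast
    then show ?thesis by metis
  qed
  have "((\<lambda>t. coord d (\<Theta> t p)) has_derivative (\<lambda>h. h *\<^sub>R v p d)) (at 0)"
    using v d p id unfolding has_initial_velocity_def has_vector_derivative_def by auto
  then have c: "((\<lambda>t. (t, coord d (\<Theta> t p))) has_derivative (\<lambda>h. (h, h *\<^sub>R v p d))) (at 0)"
    by (auto intro!: derivative_eq_intros)
  have "(?F has_derivative D) (at (0, coord d (\<Theta> 0 p)))" using F by (simp add: id)
  from has_derivative_compose[OF c this]
  have "((\<lambda>t. ?F (t, coord d (\<Theta> t p))) has_derivative (\<lambda>h. D (h, h *\<^sub>R v p d))) (at 0)" .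
  moreover have "D (h, h *\<^sub>R v p d) = h *\<^sub>R (v p d + w p d)" for h
  proof -
    have "D (h, h *\<^sub>R v p d) = D (h *\<^sub>R (1, 0) + h *\<^sub>R (0, v p d))" by simp
    also have "\<dots> = h *\<^sub>R (v p d + w p d)"
      by (simp only: linear_add[OF lin] linear_scale[OF lin] D1 D2 scaleR_add_right add.commute)
    finally show ?thesis .
  qed
  ultimately have 1: "((\<lambda>t. ?F (t, coord d (\<Theta> t p))) has_derivative (\<lambda>h. h *\<^sub>R (v p d + w p d))) (at 0)"
    by simp
  obtain S where S: "open S" "0 \<in> S" "\<And>t. t \<in> S \<Longrightarrow> \<Theta> t p \<in> chart_dom d"
    using smooth_family_curve[OF \<Theta> T id(1) d p] unfolding eventually_nhds by blast
  show "((\<lambda>t. coord d (\<Phi> t (\<Theta> t p))) has_vector_derivative v p d + w p d) (at 0)"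
    unfolding has_vector_derivative_def
    by (rule has_derivative_transform_within_open[OF 1 S(1,2)])
      (use S(3) d in \<open>simp add: family_rep_def\<close>)
qed

lemma vector_field_trans:
  assumes W: "vector_field A W" and cd: "c \<in> A" "d \<in> A" "p \<in> chart_dom c" "p \<in> chart_dom d"
  shows "W p d = dtrans c d (coord c p) (W p c)"
  using W cd transition_jacobian_mult[OF cd]
  unfolding vector_field_along_def tangent_vector_def by (metis IntI id_apply)

lemma vector_field_smooth:
  assumes W: "vector_field A W" and c: "c \<in> A"
  shows "smooth_on (chart_img c) (\<lambda>x. W (param c x) c)"
  using W c unfolding vector_field_along_def chart_img_def by fastforce

text \<open>In the chart the map \<open>x \<mapsto> x + t b(x) W(x)\<close>, extended by the identity.\<close>
lemma local_variation:
  assumes W: "vector_field A W" and c: "c \<in> A" and K: "compact K" "K \<subseteq> chart_dom c"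
    and b: "smooth_fun A b" "\<And>p. p \<notin> K \<Longrightarrow> b p = 0"
  shows "\<exists>\<epsilon>>0. \<exists>\<Theta>. smooth_family {-\<epsilon><..<\<epsilon>} \<Theta> \<and> (\<forall>p. \<Theta> 0 p = p) \<and>
    has_initial_velocity A \<Theta> (\<lambda>p d. b p *\<^sub>R W p d)"
proof -
  define V where "V = (\<lambda>x. b (param c x) *\<^sub>R W (param c x) c)"
  have sV: "smooth_on (chart_img c) V"
    unfolding V_def by (intro smooth_on_scaleR smooth_funD[OF b(1)] vector_field_smooth[OF W] c) (simp add: c)
  let ?K = "coord c ` K"
  have cK: "compact ?K"
    by (rule compact_continuous_image[OF continuous_on_subset[OF continuous_coord[OF c] K(2)] K(1)])
  have Ksub: "?K \<subseteq> chart_img c" using K by auto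
  obtain r where r: "r > 0" "(\<Union>x\<in>?K. ball x r) \<subseteq> chart_img c"
    using compact_subset_open_imp_ball_epsilon_subset[OF cK open_chart_img[OF c] Ksub] by blast
  have "compact (V ` ?K)"
    by (rule compact_continuous_image[OF continuous_on_subset[OF smooth_on_continuous_on[OF sV] Ksub] cK])
  then obtain B where B: "B > 0" "\<And>x. x \<in> ?K \<Longrightarrow> norm (V x) \<le> B"
    using compact_imp_bounded bounded_pos[of "V ` ?K"] by blast
  \<comment> \<open>\<open>r\<close> is the room left around the support inside the chart image and
    \<open>B\<close> bounds the displacement per unit time there, so for times below
    \<open>r / B\<close> no point leaves the chart.\<close>
  define \<epsilon> where "\<epsilon> = r / B"
  have \<epsilon>: "\<epsilon> > 0" using r B by (simp add: \<epsilon>_def)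
  let ?T = "{-\<epsilon><..<\<epsilon>}"
  have V0: "V x = 0" if "x \<in> chart_img c" "param c x \<notin> K" for x
    using that b(2) by (simp add: V_def)
  have inc: "x + t *\<^sub>R V x \<in> chart_img c" if "t \<in> ?T" "x \<in> chart_img c" for t x
  proof (cases "param c x \<in> K")
    case True
    then have xK: "x \<in> ?K" using that(2) c by (metis coord_param imageI)
    have "dist x (x + t *\<^sub>R V x) = \<bar>t\<bar> * norm (V x)" by (simp add: dist_norm)
    also have "\<dots> \<le> \<bar>t\<bar> * B" using B(2)[OF xK] by (intro mult_left_mono) auto
    also have "\<dots> < \<epsilon> * B" using that(1) B by (intro mult_strict_right_mono) auto
    also have "\<epsilon> * B = r" using B by (simp add: \<epsilon>_def)
    finally have "x + t *\<^sub>R V x \<in> ball x r" by simp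
    then show ?thesis using r(2) xK by blast
  qed (use that V0 in simp)
  define \<Theta> where "\<Theta> = (\<lambda>t p. if p \<in> chart_dom c then param c (coord c p + t *\<^sub>R V (coord c p)) else p)"
  have \<Theta>c: "\<Theta> t p = param c (coord c p + t *\<^sub>R V (coord c p))" if "p \<in> chart_dom c" for t p
    using that by (simp add: \<Theta>_def)
  have \<Theta>K: "\<Theta> t p = p" if "p \<notin> K" for t p
    using that V0[of "coord c p"] c by (simp add: \<Theta>_def)
  have \<Theta>in: "\<Theta> t p \<in> chart_dom c" if "p \<in> chart_dom c" "t \<in> ?T" for t p
    using inc[OF that(2), of "coord c p"] that c by (simp add: \<Theta>c)
  have closedK: "closed K" using K compact_imp_closed by blast
  have cont: "continuous_on (?T \<times> UNIV) (\<lambda>z. \<Theta> (fst z) (snd z))"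
  proof -
    have "continuous_on (?T \<times> chart_dom c \<union> ?T \<times> (- K)) (\<lambda>z. \<Theta> (fst z) (snd z))"
    proof (rule continuous_on_open_Un)
      show "open (?T \<times> chart_dom c)" "open (?T \<times> (- K))"
        using c closedK by (auto intro!: open_Times)
      have "continuous_on (?T \<times> chart_dom c) (\<lambda>z. coord c (snd z) + fst z *\<^sub>R V (coord c (snd z)))"
        by (intro continuous_intros continuous_on_compose2[OF continuous_coord[OF c]]
            continuous_on_compose2[OF smooth_on_continuous_on[OF sV]]) (use c in auto)
      then have "continuous_on (?T \<times> chart_dom c) (\<lambda>z. param c (coord c (snd z) + fst z *\<^sub>R V (coord c (snd z))))"
        by (rule continuous_on_compose2[OF continuous_param[OF c]]) (use inc in auto)
      then show "continuous_on (?T \<times> chart_dom c) (\<lambda>z. \<Theta> (fst z) (snd z))"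
        by (rule continuous_on_eq) (simp add: \<Theta>c mem_Times_iff)
      show "continuous_on (?T \<times> (- K)) (\<lambda>z. \<Theta> (fst z) (snd z))"
        by (rule continuous_on_eq[of _ snd]) (auto intro!: continuous_intros simp: \<Theta>K)
    qed
    moreover have "?T \<times> chart_dom c \<union> ?T \<times> (- K) = ?T \<times> UNIV" using K(2) by auto
    ultimately show ?thesis by simp
  qed
  have cont2: "continuous_on (?T \<times> chart_img e) (\<lambda>z. \<Theta> (fst z) (param e (snd z)))" if "e \<in> A" for e
  proof -
    have "continuous_on (?T \<times> chart_img e) (\<lambda>z. (fst z, param e (snd z)))"
      by (intro continuous_intros continuous_on_compose2[OF continuous_param[OF that]]) auto
    from continuous_on_compose2[OF cont this] show ?thesis by force
  qed
  have fam: "smooth_family ?T \<Theta>"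
    unfolding smooth_family_def
  proof (intro conjI ballI cont)
    fix e d assume e: "e \<in> A" and d: "d \<in> A"
    have oD: "open (family_dom ?T \<Theta> e d)"
    proof -
      have "open (?T \<times> chart_img e)" using e by (auto intro!: open_Times)
      from continuous_open_preimage[OF cont2[OF e] this open_chart_dom[OF d]]
      show ?thesis by (rule back_subst[where P = "open"]) (auto simp: family_dom_def)
    qed
    show "smooth_on (family_dom ?T \<Theta> e d) (family_rep \<Theta> e d)"
    proof (rule smooth_on_local)
      fix z assume z: "z \<in> family_dom ?T \<Theta> e d"
      show "\<exists>S. open S \<and> z \<in> S \<and> smooth_on S (family_rep \<Theta> e d)"
      \<comment> \<open>Two kinds of open sets suffice: over the domain of \<open>c\<close> the
        coordinate formula holds, and off \<open>K\<close> the map is the identity. They overlap,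
        since \<open>K\<close> lies inside the chart domain.\<close>
      proof (cases "param e (snd z) \<in> chart_dom c")
        case True
        define S where "S = family_dom ?T \<Theta> e d \<inter> (?T \<times> overlap e c)"
        have S: "open S" unfolding S_def using oD open_overlap[OF e c] by (auto intro!: open_Int open_Times)
        have sub: "snd ` S \<subseteq> overlap e c" by (auto simp: S_def)
        have t: "smooth_on S (\<lambda>z. trans e c (snd z))"
          by (rule smooth_on_compose[OF S open_overlap[OF e c] smooth_trans[OF e c] smooth_on_snd[OF S smooth_on_ident] sub])
        have tin: "trans e c y \<in> chart_img c" "param c (trans e c y) = param e y" if "y \<in> overlap e c" for y
          using that e c by (auto simp: overlap_eq trans_def)
        have V': "smooth_on S (\<lambda>z. V (trans e c (snd z)))"
          by (rule smooth_on_compose[OF S open_chart_img[OF c] sV t]) (use sub tin in auto)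
        have inn: "smooth_on S (\<lambda>z. trans e c (snd z) + fst z *\<^sub>R V (trans e c (snd z)))"
          by (intro smooth_on_add smooth_on_scaleR S t V' smooth_on_fst smooth_on_ident)
        have key: "\<Theta> (fst y) (param e (snd y)) = param c (trans e c (snd y) + fst y *\<^sub>R V (trans e c (snd y)))"
          if "y \<in> S" for y
          using that e by (auto simp: S_def \<Theta>c overlap_eq trans_def)
        have "smooth_on S (\<lambda>z. trans c d (trans e c (snd z) + fst z *\<^sub>R V (trans e c (snd z))))"
        proof (rule smooth_on_compose[OF S open_overlap[OF c d] smooth_trans[OF c d] inn], clarify)
          fix t x assume y: "(t, x) \<in> S"
          then have "\<Theta> t (param e x) \<in> chart_dom d" by (auto simp: S_def family_dom_def)
          moreover have "trans e c x + t *\<^sub>R V (trans e c x) \<in> chart_img c"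
            by (rule inc) (use y tin in \<open>auto simp: S_def\<close>)
          ultimately show "trans e c (snd (t, x)) + fst (t, x) *\<^sub>R V (trans e c (snd (t, x))) \<in> overlap c d"
            using key[OF y] c by (simp add: overlap_eq)
        qed
        then have "smooth_on S (family_rep \<Theta> e d)"
          by (subst smooth_on_cong[OF S]) (auto simp: family_rep_def key trans_def[of c d])
        moreover have "z \<in> S" using z True e by (auto simp: S_def family_dom_def overlap_eq mem_Times_iff)
        ultimately show ?thesis using S by blast
      next
        case False
        define S where "S = ?T \<times> ({x\<in>chart_img e. param e x \<in> - K} \<inter> overlap e d)"
        have S: "open S"
          unfolding S_def using closedK by (intro open_Times open_Int open_overlap open_param_vimage e d) auto
        have "smooth_on S (\<lambda>z. trans e d (snd z))"
          by (rule smooth_on_compose[OF S open_overlap[OF e d] smooth_trans[OF e d] smooth_on_snd[OF S smooth_on_ident]])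
            (auto simp: S_def)
        then have "smooth_on S (family_rep \<Theta> e d)"
          by (subst smooth_on_cong[OF S]) (auto simp: family_rep_def \<Theta>K trans_def S_def)
        moreover have "param e (snd z) \<notin> K" using False K by auto
        then have "z \<in> S" using z e by (auto simp: S_def family_dom_def overlap_eq \<Theta>K mem_Times_iff)
        ultimately show ?thesis using S by blast
      qed
    qed
  qed simp
  have id0: "\<Theta> 0 p = p" for p using c by (simp add: \<Theta>_def)
  have "has_initial_velocity A \<Theta> (\<lambda>p d. b p *\<^sub>R W p d)"
    unfolding has_initial_velocity_def
  proof (intro allI ballI impI)
    fix p d assume d: "d \<in> A" and "\<Theta> 0 p \<in> chart_dom d"
    then have p: "p \<in> chart_dom d" by (simp add: id0)
    show "((\<lambda>t. coord d (\<Theta> t p)) has_vector_derivative b p *\<^sub>R W p d) (at 0)"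
    proof (cases "p \<in> chart_dom c")
      case True
      let ?x = "coord c p"
      have lin: "linear (dtrans c d ?x)" and D: "(trans c d has_derivative dtrans c d ?x) (at (?x + 0 *\<^sub>R V ?x))"
        using trans_has_derivative[OF c d coord_overlap[OF True p]] has_derivative_linear by auto
      have 1: "((\<lambda>t. ?x + t *\<^sub>R V ?x) has_derivative (\<lambda>h. h *\<^sub>R V ?x)) (at 0)"
        by (auto intro!: derivative_eq_intros)
      have "((\<lambda>t. trans c d (?x + t *\<^sub>R V ?x)) has_derivative (\<lambda>h. dtrans c d ?x (h *\<^sub>R V ?x))) (at 0)"
        by (rule has_derivative_compose[OF 1 D])
      moreover have "dtrans c d ?x (h *\<^sub>R V ?x) = h *\<^sub>R (b p *\<^sub>R W p d)" for h
        using vector_field_trans[OF W c d True p] True c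
        by (simp add: V_def linear_scale[OF lin])
      ultimately have "((\<lambda>t. trans c d (?x + t *\<^sub>R V ?x)) has_vector_derivative b p *\<^sub>R W p d) (at 0)"
        by (simp add: has_vector_derivative_def)
      then show ?thesis using True by (simp add: \<Theta>c trans_def)
    next
      case False
      then have "p \<notin> K" using K by auto
      then show ?thesis by (simp add: \<Theta>K b(2))
    qed
  qed
  then show ?thesis using fam id0 \<epsilon> by blast
qed

end

context compact_riemannian_manifold
begin

lemma one_param_variation:
  assumes W: "vector_field A W"
  shows "\<exists>\<epsilon>>0. \<exists>\<Theta>. smooth_family {-\<epsilon><..<\<epsilon>} \<Theta> \<and> (\<forall>p. \<Theta> 0 p = p) \<and> has_initial_velocity A \<Theta> W"
proof -
  obtain I :: "'a set" and \<rho> :: "'a \<Rightarrow> 'a \<Rightarrow> real" and ch K where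
    P: "finite I" "\<And>i. i \<in> I \<Longrightarrow> ch i \<in> A" "\<And>i. i \<in> I \<Longrightarrow> compact (K i)"
    "\<And>i. i \<in> I \<Longrightarrow> K i \<subseteq> chart_dom (ch i)" "\<And>i. i \<in> I \<Longrightarrow> smooth_fun A (\<rho> i)"
    "\<And>i p. i \<in> I \<Longrightarrow> p \<notin> K i \<Longrightarrow> \<rho> i p = 0" "\<And>p. (\<Sum>i\<in>I. \<rho> i p) = 1"
    by (rule partition_of_unity) (rule that)
  \<comment> \<open>Generalised to subfamilies \<open>J\<close> for the induction: a partial
    composition has only the share of \<open>W\<close> that belongs to the functions of index in
    \<open>J\<close>. Each step shrinks \<epsilon>, finitely often.\<close>
  have "\<exists>\<epsilon>>0. \<exists>\<Theta>. smooth_family {-\<epsilon><..<\<epsilon>} \<Theta> \<and> (\<forall>p. \<Theta> 0 p = p) \<and>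
    has_initial_velocity A \<Theta> (\<lambda>p d. (\<Sum>i\<in>J. \<rho> i p) *\<^sub>R W p d)" if "J \<subseteq> I" for J
    using finite_subset[OF that P(1)] that
  proof (induction J rule: finite_induct)
    case empty
    have "smooth_family {-1<..<1::real} (\<lambda>t p. p)" by (rule smooth_family_id) simp
    moreover have "has_initial_velocity A (\<lambda>t p. p) (\<lambda>p d. 0)"
      by (simp add: has_initial_velocity_def)
    ultimately show ?case by (intro exI[of _ 1] conjI exI[of _ "\<lambda>t p. p"]) auto
  next
    case (insert i J)
    obtain e1 \<Theta> where 1: "e1 > 0" "smooth_family {-e1<..<e1} \<Theta>" "\<And>p. \<Theta> 0 p = p"
      "has_initial_velocity A \<Theta> (\<lambda>p d. (\<Sum>i\<in>J. \<rho> i p) *\<^sub>R W p d)"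
      using insert by blast
    have i: "i \<in> I" using insert by simp
    obtain e2 \<Phi> where 2: "e2 > 0" "smooth_family {-e2<..<e2} \<Phi>" "\<And>p. \<Phi> 0 p = p"
      "has_initial_velocity A \<Phi> (\<lambda>p d. \<rho> i p *\<^sub>R W p d)"
      using local_variation[OF W P(2-4)[OF i] P(5)[OF i] P(6)[OF i]] i by blast
    define e where "e = min e1 e2"
    have f: "smooth_family {-e<..<e} \<Theta>" "smooth_family {-e<..<e} \<Phi>"
      by (auto intro!: smooth_family_subset[OF 1(2)] smooth_family_subset[OF 2(2)] simp: e_def)
    have e: "e > 0" using 1 2 by (simp add: e_def)
    have "has_initial_velocity A (\<lambda>t p. \<Phi> t (\<Theta> t p)) (\<lambda>p d. (\<Sum>i\<in>J. \<rho> i p) *\<^sub>R W p d + \<rho> i p *\<^sub>R W p d)"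
      by (rule initial_velocity_compose[OF f _ 1(3) 2(3) 1(4) 2(4)]) (simp add: e)
    moreover have "(\<lambda>p d. (\<Sum>i\<in>J. \<rho> i p) *\<^sub>R W p d + \<rho> i p *\<^sub>R W p d) = (\<lambda>p d. (\<Sum>i\<in>insert i J. \<rho> i p) *\<^sub>R W p d)"
      using insert by (simp add: scaleR_add_left add.commute)
    ultimately have "has_initial_velocity A (\<lambda>t p. \<Phi> t (\<Theta> t p)) (\<lambda>p d. (\<Sum>i\<in>insert i J. \<rho> i p) *\<^sub>R W p d)"
      by simp
    with smooth_family_compose[OF f] e 1(3) 2(3) show ?case
      by (intro exI[of _ e] conjI exI[of _ "\<lambda>t p. \<Phi> t (\<Theta> t p)"]) auto
  qed
  from this[OF order.refl] show ?thesis by (simp add: P(7))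
qed

lemma two_param_variation:
  assumes W: "vector_field A W"
  shows "\<exists>\<Psi>. smooth_two_param_variation A A id \<Psi> \<and> has_initial_velocity A (\<lambda>t. \<Psi> t 0) W \<and>
    has_initial_velocity A (\<lambda>s. \<Psi> 0 s) W"
proof -
  obtain e \<Theta> where \<Theta>: "e > 0" "smooth_family {-e<..<e} \<Theta>" "\<And>p. \<Theta> 0 p = p" "has_initial_velocity A \<Theta> W"
    using one_param_variation[OF W] by blast
  let ?I = "{-(e/2)<..<e/2}"
  \<comment> \<open>Evaluation at \<open>t + s\<close> gives the velocity \<open>W\<close> in both
    parameters; on the halved intervals the sum stays in the range of
    \<open>\<Theta>\<close>.\<close>
  define \<Psi> where "\<Psi> = (\<lambda>t s. \<Theta> (t + s))"
  have sum: "t + s \<in> {-e<..<e}" if "t \<in> ?I" "s \<in> ?I" for t s using that by auto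
  have "smooth_two_param_variation A A id \<Psi>"
    unfolding smooth_two_param_variation_def
  proof (intro conjI exI[of _ "e/2"] ballI)
    show "\<Psi> 0 0 = id" by (simp add: \<Psi>_def \<Theta>(3) fun_eq_iff)
    show "e / 2 > 0" using \<Theta> by simp
    have "continuous_on (?I \<times> ?I \<times> (UNIV :: 'a set)) (\<lambda>z. (fst z + fst (snd z), snd (snd z)))"
      by (intro continuous_intros)
    from continuous_on_compose2[OF smooth_familyD(2)[OF \<Theta>(2)] this]
    have cont: "continuous_on (?I \<times> ?I \<times> UNIV) (\<lambda>z. \<Theta> (fst z + fst (snd z)) (snd (snd z)))"
      using sum by force
    then show "continuous_on (?I \<times> ?I \<times> UNIV) (\<lambda>(t, s, p). \<Psi> t s p)"
      by (simp add: \<Psi>_def case_prod_unfold)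
    fix c d assume c: "c \<in> A" and d: "d \<in> A"
    let ?D = "{(t, s, x). t \<in> ?I \<and> s \<in> ?I \<and> x \<in> chart_img c \<and> \<Psi> t s (param c x) \<in> chart_dom d}"
    define L :: "real \<times> real \<times> (real^'m) \<Rightarrow> real \<times> (real^'m)" where "L = (\<lambda>z. (fst z + fst (snd z), snd (snd z)))"
    have L: "bounded_linear L"
      unfolding L_def by (intro bounded_linear_intros)
    have D: "?D = (?I \<times> ?I \<times> chart_img c) \<inter> L -` family_dom {-e<..<e} \<Theta> c d"
      by (auto simp: family_dom_def L_def \<Psi>_def)
    have o: "open ?D"
      unfolding D
      by (rule continuous_open_preimage[OF linear_continuous_on[OF L] _ open_family_dom[OF \<Theta>(2) c d]])
        (use c in \<open>auto intro!: open_Times\<close>)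
    have "smooth_on ?D (\<lambda>z. family_rep \<Theta> c d (L z))"
      by (rule smooth_on_compose[OF o open_family_dom[OF \<Theta>(2) c d] smooth_familyD(3)[OF \<Theta>(2) c d] smooth_on_linear[OF L]])
        (unfold D, auto)
    moreover have "(\<lambda>z. family_rep \<Theta> c d (L z)) = (\<lambda>(t, s, x). coord d (\<Psi> t s (param c x)))"
      by (auto simp: family_rep_def L_def \<Psi>_def)
    ultimately show "smooth_on ?D (\<lambda>(t, s, x). coord d (\<Psi> t s (param c x)))" by simp
  qed
  moreover have "has_initial_velocity A (\<lambda>t. \<Psi> t 0) W" "has_initial_velocity A (\<lambda>s. \<Psi> 0 s) W"
    using \<Theta>(4) by (simp_all add: \<Psi>_def)
  ultimately show ?thesis by blast
qed

end

section \<open>Partial derivatives\<close>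

lemma frechet_derivative_eqI: "(f has_derivative f') (at x) \<Longrightarrow> frechet_derivative f (at x) = f'"
  by (rule frechet_derivative_at[symmetric])

lemma frechet_derivative_cong:
  assumes "open S" "x \<in> S" "\<And>y. y \<in> S \<Longrightarrow> f y = g y"
  shows "frechet_derivative f (at x) = frechet_derivative g (at x)"
proof -
  have "(f has_derivative D) (at x) \<longleftrightarrow> (g has_derivative D) (at x)" for D
    using has_derivative_transform_within_open[of f D x UNIV S g] has_derivative_transform_within_open[of g D x UNIV S f] assms
    by auto
  then show ?thesis unfolding frechet_derivative_def by presburger
qed

lemma linear_axis_sum:
  fixes D :: "real^'n::finite \<Rightarrow> real"
  assumes "linear D"
  shows "D v = (\<Sum>k\<in>UNIV. D (axis k 1) * v $ k)"
proof -
  have "D v = D (\<Sum>k\<in>UNIV. v $ k *\<^sub>R axis k 1)"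
    using basis_expansion[of v] by (simp add: scalar_mult_eq_scaleR)
  also have "\<dots> = (\<Sum>k\<in>UNIV. D (axis k 1) * v $ k)"
    by (simp add: linear_sum[OF assms] linear_scale[OF assms] mult.commute)
  finally show ?thesis .
qed

lemma frechet_derivative_slice:
  assumes "(F has_derivative D) (at (u, x))"
  shows "((\<lambda>u. F (u, x)) has_derivative (\<lambda>v. D (v, 0))) (at u)"
    and "((\<lambda>x. F (u, x)) has_derivative (\<lambda>v. D (0, v))) (at x)"
proof -
  have "((\<lambda>u. (u, x)) has_derivative (\<lambda>v. (v, 0))) (at u)"
    "((\<lambda>x. (u, x)) has_derivative (\<lambda>v. (0, v))) (at x)"
    by (auto intro!: derivative_eq_intros)
  from has_derivative_compose[OF this(1) assms] has_derivative_compose[OF this(2) assms]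
  show "((\<lambda>u. F (u, x)) has_derivative (\<lambda>v. D (v, 0))) (at u)"
    "((\<lambda>x. F (u, x)) has_derivative (\<lambda>v. D (0, v))) (at x)" .
qed

lemma partial_deriv_smooth:
  "smooth_on S f \<Longrightarrow> smooth_on S (partial_deriv k f)"
  unfolding partial_deriv_def[abs_def] by (rule smooth_on_frechet_derivative)

lemma frechet_derivative_partial_sum:
  fixes f :: "real^'n::finite \<Rightarrow> real"
  assumes "smooth_on S f" "x \<in> S"
  shows "frechet_derivative f (at x) v = (\<Sum>k\<in>UNIV. partial_deriv k f x * v $ k)"
  unfolding partial_deriv_def
  by (rule linear_axis_sum[OF has_derivative_linear[OF smooth_on_has_derivative[OF assms]]])

lemma partial_deriv_commute:
  fixes f :: "real^'n::finite \<Rightarrow> real"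
  assumes "open S" "x \<in> S" "smooth_on S f"
  shows "partial_deriv k (partial_deriv l f) x = partial_deriv l (partial_deriv k f) x"
  unfolding partial_deriv_def using symmetric_second_derivative[OF assms] .

lemma partial_deriv_has_derivative:
  fixes f :: "real^'n::finite \<Rightarrow> real"
  assumes "(f has_derivative D) (at x)"
  shows "partial_deriv k f x = D (axis k 1)"
  unfolding partial_deriv_def frechet_derivative_eqI[OF assms] ..

lemma partial_deriv_mult:
  fixes f h :: "real^'n::finite \<Rightarrow> real"
  assumes "smooth_on S f" "smooth_on S h" "x \<in> S"
  shows "partial_deriv k (\<lambda>x. f x * h x) x = partial_deriv k f x * h x + f x * partial_deriv k h x"
  using partial_deriv_has_derivative[OF has_derivative_mult[OF smooth_on_has_derivative[OF assms(1,3)]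
      smooth_on_has_derivative[OF assms(2,3)]]]
  by (simp add: partial_deriv_def)

lemma partial_deriv_sum:
  fixes f :: "'i \<Rightarrow> real^'n::finite \<Rightarrow> real"
  assumes "\<And>i. i \<in> I \<Longrightarrow> smooth_on S (f i)" "x \<in> S"
  shows "partial_deriv k (\<lambda>x. \<Sum>i\<in>I. f i x) x = (\<Sum>i\<in>I. partial_deriv k (f i) x)"
proof -
  have "((\<lambda>x. \<Sum>i\<in>I. f i x) has_derivative (\<lambda>v. \<Sum>i\<in>I. frechet_derivative (f i) (at x) v)) (at x)"
    by (rule has_derivative_sum) (rule smooth_on_has_derivative[OF assms])
  from partial_deriv_has_derivative[OF this] show ?thesis by (simp add: partial_deriv_def)
qed

lemma partial_deriv_diff:
  fixes f h :: "real^'n::finite \<Rightarrow> real"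
  assumes "smooth_on S f" "smooth_on S h" "x \<in> S"
  shows "partial_deriv k (\<lambda>x. f x - h x) x = partial_deriv k f x - partial_deriv k h x"
  using partial_deriv_has_derivative[OF has_derivative_diff[OF smooth_on_has_derivative[OF assms(1,3)]
      smooth_on_has_derivative[OF assms(2,3)]]]
  by (simp add: partial_deriv_def)

lemma partial_deriv_add:
  fixes f h :: "real^'n::finite \<Rightarrow> real"
  assumes "smooth_on S f" "smooth_on S h" "x \<in> S"
  shows "partial_deriv k (\<lambda>x. f x + h x) x = partial_deriv k f x + partial_deriv k h x"
  using partial_deriv_has_derivative[OF has_derivative_add[OF smooth_on_has_derivative[OF assms(1,3)]
      smooth_on_has_derivative[OF assms(2,3)]]]
  by (simp add: partial_deriv_def)

lemma partial_deriv_cong: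
  "open S \<Longrightarrow> x \<in> S \<Longrightarrow> (\<And>y. y \<in> S \<Longrightarrow> f y = h y) \<Longrightarrow> partial_deriv k f x = partial_deriv k h x"
  unfolding partial_deriv_def using frechet_derivative_cong[of S x f h] by simp

text \<open>Jacobi's formula. The product rule in the Leibniz expansion replaces one row at a time
  by its derivative, and Cramer's rule evaluates each resulting determinant.\<close>

lemma det_has_derivative:
  fixes M :: "'e::euclidean_space \<Rightarrow> real^'n^'n::finite"
  assumes M: "\<And>i j. ((\<lambda>x. M x $ i $ j) has_derivative M' i j) (at x)" and nz: "det (M x) \<noteq> 0"
  shows "((\<lambda>x. det (M x)) has_derivative
    (\<lambda>h. det (M x) * (\<Sum>i\<in>UNIV. \<Sum>j\<in>UNIV. M' i j h * matrix_inv (M x) $ j $ i))) (at x)"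
proof -
  let ?P = "{p. p permutes (UNIV :: 'n set)}"
  let ?R = "\<lambda>i h. (\<chi> a b. if a = i then M' i b h else M x $ a $ b) :: real^'n^'n"
  have prod: "((\<lambda>x. \<Prod>a\<in>UNIV. M x $ a $ p a) has_derivative
      (\<lambda>h. \<Sum>i\<in>UNIV. \<Prod>a\<in>UNIV. ?R i h $ a $ p a)) (at x)" for p :: "'n \<Rightarrow> 'n"
  proof -
    have "((\<lambda>x. \<Prod>a\<in>UNIV. M x $ a $ p a) has_derivative
        (\<lambda>h. \<Sum>i\<in>UNIV. M' i (p i) h * (\<Prod>a\<in>UNIV - {i}. M x $ a $ p a))) (at x)"
      by (rule has_derivative_prod) (rule M)
    moreover have "(\<Prod>a\<in>UNIV. ?R i h $ a $ p a) = M' i (p i) h * (\<Prod>a\<in>UNIV - {i}. M x $ a $ p a)" for i h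
      by (subst prod.remove[of _ i]) (auto intro!: prod.cong)
    ultimately show ?thesis by presburger
  qed
  have "((\<lambda>x. \<Sum>p\<in>?P. of_int (sign p) * (\<Prod>a\<in>UNIV. M x $ a $ p a)) has_derivative
      (\<lambda>h. \<Sum>p\<in>?P. of_int (sign p) * (\<Sum>i\<in>UNIV. \<Prod>a\<in>UNIV. ?R i h $ a $ p a))) (at x)"
    by (intro has_derivative_sum has_derivative_mult_right prod)
  moreover have "(\<Sum>p\<in>?P. of_int (sign p) * (\<Sum>i\<in>UNIV. \<Prod>a\<in>UNIV. ?R i h $ a $ p a))
      = (\<Sum>i\<in>UNIV. det (?R i h))" for h
    unfolding det_def sum_distrib_left by (rule sum.swap)
  moreover have "det (?R i h) = (\<Sum>j\<in>UNIV. M' i j h * matrix_inv (M x) $ j $ i) * det (M x)" for i h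
  proof -
    \<comment> \<open>The coefficients of the new row with respect to the rows of
      \<open>M x\<close>; in the determinant only the multiple of the row it replaces
      survives.\<close>
    define y where "y = (\<chi> l. \<Sum>j\<in>UNIV. M' i j h * matrix_inv (M x) $ j $ l)"
    have "(\<Sum>l\<in>UNIV. y $ l * M x $ l $ b) = M' i b h" for b
    proof -
      have "(\<Sum>l\<in>UNIV. y $ l * M x $ l $ b) = (\<Sum>j\<in>UNIV. M' i j h * (\<Sum>l\<in>UNIV. matrix_inv (M x) $ j $ l * M x $ l $ b))"
        unfolding y_def by (simp add: sum_distrib_left sum_distrib_right mult.assoc) (rule sum.swap)
      also have "\<dots> = (\<Sum>j\<in>UNIV. M' i j h * (matrix_inv (M x) ** M x) $ j $ b)"
        by (simp add: matrix_matrix_mult_def)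
      also have "\<dots> = (\<Sum>j\<in>UNIV. M' i j h * (if j = b then 1 else 0))"
        by (simp add: matrix_inv_left[OF nz] mat_def)
      also have "\<dots> = (\<Sum>j\<in>UNIV. if j = b then M' i j h else 0)"
        by (intro sum.cong) auto
      also have "\<dots> = M' i b h" by simp
      finally show ?thesis .
    qed
    then have "?R i h = (\<chi> a. if a = i then (\<Sum>l\<in>UNIV. y $ l *s row l (M x)) else row a (M x))"
      by (simp add: vec_eq_iff row_def)
    then have "det (?R i h) = y $ i * det (M x)"
      using cramer_lemma_transpose[where A = "M x" and x = y and k = i] by simp
    then show ?thesis by (simp add: y_def)
  qed
  ultimately show ?thesis
    unfolding det_def[of "M y" for y, symmetric]
    by (simp add: sum_distrib_left sum_distrib_right mult.commute)
qed

section \<open>Second order jets\<close>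

text \<open>Jets at \<open>0\<close> in \<open>(t, s)\<close>, modulo \<open>t\<^sup>2\<close> and \<open>s\<^sup>2\<close>.\<close>
definition has_jet :: "(real \<times> real \<Rightarrow> real) \<Rightarrow> real \<Rightarrow> real \<Rightarrow> real \<Rightarrow> real \<Rightarrow> bool" where
  "has_jet a a0 a1 a2 a12 \<longleftrightarrow> (\<exists>S. open S \<and> 0 \<in> S \<and> smooth_on S a \<and> a 0 = a0 \<and>
     frechet_derivative a (at 0) (1, 0) = a1 \<and> frechet_derivative a (at 0) (0, 1) = a2 \<and>
     frechet_derivative (\<lambda>u. frechet_derivative a (at u) (0, 1)) (at 0) (1, 0) = a12)"

lemma has_jetI:
  assumes "open S" "0 \<in> S" "smooth_on S a" "a 0 = a0"
    "frechet_derivative a (at 0) (1, 0) = a1" "frechet_derivative a (at 0) (0, 1) = a2"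
    "\<And>u. u \<in> S \<Longrightarrow> frechet_derivative a (at u) (0, 1) = b u"
    "(b has_derivative D) (at 0)" "D (1, 0) = a12"
  shows "has_jet a a0 a1 a2 a12"
proof -
  have "frechet_derivative (\<lambda>u. frechet_derivative a (at u) (0, 1)) (at 0) = frechet_derivative b (at 0)"
    by (rule frechet_derivative_cong[OF assms(1,2,7)])
  also have "\<dots> = D" by (rule frechet_derivative_eqI[OF assms(8)])
  finally show ?thesis using assms unfolding has_jet_def by metis
qed

lemma has_jet_cong:
  assumes "open S" "0 \<in> S" "\<And>u. u \<in> S \<Longrightarrow> a u = b u" "has_jet a a0 a1 a2 a12"
  shows "has_jet b a0 a1 a2 a12"
proof -
  obtain T where T: "open T" "0 \<in> T" "smooth_on T a" "a 0 = a0"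
    "frechet_derivative a (at 0) (1, 0) = a1" "frechet_derivative a (at 0) (0, 1) = a2"
    "frechet_derivative (\<lambda>u. frechet_derivative a (at u) (0, 1)) (at 0) (1, 0) = a12"
    using assms(4) unfolding has_jet_def by blast
  have eq: "frechet_derivative a (at u) = frechet_derivative b (at u)" if "u \<in> S" for u
    by (rule frechet_derivative_cong[OF assms(1) that assms(3)])
  have "frechet_derivative (\<lambda>u. frechet_derivative a (at u) (0, 1)) (at 0) = frechet_derivative (\<lambda>u. frechet_derivative b (at u) (0, 1)) (at 0)"
    by (rule frechet_derivative_cong[OF assms(1,2)]) (simp add: eq)
  moreover have "smooth_on (S \<inter> T) b"
    using smooth_on_cong[of "S \<inter> T" a b] smooth_on_subset[OF T(3), of "S \<inter> T"] assms T by auto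
  ultimately show ?thesis
    unfolding has_jet_def using T assms eq[OF assms(2)] by (intro exI[of _ "S \<inter> T"]) auto
qed

lemma has_jet_const: "has_jet (\<lambda>u. c) c 0 0 0"
  unfolding has_jet_def by (intro exI[of _ UNIV]) (auto simp: smooth_on_const)

lemma has_jet_add:
  assumes "has_jet a a0 a1 a2 a12" "has_jet b b0 b1 b2 b12"
  shows "has_jet (\<lambda>u. a u + b u) (a0 + b0) (a1 + b1) (a2 + b2) (a12 + b12)"
proof -
  obtain S T where S: "open S" "0 \<in> S" "smooth_on S a" "a 0 = a0"
    "frechet_derivative a (at 0) (1, 0) = a1" "frechet_derivative a (at 0) (0, 1) = a2"
    "frechet_derivative (\<lambda>u. frechet_derivative a (at u) (0, 1)) (at 0) (1, 0) = a12"
    and T: "open T" "0 \<in> T" "smooth_on T b" "b 0 = b0"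
    "frechet_derivative b (at 0) (1, 0) = b1" "frechet_derivative b (at 0) (0, 1) = b2"
    "frechet_derivative (\<lambda>u. frechet_derivative b (at u) (0, 1)) (at 0) (1, 0) = b12"
    using assms unfolding has_jet_def by blast
  have D: "frechet_derivative (\<lambda>u. a u + b u) (at u) = (\<lambda>h. frechet_derivative a (at u) h + frechet_derivative b (at u) h)"
    if "u \<in> S \<inter> T" for u
    by (rule frechet_derivative_eqI, rule has_derivative_add)
      (use that S T in \<open>auto intro: smooth_on_has_derivative\<close>)
  have 2: "((\<lambda>u. frechet_derivative a (at u) (0, 1) + frechet_derivative b (at u) (0, 1)) has_derivative
    (\<lambda>h. frechet_derivative (\<lambda>u. frechet_derivative a (at u) (0, 1)) (at 0) h
       + frechet_derivative (\<lambda>u. frechet_derivative b (at u) (0, 1)) (at 0) h)) (at 0)"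
    by (rule has_derivative_add; rule smooth_on_has_derivative[OF smooth_on_frechet_derivative])
      (fact S T)+
  show ?thesis
    by (rule has_jetI[OF open_Int[OF S(1) T(1)] _ _ _ _ _ _ 2])
      (use S T D in \<open>auto intro!: smooth_on_add open_Int intro: smooth_on_subset\<close>)
qed

lemma has_jet_sum:
  assumes "\<And>i. i \<in> I \<Longrightarrow> has_jet (a i) (a0 i) (a1 i) (a2 i) (a12 i)"
  shows "has_jet (\<lambda>u. \<Sum>i\<in>I. a i u) (\<Sum>i\<in>I. a0 i) (\<Sum>i\<in>I. a1 i) (\<Sum>i\<in>I. a2 i) (\<Sum>i\<in>I. a12 i)"
  using assms
  by (induction I rule: infinite_finite_induct) (auto intro!: has_jet_add has_jet_const)

lemma has_jet_mult:
  assumes "has_jet a a0 a1 a2 a12" "has_jet b b0 b1 b2 b12"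
  shows "has_jet (\<lambda>u. a u * b u) (a0 * b0) (a0 * b1 + a1 * b0) (a0 * b2 + a2 * b0)
    (a0 * b12 + a1 * b2 + a2 * b1 + a12 * b0)"
proof -
  obtain S T where S: "open S" "0 \<in> S" "smooth_on S a" "a 0 = a0"
    "frechet_derivative a (at 0) (1, 0) = a1" "frechet_derivative a (at 0) (0, 1) = a2"
    "frechet_derivative (\<lambda>u. frechet_derivative a (at u) (0, 1)) (at 0) (1, 0) = a12"
    and T: "open T" "0 \<in> T" "smooth_on T b" "b 0 = b0"
    "frechet_derivative b (at 0) (1, 0) = b1" "frechet_derivative b (at 0) (0, 1) = b2"
    "frechet_derivative (\<lambda>u. frechet_derivative b (at u) (0, 1)) (at 0) (1, 0) = b12"
    using assms unfolding has_jet_def by blast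
  have D: "frechet_derivative (\<lambda>u. a u * b u) (at u) = (\<lambda>h. a u * frechet_derivative b (at u) h + frechet_derivative a (at u) h * b u)"
    if "u \<in> S \<inter> T" for u
    by (rule frechet_derivative_eqI, rule has_derivative_mult)
      (use that S T in \<open>auto intro: smooth_on_has_derivative\<close>)
  note Sd = smooth_on_has_derivative[OF S(3,2)] smooth_on_has_derivative[OF smooth_on_frechet_derivative[OF S(3)] S(2), of "(0, 1)"]
  note Td = smooth_on_has_derivative[OF T(3,2)] smooth_on_has_derivative[OF smooth_on_frechet_derivative[OF T(3)] T(2), of "(0, 1)"]
  note 2 = has_derivative_add[OF has_derivative_mult[OF Sd(1) Td(2)] has_derivative_mult[OF Sd(2) Td(1)]]
  show ?thesis
    by (rule has_jetI[OF open_Int[OF S(1) T(1)] _ _ _ _ _ _ 2])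
      (use S T D in \<open>auto intro!: smooth_on_mult open_Int intro: smooth_on_subset\<close>)
qed

text \<open>Second order chain rule: the Hessian of \<open>G\<close> pairs the two velocities
  \<open>v\<close> and \<open>w\<close>, its gradient meets the mixed derivative \<open>z\<close>.
  Through the latter the acceleration of a variation enters.\<close>

lemma has_jet_compose:
  fixes G :: "real^'n::finite \<Rightarrow> real" and \<gamma> :: "real \<times> real \<Rightarrow> real^'n"
  assumes V: "open V" "smooth_on V G" and S: "open S" "0 \<in> S" "smooth_on S \<gamma>" "\<gamma> ` S \<subseteq> V"
    and jet: "\<And>k. has_jet (\<lambda>u. \<gamma> u $ k) (x $ k) (v $ k) (w $ k) (z $ k)"
  shows "has_jet (\<lambda>u. G (\<gamma> u)) (G x) (\<Sum>k\<in>UNIV. partial_deriv k G x * v $ k)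
    (\<Sum>k\<in>UNIV. partial_deriv k G x * w $ k)
    (\<Sum>k\<in>UNIV. partial_deriv k G x * z $ k + (\<Sum>l\<in>UNIV. partial_deriv l (partial_deriv k G) x * v $ l) * w $ k)"
proof -
  have x: "\<gamma> 0 = x" using jet by (auto simp: has_jet_def vec_eq_iff)
  have smk: "smooth_on S (\<lambda>u. \<gamma> u $ k)" for k by (rule smooth_on_vec_nth[OF S(1,3)])
  have D: "((\<lambda>u. F (\<gamma> u)) has_derivative (\<lambda>h. \<Sum>k\<in>UNIV. partial_deriv k F (\<gamma> u) * frechet_derivative (\<lambda>u. \<gamma> u $ k) (at u) h)) (at u)"
    if F: "smooth_on V F" and u: "u \<in> S" for F :: "real^'n \<Rightarrow> real" and u
  proof -
    have uV: "\<gamma> u \<in> V" using S u by auto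
    have d\<gamma>: "(\<gamma> has_derivative frechet_derivative \<gamma> (at u)) (at u)"
      by (rule smooth_on_has_derivative[OF S(3) u])
    have k: "frechet_derivative \<gamma> (at u) h $ k = frechet_derivative (\<lambda>u. \<gamma> u $ k) (at u) h" for h k
      using frechet_derivative_eqI[OF bounded_linear.has_derivative[OF bounded_linear_vec_nth d\<gamma>], of k] by simp
    have "((\<lambda>u. F (\<gamma> u)) has_derivative (\<lambda>h. frechet_derivative F (at (\<gamma> u)) (frechet_derivative \<gamma> (at u) h))) (at u)"
      by (rule has_derivative_compose[OF d\<gamma> smooth_on_has_derivative[OF F uV]])
    then show ?thesis by (simp add: frechet_derivative_partial_sum[OF F uV] k)
  qed
  have jk: "frechet_derivative (\<lambda>u. \<gamma> u $ k) (at 0) (1, 0) = v $ k"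
    "frechet_derivative (\<lambda>u. \<gamma> u $ k) (at 0) (0, 1) = w $ k"
    "frechet_derivative (\<lambda>u. frechet_derivative (\<lambda>u. \<gamma> u $ k) (at u) (0, 1)) (at 0) (1, 0) = z $ k" for k
    using jet[of k] by (auto simp: has_jet_def)
  have 2: "((\<lambda>u. \<Sum>k\<in>UNIV. partial_deriv k G (\<gamma> u) * frechet_derivative (\<lambda>u. \<gamma> u $ k) (at u) (0, 1)) has_derivative
    (\<lambda>h. \<Sum>k\<in>UNIV. partial_deriv k G (\<gamma> 0) * frechet_derivative (\<lambda>u. frechet_derivative (\<lambda>u. \<gamma> u $ k) (at u) (0, 1)) (at 0) h
      + (\<Sum>l\<in>UNIV. partial_deriv l (partial_deriv k G) (\<gamma> 0) * frechet_derivative (\<lambda>u. \<gamma> u $ l) (at 0) h)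
        * frechet_derivative (\<lambda>u. \<gamma> u $ k) (at 0) (0, 1))) (at 0)"
    by (intro has_derivative_sum has_derivative_mult D partial_deriv_smooth V S(2)
        smooth_on_has_derivative[OF smooth_on_frechet_derivative[OF smk]])
  show ?thesis
  proof (rule has_jetI[OF S(1,2) _ _ _ _ _ 2])
    show "smooth_on S (\<lambda>u. G (\<gamma> u))"
      by (rule smooth_on_compose[OF S(1) V S(3,4)])
    show "frechet_derivative (\<lambda>u. G (\<gamma> u)) (at u) (0, 1)
      = (\<Sum>k\<in>UNIV. partial_deriv k G (\<gamma> u) * frechet_derivative (\<lambda>u. \<gamma> u $ k) (at u) (0, 1))" if "u \<in> S" for u
      using frechet_derivative_eqI[OF D[OF V(2) that]] by simp
  qed (simp_all add: x jk frechet_derivative_eqI[OF D[OF V(2) S(2)]])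
qed

lemma has_jet_powr:
  assumes "has_jet a a0 a1 a2 a12" and pos: "1 + a0 > 0"
  shows "has_jet (\<lambda>u. (1 + a u) powr r) ((1 + a0) powr r) (r * (1 + a0) powr (r - 1) * a1)
    (r * (1 + a0) powr (r - 1) * a2)
    (r * (1 + a0) powr (r - 1) * a12 + r * (r - 1) * (1 + a0) powr (r - 2) * a1 * a2)"
proof -
  obtain S where S: "open S" "0 \<in> S" "smooth_on S a" "a 0 = a0"
    "frechet_derivative a (at 0) (1, 0) = a1" "frechet_derivative a (at 0) (0, 1) = a2"
    "frechet_derivative (\<lambda>u. frechet_derivative a (at u) (0, 1)) (at 0) (1, 0) = a12"
    using assms unfolding has_jet_def by blast
  \<comment> \<open>On this neighbourhood the base \<open>1 + a u\<close> is positive, where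
    \<open>powr\<close> is smooth.\<close>
  define T where "T = S \<inter> a -` {-1<..}"
  have T: "open T" "0 \<in> T" "T \<subseteq> S" "\<And>u. u \<in> T \<Longrightarrow> 1 + a u > 0"
    using continuous_open_preimage[OF smooth_on_continuous_on[OF S(3)] S(1), of "{-1<..}"] S pos
    by (auto simp: T_def)
  have D: "((\<lambda>u. (1 + a u) powr q) has_derivative (\<lambda>h. q * (1 + a u) powr (q - 1) * frechet_derivative a (at u) h)) (at u)"
    if u: "u \<in> T" for u q
  proof -
    have "((\<lambda>u. 1 + a u) has_derivative frechet_derivative a (at u)) (at u)"
    proof -
      have "(a has_derivative frechet_derivative a (at u)) (at u)"
        by (rule smooth_on_has_derivative[OF S(3)]) (use u T(3) in blast)
      then show ?thesis by (auto intro!: derivative_eq_intros)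
    qed
    moreover have "((\<lambda>y. y powr q) has_derivative (\<lambda>h. q * (1 + a u) powr (q - 1) * h)) (at (1 + a u))"
      using has_real_derivative_powr[OF T(4)[OF u], of q] by (simp add: has_field_derivative_def)
    ultimately show ?thesis by (rule has_derivative_compose)
  qed
  note sd = smooth_on_has_derivative[OF smooth_on_frechet_derivative[OF S(3)] S(2), of "(0, 1)"]
  note 2 = has_derivative_mult[OF has_derivative_mult_right[OF D[OF T(2), of "r - 1"], of r] sd]
  show ?thesis
  proof (rule has_jetI[OF T(1,2) _ _ _ _ _ 2])
    show "smooth_on T (\<lambda>u. (1 + a u) powr r)"
      by (intro smooth_on_powr_compose smooth_on_add smooth_on_const T smooth_on_subset[OF S(3)])
    show "frechet_derivative (\<lambda>u. (1 + a u) powr r) (at u) (0, 1)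
      = r * (1 + a u) powr (r - 1) * frechet_derivative a (at u) (0, 1)" if "u \<in> T" for u
      by (simp add: frechet_derivative_eqI[OF D[OF that]])
  qed (simp_all add: S frechet_derivative_eqI[OF D[OF T(2)]] algebra_simps)
qed

section \<open>Functions depending smoothly on parameters\<close>

context riemannian_manifold
begin

definition smooth_param :: "'e::euclidean_space set \<Rightarrow> ('e \<Rightarrow> 'a \<Rightarrow> real) \<Rightarrow> bool" where
  "smooth_param T F \<longleftrightarrow> open T \<and> (\<forall>c\<in>A. smooth_on (T \<times> chart_img c) (\<lambda>z. F (fst z) (param c (snd z))))"

definition param_deriv :: "'e::euclidean_space \<Rightarrow> ('e \<Rightarrow> 'a \<Rightarrow> real) \<Rightarrow> 'e \<Rightarrow> 'a \<Rightarrow> real" where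
  "param_deriv v F u p = frechet_derivative (\<lambda>u. F u p) (at u) v"

lemma open_param_dom: "smooth_param T F \<Longrightarrow> c \<in> A \<Longrightarrow> open (T \<times> chart_img c)"
  by (auto simp: smooth_param_def intro!: open_Times)

lemma smooth_param_continuous:
  assumes "smooth_param T F"
  shows "continuous_on (T \<times> UNIV) (\<lambda>z. F (fst z) (snd z))"
proof -
  have "isCont (\<lambda>z. F (fst z) (snd z)) z" if z: "z \<in> T \<times> UNIV" for z
  proof -
    let ?c = "chart_at A (snd z)"
    note c = chart_at[of "snd z"]
    have 1: "continuous_on (T \<times> chart_dom ?c) (\<lambda>z. (fst z, coord ?c (snd z)))"
      by (intro continuous_intros continuous_on_compose2[OF continuous_coord[OF c(1)]]) auto
    have 2: "continuous_on (T \<times> chart_img ?c) (\<lambda>z. F (fst z) (param ?c (snd z)))"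
      using assms c(1) by (intro smooth_on_continuous_on) (simp add: smooth_param_def)
    have 3: "(\<lambda>z. (fst z, coord ?c (snd z))) ` (T \<times> chart_dom ?c) \<subseteq> T \<times> chart_img ?c"
      by auto
    have "continuous_on (T \<times> chart_dom ?c)
        (\<lambda>z. F (fst (fst z, coord ?c (snd z))) (param ?c (snd (fst z, coord ?c (snd z)))))"
      by (rule continuous_on_compose2[OF 2 1 3])
    then have "continuous_on (T \<times> chart_dom ?c) (\<lambda>z. F (fst z) (snd z))"
      by (rule continuous_on_eq) (use c in auto)
    moreover have "open (T \<times> chart_dom ?c)" using assms c by (auto simp: smooth_param_def intro!: open_Times)
    moreover have "z \<in> T \<times> chart_dom ?c" using z c by (auto simp: mem_Times_iff)
    ultimately show ?thesis using continuous_on_eq_continuous_at by blast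
  qed
  then show ?thesis by (simp add: continuous_at_imp_continuous_on)
qed

lemma smooth_param_slice_continuous:
  assumes "smooth_param T F" "u \<in> T"
  shows "continuous_on UNIV (F u)"
proof -
  have "continuous_on UNIV (\<lambda>p. (u, p))" by (intro continuous_intros)
  from continuous_on_compose2[OF smooth_param_continuous[OF assms(1)] this] assms(2)
  show ?thesis by auto
qed

lemma smooth_param_has_derivative:
  assumes F: "smooth_param T F" and u: "u \<in> T"
  shows "((\<lambda>u. F u p) has_derivative (\<lambda>v. param_deriv v F u p)) (at u)"
proof -
  let ?c = "chart_at A p"
  note c = chart_at[of p]
  have "((\<lambda>z. F (fst z) (param ?c (snd z))) has_derivative
      frechet_derivative (\<lambda>z. F (fst z) (param ?c (snd z))) (at (u, coord ?c p))) (at (u, coord ?c p))"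
    by (rule smooth_on_has_derivative[of "T \<times> chart_img ?c"]) (use F u c in \<open>auto simp: smooth_param_def\<close>)
  from frechet_derivative_slice(1)[OF this]
  have "(\<lambda>u. F u p) differentiable at u" using c by (auto simp: differentiable_def)
  then show ?thesis unfolding param_deriv_def by (simp add: frechet_derivative_works)
qed

lemma smooth_param_deriv:
  assumes F: "smooth_param T F"
  shows "smooth_param T (param_deriv v F)"
  unfolding smooth_param_def
proof (intro conjI ballI)
  show "open T" using F by (simp add: smooth_param_def)
  fix c assume c: "c \<in> A"
  have sm: "smooth_on (T \<times> chart_img c) (\<lambda>z. F (fst z) (param c (snd z)))"
    using F c by (simp add: smooth_param_def)
  have "param_deriv v F (fst z) (param c (snd z)) = frechet_derivative (\<lambda>z. F (fst z) (param c (snd z))) (at z) (v, 0)"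
    if "z \<in> T \<times> chart_img c" for z
  proof -
    obtain u x where z: "z = (u, x)" by fastforce
    from frechet_derivative_slice(1)[OF smooth_on_has_derivative[OF sm that, unfolded z]]
    show ?thesis unfolding param_deriv_def z by (simp add: frechet_derivative_eqI)
  qed
  then show "smooth_on (T \<times> chart_img c) (\<lambda>z. param_deriv v F (fst z) (param c (snd z)))"
    using smooth_on_frechet_derivative[OF sm, of "(v, 0)"]
    by (subst smooth_on_cong[OF open_param_dom[OF F c]]) auto
qed

lemma smooth_param_line:
  assumes F: "smooth_param T F" and u: "u + r *\<^sub>R v \<in> T"
  shows "((\<lambda>r. F (u + r *\<^sub>R v) p) has_real_derivative param_deriv v F (u + r *\<^sub>R v) p) (at r)"
  by (rule has_real_derivative_along[where c = "\<lambda>r. u + r *\<^sub>R v", OF smooth_param_has_derivative[OF F u]])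
    (auto intro!: derivative_eq_intros simp: has_vector_derivative_def)

end

context compact_riemannian_manifold
begin

text \<open>The tube lemma: compactness of the manifold turns a condition at parameter 0 into one
  neighbourhood of parameters that serves all points. It keeps the base of the power in the energy
  positive.\<close>

lemma param_tube:
  fixes F :: "'e::euclidean_space \<Rightarrow> 'a \<Rightarrow> real"
  assumes T: "open T" "0 \<in> T" and cont: "continuous_on (T \<times> UNIV) (\<lambda>z. F (fst z) (snd z))"
    and V: "open V" "\<And>p. F 0 p \<in> V"
  shows "\<exists>S. open S \<and> 0 \<in> S \<and> S \<subseteq> T \<and> (\<forall>u\<in>S. \<forall>p. F u p \<in> V)"
proof -
  let ?W = "(T \<times> (UNIV :: 'a set)) \<inter> (\<lambda>z. F (fst z) (snd z)) -` V"
  have W: "open ?W"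
    by (rule continuous_open_preimage[OF cont _ V(1)]) (use T in \<open>auto intro!: open_Times\<close>)
  define P where "P = (\<lambda>p S U. open S \<and> open U \<and> 0 \<in> S \<and> p \<in> U \<and> S \<times> U \<subseteq> ?W)"
  have "\<exists>S U. P p S U" for p
  proof -
    have "(0, p) \<in> ?W" using T V by simp
    from open_prod_elim[OF W this]
    obtain S U where "open S" "open U" "(0, p) \<in> S \<times> U" "S \<times> U \<subseteq> ?W" .
    then have "P p S U" by (simp add: P_def)
    then show ?thesis by blast
  qed
  then obtain S U where SU: "\<And>p. P p (S p) (U p)" by metis
  obtain I where I: "finite I" "UNIV \<subseteq> (\<Union>p\<in>I. U p)"
  proof (rule compactE_image[OF compact_UNIV, of UNIV U])
    show "open (U p)" for p using SU[of p] by (simp add: P_def)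
    show "UNIV \<subseteq> (\<Union>p. U p)" using SU by (auto simp: P_def)
  qed auto
  let ?S = "T \<inter> (\<Inter>p\<in>I. S p)"
  have "open ?S" using I SU T by (auto simp: P_def intro!: open_Int open_INT)
  moreover have "0 \<in> ?S" using SU T by (auto simp: P_def)
  moreover have "F u p \<in> V" if "u \<in> ?S" for u p
  proof -
    obtain q where "q \<in> I" "p \<in> U q" using I(2) by blast
    then have "(u, p) \<in> S q \<times> U q" using that by auto
    then have "(u, p) \<in> ?W" using SU[of q] unfolding P_def by blast
    then show ?thesis by simp
  qed
  ultimately show ?thesis by (intro exI[of _ ?S]) auto
qed

text \<open>Dominated convergence for difference quotients. On a compact interval of parameters
  times the compact manifold the derivative is bounded by a constant, which bounds the quotients and
  is integrable because the volume is finite.\<close>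

lemma integral_param_has_derivative:
  assumes F: "smooth_param T F" and u: "u \<in> T"
  shows "((\<lambda>r. LINT p|vol. F (u + r *\<^sub>R v) p) has_real_derivative (LINT p|vol. param_deriv v F u p)) (at 0)"
proof -
  have T: "open T" using F by (simp add: smooth_param_def)
  have F': "smooth_param T (param_deriv v F)" by (rule smooth_param_deriv[OF F])
  have "open ((\<lambda>r. u + r *\<^sub>R v) -` T)"
    by (rule open_vimage[OF T]) (intro continuous_intros)
  then obtain e where e: "e > 0" "cball 0 e \<subseteq> (\<lambda>r. u + r *\<^sub>R v) -` T"
    using open_contains_cball[THEN iffD1, rule_format, of "(\<lambda>r. u + r *\<^sub>R v) -` T" 0] u by auto
  have inT: "u + r *\<^sub>R v \<in> T" if "\<bar>r\<bar> \<le> e" for r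
    using e(2) that by (auto simp: subset_iff)
  have "compact (cball (0::real) e \<times> (UNIV :: 'a set))"
    by (intro compact_Times compact_UNIV compact_cball)
  moreover have "continuous_on (cball 0 e \<times> UNIV) (\<lambda>z. param_deriv v F (u + fst z *\<^sub>R v) (snd z))"
  proof -
    have "continuous_on (cball 0 e \<times> UNIV) (\<lambda>z. (u + fst z *\<^sub>R v, snd z))"
      by (intro continuous_intros)
    moreover have "(\<lambda>z. (u + fst z *\<^sub>R v, snd z)) ` (cball 0 e \<times> (UNIV :: 'a set)) \<subseteq> T \<times> UNIV"
      using inT by auto
    ultimately show ?thesis
      using continuous_on_compose2[OF smooth_param_continuous[OF F']] by fastforce
  qed
  ultimately have "compact ((\<lambda>z. param_deriv v F (u + fst z *\<^sub>R v) (snd z)) ` (cball 0 e \<times> UNIV))"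
    using compact_continuous_image by blast
  then obtain B where B: "\<And>r p. \<bar>r\<bar> \<le> e \<Longrightarrow> \<bar>param_deriv v F (u + r *\<^sub>R v) p\<bar> \<le> B"
  proof -
    have "bounded ((\<lambda>z. param_deriv v F (u + fst z *\<^sub>R v) (snd z)) ` (cball 0 e \<times> UNIV))"
      by (rule compact_imp_bounded) fact
    then obtain B where "\<forall>x\<in>cball 0 e. \<forall>y. \<bar>param_deriv v F (u + x *\<^sub>R v) y\<bar> \<le> B"
      unfolding bounded_iff by auto
    then show ?thesis by (intro that[of B]) simp
  qed
  have lip: "\<bar>F (u + r *\<^sub>R v) p - F u p\<bar> \<le> B * \<bar>r\<bar>" if "\<bar>r\<bar> \<le> e" for r p
  proof -
    have "norm (F (u + r *\<^sub>R v) p - F (u + 0 *\<^sub>R v) p) \<le> B * norm (r - 0)"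
    proof (rule field_differentiable_bound[of "cball 0 e"])
      show "((\<lambda>r. F (u + r *\<^sub>R v) p) has_field_derivative param_deriv v F (u + s *\<^sub>R v) p) (at s within cball 0 e)"
        if "s \<in> cball 0 e" for s
        by (rule has_field_derivative_at_within, rule smooth_param_line[OF F inT]) (use that in simp)
    qed (use B that e in auto)
    then show ?thesis by simp
  qed
  have "((\<lambda>r. ((LINT p|vol. F (u + r *\<^sub>R v) p) - (LINT p|vol. F (u + 0 *\<^sub>R v) p)) / (r - 0)) \<longlongrightarrow> (LINT p|vol. param_deriv v F u p)) (at 0)"
    unfolding tendsto_at_iff_sequentially
  proof (intro allI impI)
    fix X :: "nat \<Rightarrow> real" assume X: "\<forall>i. X i \<in> UNIV - {0}" "X \<longlonglongrightarrow> 0"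
    have ev: "\<forall>\<^sub>F i in sequentially. \<bar>X i\<bar> < e"
      using tendstoD[OF X(2) e(1)] by simp
    then obtain N where N: "\<And>i. i \<ge> N \<Longrightarrow> \<bar>X i\<bar> < e"
      unfolding eventually_sequentially by blast
    \<comment> \<open>The bound holds for increments below \<open>e\<close> only, so the sequence is
      started at \<open>N\<close>.\<close>
    define Q where "Q = (\<lambda>i p. (F (u + X (i + N) *\<^sub>R v) p - F u p) / X (i + N))"
    have X': "(\<lambda>i. X (i + N)) \<longlonglongrightarrow> 0" using LIMSEQ_ignore_initial_segment[OF X(2)] .
    have int: "integrable vol (F (u + X (i + N) *\<^sub>R v))" "integrable vol (F u)" for i
    proof -
      have "u + X (i + N) *\<^sub>R v \<in> T"
        by (rule inT[OF less_imp_le[OF N]]) simp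
      then show "integrable vol (F (u + X (i + N) *\<^sub>R v))"
        by (rule integrable_vol_continuous[OF smooth_param_slice_continuous[OF F]])
      show "integrable vol (F u)"
        by (rule integrable_vol_continuous[OF smooth_param_slice_continuous[OF F u]])
    qed
    have "(\<lambda>i. LINT p|vol. Q i p) \<longlonglongrightarrow> (LINT p|vol. param_deriv v F u p)"
    proof (rule integral_dominated_convergence[where w = "\<lambda>_. B"])
      show "param_deriv v F u \<in> borel_measurable vol"
        using borel_measurable_continuous_onI[OF smooth_param_slice_continuous[OF F' u]] by simp
      show "Q i \<in> borel_measurable vol" for i
        unfolding Q_def
        by (intro borel_measurable_divide borel_measurable_diff borel_measurable_integrable int borel_measurable_const)
      show "AE p in vol. (\<lambda>i. Q i p) \<longlonglongrightarrow> param_deriv v F u p"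
      proof (rule AE_I2)
        fix p
        have "((\<lambda>r. (F (u + r *\<^sub>R v) p - F (u + 0 *\<^sub>R v) p) / (r - 0)) \<longlongrightarrow> param_deriv v F (u + 0 *\<^sub>R v) p) (at 0)"
          using smooth_param_line[OF F, of u 0 v] u by (simp add: has_field_derivative_iff)
        then show "(\<lambda>i. Q i p) \<longlonglongrightarrow> param_deriv v F u p"
          using X(1) X' unfolding tendsto_at_iff_sequentially Q_def o_def by simp
      qed
      show "AE p in vol. norm (Q i p) \<le> B" for i
      proof (rule AE_I2)
        fix p
        have "X (i + N) \<noteq> 0" using X(1) by simp
        moreover have "\<bar>X (i + N)\<bar> \<le> e" by (rule less_imp_le[OF N]) simp
        ultimately show "norm (Q i p) \<le> B"
          using lip[of "X (i + N)" p] by (simp add: Q_def abs_divide divide_le_eq)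
      qed
    qed simp
    moreover have "(LINT p|vol. Q i p) = ((LINT p|vol. F (u + X (i + N) *\<^sub>R v) p) - (LINT p|vol. F u p)) / X (i + N)" for i
      unfolding Q_def using int(1)[of i] int(2) by simp
    ultimately have "(\<lambda>i. ((LINT p|vol. F (u + X (i + N) *\<^sub>R v) p) - (LINT p|vol. F u p)) / X (i + N)) \<longlonglongrightarrow> (LINT p|vol. param_deriv v F u p)"
      by simp
    then have "(\<lambda>i. ((\<lambda>r. ((LINT p|vol. F (u + r *\<^sub>R v) p) - (LINT p|vol. F (u + 0 *\<^sub>R v) p)) / (r - 0)) \<circ> X) (i + N)) \<longlonglongrightarrow> (LINT p|vol. param_deriv v F u p)"
      by (simp add: o_def)
    then show "((\<lambda>r. ((LINT p|vol. F (u + r *\<^sub>R v) p) - (LINT p|vol. F (u + 0 *\<^sub>R v) p)) / (r - 0)) \<circ> X) \<longlonglongrightarrow> (LINT p|vol. param_deriv v F u p)"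
      by (rule LIMSEQ_offset)
  qed
  then show ?thesis by (simp add: has_field_derivative_iff)
qed

lemma second_deriv_integral:
  fixes F :: "real \<times> real \<Rightarrow> 'a \<Rightarrow> real"
  assumes F: "smooth_param T F" and T: "0 \<in> T"
  shows "deriv (\<lambda>t. deriv (\<lambda>s. LINT p|vol. F (t, s) p) 0) 0
    = (LINT p|vol. param_deriv (1, 0) (param_deriv (0, 1) F) 0 p)"
proof -
  have oT: "open T" using F by (simp add: smooth_param_def)
  have "open ((\<lambda>t. (t, 0)) -` T)"
    by (rule open_vimage[OF oT]) (intro continuous_intros)
  then have ev: "\<forall>\<^sub>F t in nhds 0. (t, 0) \<in> T"
    unfolding eventually_nhds using T by (intro exI[of _ "(\<lambda>t. (t, 0)) -` T"]) (auto simp: zero_prod_def)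
  have "deriv (\<lambda>s. LINT p|vol. F (t, s) p) 0 = (LINT p|vol. param_deriv (0, 1) F (t, 0) p)"
    if "(t, 0) \<in> T" for t
    using integral_param_has_derivative[OF F that, of "(0, 1)"] by (intro DERIV_imp_deriv) simp
  then have "deriv (\<lambda>t. deriv (\<lambda>s. LINT p|vol. F (t, s) p) 0) 0 = deriv (\<lambda>t. LINT p|vol. param_deriv (0, 1) F (t, 0) p) 0"
    by (intro deriv_cong_ev eventually_mono[OF ev]) auto
  also have "\<dots> = (LINT p|vol. param_deriv (1, 0) (param_deriv (0, 1) F) 0 p)"
    using integral_param_has_derivative[OF smooth_param_deriv[OF F, of "(0, 1)"] T, of "(1, 0)"]
    by (intro DERIV_imp_deriv) simp
  finally show ?thesis .
qed

end

section \<open>The energy density\<close>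

lemma matrix_inv_eqI:
  fixes X Y :: "real^'n^'n::finite"
  assumes "X ** Y = mat 1"
  shows "matrix_inv X = Y"
proof -
  have "det X * det Y = 1" using assms det_mul[of X Y] by simp
  then have "det X \<noteq> 0" by auto
  have "matrix_inv X = matrix_inv X ** (X ** Y)" by (simp add: assms)
  also have "\<dots> = Y" by (simp add: matrix_mul_assoc matrix_inv_left[OF \<open>det X \<noteq> 0\<close>])
  finally show ?thesis .
qed

context riemannian_manifold
begin

definition energy :: "('a, 'm) chart \<Rightarrow> ('a, 'm) chart \<Rightarrow> 'a \<Rightarrow> 'a \<Rightarrow> real^'m^'m \<Rightarrow> real" where
  "energy c d p q J = trace (matrix_inv (g p c) ** transpose J ** g q d ** J)"

text \<open>\<open>norm_sq_differential\<close> uses arbitrarily chosen charts, and this invariance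
  allows computing in any others. The Jacobians cancel inside the product, except for a pair at its
  two ends, which cyclicity of the trace removes.\<close>

lemma energy_trans:
  assumes c: "c \<in> A" "c' \<in> A" "p \<in> chart_dom c" "p \<in> chart_dom c'"
    and d: "d \<in> A" "d' \<in> A" "q \<in> chart_dom d" "q \<in> chart_dom d'"
  shows "energy c' d' p q (transition_jacobian d d' q ** J ** transition_jacobian c' c p) = energy c d p q J"
proof -
  define B where "B = transition_jacobian d d' q"
  define C where "C = transition_jacobian c' c p"
  define C' where "C' = transition_jacobian c c' p"
  have CC: "C ** C' = mat 1" "C' ** C = mat 1"
    unfolding C_def C'_def using transition_jacobian_inverse c by auto
  have CT: "transpose C' ** transpose C = mat 1" "transpose C ** transpose C' = mat 1"
    using CC by (simp_all add: matrix_transpose_mul[symmetric] transpose_mat)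
  have gc: "g p c' = transpose C ** g p c ** C"
    unfolding C_def by (rule metric_trans) (use c in auto)
  have gd: "g q d = transpose B ** g q d' ** B"
    unfolding B_def by (rule metric_trans) (use d in auto)
  have nz: "det (g p c) \<noteq> 0" using det_metric_pos[OF c(1,3)] by simp
  have "g p c' ** (C' ** matrix_inv (g p c) ** transpose C')
      = transpose C ** (g p c ** ((C ** C') ** matrix_inv (g p c))) ** transpose C'"
    by (simp only: gc matrix_mul_assoc)
  also have "\<dots> = mat 1"
    by (simp add: CC CT matrix_inv_right[OF nz])
  finally have inv: "matrix_inv (g p c') = C' ** matrix_inv (g p c) ** transpose C'"
    by (rule matrix_inv_eqI)
  have "energy c' d' p q (B ** J ** C)
      = trace (C' ** matrix_inv (g p c) ** (transpose C' ** transpose C) ** transpose J ** (transpose B ** g q d' ** B) ** J ** C)"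
    by (simp add: energy_def inv matrix_transpose_mul matrix_mul_assoc)
  also have "\<dots> = trace (C' ** (matrix_inv (g p c) ** transpose J ** g q d ** J ** C))"
    by (simp add: CT gd[symmetric] matrix_mul_assoc)
  also have "\<dots> = trace (matrix_inv (g p c) ** transpose J ** g q d ** J ** (C ** C'))"
    by (subst trace_mul_sym) (simp add: matrix_mul_assoc)
  also have "\<dots> = energy c d p q J" by (simp add: CC energy_def)
  finally show ?thesis by (simp add: B_def C_def)
qed

lemma norm_sq_differential_chart:
  assumes \<psi>: "continuous_on UNIV \<psi>"
    and c: "c \<in> A" "p \<in> chart_dom c" and d: "d \<in> A" "\<psi> p \<in> chart_dom d"
    and L: "((\<lambda>y. coord d (\<psi> (param c y))) has_derivative L) (at (coord c p))"
  shows "norm_sq_differential A g A g \<psi> p = energy c d p (\<psi> p) (matrix L)"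
proof -
  define c0 where "c0 = chart_at A p"
  define d0 where "d0 = chart_at A (\<psi> p)"
  have c0: "c0 \<in> A" "p \<in> chart_dom c0" and d0: "d0 \<in> A" "\<psi> p \<in> chart_dom d0"
    using chart_at by (auto simp: c0_def d0_def)
  let ?x = "coord c0 p"
  define V where "V = {y\<in>chart_img c0. param c0 y \<in> chart_dom c \<inter> \<psi> -` (chart_dom d \<inter> chart_dom d0)}"
  have V: "open V" unfolding V_def
    by (rule open_param_vimage[OF c0(1)]) (use c d d0 in \<open>auto intro!: open_Int open_vimage[OF _ \<psi>]\<close>)
  have xV: "?x \<in> V" using c d c0 d0 by (simp add: V_def)
  have tx: "trans c0 c ?x = coord c p" using c0 by (simp add: trans_coord)
  have 1: "(trans c0 c has_derivative dtrans c0 c ?x) (at ?x)"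
    by (rule trans_has_derivative) (use c c0 coord_overlap in auto)
  have 2: "((\<lambda>y. coord d (\<psi> (param c y))) has_derivative L) (at (trans c0 c ?x))"
    using L by (simp add: tx)
  have 3: "(trans d d0 has_derivative dtrans d d0 (coord d (\<psi> p))) (at (coord d (\<psi> (param c (trans c0 c ?x)))))"
    using trans_has_derivative[OF d(1) d0(1) coord_overlap[OF d(2) d0(2)]] c by (simp add: tx)
  have "((\<lambda>y. trans d d0 (coord d (\<psi> (param c (trans c0 c y))))) has_derivative
      (\<lambda>v. dtrans d d0 (coord d (\<psi> p)) (L (dtrans c0 c ?x v)))) (at ?x)"
    by (rule has_derivative_compose[OF has_derivative_compose[OF 1 2] 3])
  then have D: "((coord d0 \<circ> \<psi> \<circ> param c0) has_derivative
      (\<lambda>v. dtrans d d0 (coord d (\<psi> p)) (L (dtrans c0 c ?x v)))) (at ?x)"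
    by (rule has_derivative_transform_within_open[OF _ V xV]) (use c c0 d in \<open>auto simp: V_def trans_def\<close>)
  have lin: "linear L" "linear (dtrans c0 c ?x)" "linear (dtrans d d0 (coord d (\<psi> p)))"
    using has_derivative_linear[OF 1] has_derivative_linear[OF 2] has_derivative_linear[OF 3] by auto
  have "jacobian (coord d0 \<circ> \<psi> \<circ> param c0) (at ?x)
      = matrix (\<lambda>v. dtrans d d0 (coord d (\<psi> p)) (L (dtrans c0 c ?x v)))"
    unfolding jacobian_def frechet_derivative_eqI[OF D] ..
  also have "\<dots> = transition_jacobian d d0 (\<psi> p) ** matrix L ** transition_jacobian c0 c p"
  proof -
    have "matrix (\<lambda>v. dtrans d d0 (coord d (\<psi> p)) (L (dtrans c0 c ?x v))) *v v
        = (transition_jacobian d d0 (\<psi> p) ** matrix L ** transition_jacobian c0 c p) *v v" for v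
      using has_derivative_linear[OF D] lin
      by (simp add: matrix_vector_mul_assoc[symmetric] transition_jacobian)
    then show ?thesis by (metis matrix_eq)
  qed
  finally have J: "jacobian (coord d0 \<circ> \<psi> \<circ> param c0) (at ?x)
      = transition_jacobian d d0 (\<psi> p) ** matrix L ** transition_jacobian c0 c p" .
  have "norm_sq_differential A g A g \<psi> p = energy c0 d0 p (\<psi> p) (jacobian (coord d0 \<circ> \<psi> \<circ> param c0) (at ?x))"
    unfolding norm_sq_differential_def Let_def energy_def c0_def d0_def ..
  also have "\<dots> = energy c d p (\<psi> p) (matrix L)"
    unfolding J by (rule energy_trans) (use c c0 d d0 in auto)
  finally show ?thesis .
qed

text \<open>The spatial Jacobian is taken from the derivative of the joint map in the directions
  \<open>(0, axis i 1)\<close>, so that its smoothness in parameter and point together is inherited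
  from \<open>family_rep\<close>.\<close>

definition family_jac :: "('e::euclidean_space \<Rightarrow> 'a \<Rightarrow> 'a) \<Rightarrow> ('a, 'm) chart \<Rightarrow> ('a, 'm) chart \<Rightarrow> 'e \<times> (real^'m) \<Rightarrow> real^'m^'m" where
  "family_jac \<Psi> c d z = (\<chi> a i. frechet_derivative (\<lambda>z. family_rep \<Psi> c d z $ a) (at z) (0, axis i 1))"

lemma family_norm_sq:
  assumes \<Psi>: "smooth_family T \<Psi>" and cd: "c \<in> A" "d \<in> A" and z: "z \<in> family_dom T \<Psi> c d"
  shows "norm_sq_differential A g A g (\<Psi> (fst z)) (param c (snd z))
    = energy c d (param c (snd z)) (\<Psi> (fst z) (param c (snd z))) (family_jac \<Psi> c d z)"
proof -
  obtain u x where ux: "z = (u, x)" by fastforce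
  let ?R = "family_rep \<Psi> c d"
  have u: "u \<in> T" "x \<in> chart_img c" "\<Psi> u (param c x) \<in> chart_dom d"
    using z by (auto simp: ux family_dom_def)
  have R: "(?R has_derivative frechet_derivative ?R (at z)) (at z)"
    by (rule smooth_on_has_derivative[OF smooth_familyD(3)[OF \<Psi> cd] z])
  have L: "((\<lambda>y. coord d (\<Psi> u (param c y))) has_derivative (\<lambda>v. frechet_derivative ?R (at z) (0, v))) (at (coord c (param c x)))"
    using frechet_derivative_slice(2)[OF R[unfolded ux]] u cd by (simp add: family_rep_def ux)
  have "frechet_derivative (\<lambda>z. ?R z $ a) (at z) h = frechet_derivative ?R (at z) h $ a" for a h
    using frechet_derivative_eqI[OF bounded_linear.has_derivative[OF bounded_linear_vec_nth R], of a] by simp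
  then have "matrix (\<lambda>v. frechet_derivative ?R (at z) (0, v)) = family_jac \<Psi> c d z"
    by (simp add: matrix_def family_jac_def)
  moreover have "continuous_on UNIV (\<Psi> u)"
  proof -
    have "continuous_on UNIV (\<lambda>p. (u, p))" by (intro continuous_intros)
    from continuous_on_compose2[OF smooth_familyD(2)[OF \<Psi>] this] u(1) show ?thesis by auto
  qed
  ultimately show ?thesis
    using norm_sq_differential_chart[OF _ cd(1) _ cd(2) _ L] u cd by (simp add: ux)
qed

lemma energy_expand:
  "energy c d p q J = (\<Sum>i\<in>UNIV. \<Sum>j\<in>UNIV. matrix_inv (g p c) $ i $ j *
     (\<Sum>a\<in>UNIV. \<Sum>b\<in>UNIV. g q d $ a $ b * J $ a $ j * J $ b $ i))"
proof -
  have "energy c d p q J = (\<Sum>i\<in>UNIV. \<Sum>b\<in>UNIV. \<Sum>a\<in>UNIV. \<Sum>j\<in>UNIV. matrix_inv (g p c) $ i $ j * J $ a $ j * g q d $ a $ b * J $ b $ i)"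
    unfolding energy_def trace_def matrix_matrix_mult_def transpose_def by (simp add: sum_distrib_right)
  also have "\<dots> = (\<Sum>i\<in>UNIV. \<Sum>j\<in>UNIV. \<Sum>a\<in>UNIV. \<Sum>b\<in>UNIV. matrix_inv (g p c) $ i $ j * J $ a $ j * g q d $ a $ b * J $ b $ i)"
  proof (rule sum.cong[OF refl])
    fix i :: 'm
    let ?f = "\<lambda>b a j. matrix_inv (g p c) $ i $ j * J $ a $ j * g q d $ a $ b * J $ b $ i"
    have "(\<Sum>b\<in>UNIV. \<Sum>a\<in>UNIV. \<Sum>j\<in>UNIV. ?f b a j) = (\<Sum>b\<in>UNIV. \<Sum>j\<in>UNIV. \<Sum>a\<in>UNIV. ?f b a j)"
      by (intro sum.cong refl sum.swap)
    also have "\<dots> = (\<Sum>j\<in>UNIV. \<Sum>b\<in>UNIV. \<Sum>a\<in>UNIV. ?f b a j)" by (rule sum.swap)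
    also have "\<dots> = (\<Sum>j\<in>UNIV. \<Sum>a\<in>UNIV. \<Sum>b\<in>UNIV. ?f b a j)" by (intro sum.cong refl sum.swap)
    finally show "(\<Sum>b\<in>UNIV. \<Sum>a\<in>UNIV. \<Sum>j\<in>UNIV. ?f b a j) = (\<Sum>j\<in>UNIV. \<Sum>a\<in>UNIV. \<Sum>b\<in>UNIV. ?f b a j)" .
  qed
  also have "\<dots> = (\<Sum>i\<in>UNIV. \<Sum>j\<in>UNIV. matrix_inv (g p c) $ i $ j *
     (\<Sum>a\<in>UNIV. \<Sum>b\<in>UNIV. g q d $ a $ b * J $ a $ j * J $ b $ i))"
    by (simp add: sum_distrib_left mult_ac)
  finally show ?thesis .
qed

lemma smooth_metric_inv:
  assumes "c \<in> A" shows "smooth_on (chart_img c) (\<lambda>x. matrix_inv (g (param c x) c) $ i $ j)"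
proof (rule smooth_on_matrix_inv)
  show "det (g (param c x) c) \<noteq> 0" if "x \<in> chart_img c" for x
    using det_metric_pos[OF assms param_in[OF assms that]] by simp
qed (use assms metric_smooth_nth in auto)

lemma family_rep_in: "c \<in> A \<Longrightarrow> d \<in> A \<Longrightarrow> z \<in> family_dom T \<Psi> c d \<Longrightarrow>
    family_rep \<Psi> c d z \<in> chart_img d \<and> param d (family_rep \<Psi> c d z) = \<Psi> (fst z) (param c (snd z))"
  by (auto simp: family_dom_def family_rep_def)

lemma smooth_norm_sq:
  assumes \<Psi>: "smooth_family T \<Psi>"
  shows "smooth_param T (\<lambda>u p. norm_sq_differential A g A g (\<Psi> u) p)"
  unfolding smooth_param_def
proof (intro conjI ballI smooth_familyD(1)[OF \<Psi>])
  fix c assume c: "c \<in> A"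
  let ?N = "\<lambda>z. norm_sq_differential A g A g (\<Psi> (fst z)) (param c (snd z))"
  show "smooth_on (T \<times> chart_img c) ?N"
  proof (rule smooth_on_local)
    fix z assume z: "z \<in> T \<times> chart_img c"
    define d where "d = chart_at A (\<Psi> (fst z) (param c (snd z)))"
    have d: "d \<in> A" "\<Psi> (fst z) (param c (snd z)) \<in> chart_dom d"
      using chart_at by (auto simp: d_def)
    let ?D = "family_dom T \<Psi> c d"
    have o: "open ?D" by (rule open_family_dom[OF \<Psi> c d(1)])
    note R = smooth_familyD(3)[OF \<Psi> c d(1)]
    have J: "smooth_on ?D (\<lambda>z. family_jac \<Psi> c d z $ a $ i)" for a i
      unfolding family_jac_def vec_lambda_beta
      by (rule smooth_on_frechet_derivative[OF smooth_on_vec_nth[OF o R]])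
    have G: "smooth_on ?D (\<lambda>z. g (\<Psi> (fst z) (param c (snd z))) d $ a $ b)" for a b
    proof -
      have "smooth_on ?D (\<lambda>z. g (param d (family_rep \<Psi> c d z)) d $ a $ b)"
        by (rule smooth_on_compose[OF o open_chart_img[OF d(1)] metric_smooth_nth[OF d(1)] R])
          (use family_rep_in[OF c d(1)] in blast)
      then show ?thesis
        by (subst smooth_on_cong[OF o, of _ "\<lambda>z. g (param d (family_rep \<Psi> c d z)) d $ a $ b"])
          (simp_all add: family_rep_in[OF c d(1)])
    qed
    have I: "smooth_on ?D (\<lambda>z. matrix_inv (g (param c (snd z)) c) $ i $ j)" for i j
      by (rule smooth_on_compose[OF o open_chart_img[OF c] smooth_metric_inv[OF c] smooth_on_snd[OF o smooth_on_ident]])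
        (auto simp: family_dom_def)
    have "smooth_on ?D (\<lambda>z. energy c d (param c (snd z)) (\<Psi> (fst z) (param c (snd z))) (family_jac \<Psi> c d z))"
      unfolding energy_expand by (intro smooth_on_sum smooth_on_mult o J G I)
    then have "smooth_on ?D ?N"
      by (subst smooth_on_cong[OF o]) (auto simp: family_norm_sq[OF \<Psi> c d(1)])
    moreover have "z \<in> ?D" using z d by (auto simp: family_dom_def)
    ultimately show "\<exists>S. open S \<and> z \<in> S \<and> smooth_on S ?N" using o by blast
  qed
qed

end

section \<open>The pulled back metric\<close>

lemma has_jet_slice:
  fixes F :: "(real \<times> real) \<times> (real^'n::finite) \<Rightarrow> real"
  assumes D: "open D" "(0, x) \<in> D" and F: "smooth_on D F"
  shows "has_jet (\<lambda>u. F (u, x)) (F (0, x)) (frechet_derivative F (at (0, x)) ((1, 0), 0))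
    (frechet_derivative F (at (0, x)) ((0, 1), 0))
    (frechet_derivative (\<lambda>z. frechet_derivative F (at z) ((0, 1), 0)) (at (0, x)) ((1, 0), 0))"
proof -
  let ?S = "(\<lambda>u. (u, x)) -` D"
  have S: "open ?S" by (rule open_vimage[OF D(1)]) (intro continuous_intros)
  have d: "((\<lambda>u. F (u, x)) has_derivative (\<lambda>v. frechet_derivative F (at (u, x)) (v, 0))) (at u)" if "u \<in> ?S" for u
    using frechet_derivative_slice(1)[OF smooth_on_has_derivative[OF F]] that by simp
  have d2: "((\<lambda>u. frechet_derivative F (at (u, x)) ((0, 1), 0)) has_derivative
      (\<lambda>v. frechet_derivative (\<lambda>z. frechet_derivative F (at z) ((0, 1), 0)) (at (0, x)) (v, 0))) (at 0)"
    by (rule frechet_derivative_slice(1)[OF smooth_on_has_derivative[OF smooth_on_frechet_derivative[OF F] D(2)]])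
  have sm: "smooth_on ?S (\<lambda>u. F (u, x))"
    by (rule smooth_on_compose[OF S D(1) F smooth_on_Pair[OF S smooth_on_ident smooth_on_const]]) auto
  show ?thesis
    by (rule has_jetI[OF S _ sm _ _ _ _ d2])
      (use D(2) frechet_derivative_eqI[OF d] in auto)
qed

lemma partial_deriv_slice:
  fixes F :: "'e::euclidean_space \<times> (real^'n::finite) \<Rightarrow> real"
  assumes "smooth_on D F" "(u, x) \<in> D"
  shows "frechet_derivative F (at (u, x)) (0, axis i 1) = partial_deriv i (\<lambda>y. F (u, y)) x"
  using partial_deriv_has_derivative[OF frechet_derivative_slice(2)[OF smooth_on_has_derivative[OF assms]]] by simp

lemma sum_delta_mult:
  fixes f :: "'n::finite \<Rightarrow> real"
  shows "(\<Sum>a\<in>UNIV. (if a = i then 1 else 0) * f a) = f i" "(\<Sum>a\<in>UNIV. f a * (if a = i then 1 else 0)) = f i"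
proof -
  have "(\<Sum>a\<in>UNIV. (if a = i then 1 else 0) * f a) = (\<Sum>a\<in>UNIV. if a = i then f a else 0)"
    "(\<Sum>a\<in>UNIV. f a * (if a = i then 1 else 0)) = (\<Sum>a\<in>UNIV. if a = i then f a else 0)"
    by (intro sum.cong refl; simp)+
  then show "(\<Sum>a\<in>UNIV. (if a = i then 1 else 0) * f a) = f i" "(\<Sum>a\<in>UNIV. f a * (if a = i then 1 else 0)) = f i"
    by simp_all
qed

text \<open>With \<open>J = DW\<close>, \<open>A = \<partial>\<^sub>W g\<close>, \<open>S = \<partial>\<^sup>2 g(W, W)\<close> and \<open>R = \<partial>\<^sub>W J\<close>, the two hypotheses are \<open>L\<^sub>W g = 2 \<lambda> g\<close> and
  its derivative along \<open>W\<close>; the left hand side of the conclusion is the second derivative of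
  the pulled back metric, and the last three terms of the right hand side are
  \<open>L\<^sub>Y g\<close> for \<open>Y = Z - JW\<close>, where \<open>Q = DZ\<close>.\<close>
lemma conformal_hessian_algebra:
  fixes G A S J Q R GZ GJW :: "'n::finite \<Rightarrow> 'n \<Rightarrow> real" and l wl :: real
  assumes 1: "\<And>i j. A i j + (\<Sum>a\<in>UNIV. G a j * J a i) + (\<Sum>a\<in>UNIV. G i a * J a j) = 2 * l * G i j"
    and 2: "\<And>i j. S i j + GJW i j + (\<Sum>a\<in>UNIV. R a i * G a j + J a i * A a j)
        + (\<Sum>a\<in>UNIV. G i a * R a j + A i a * J a j) = 2 * wl * G i j + 2 * l * A i j"
  shows "S i j + GZ i j + 2 * (\<Sum>a\<in>UNIV. A a j * J a i) + 2 * (\<Sum>b\<in>UNIV. A i b * J b j)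
      + (\<Sum>a\<in>UNIV. G a j * Q a i) + (\<Sum>b\<in>UNIV. G i b * Q b j) + 2 * (\<Sum>a\<in>UNIV. \<Sum>b\<in>UNIV. G a b * J a i * J b j)
    = (2 * wl + 4 * l\<^sup>2) * G i j + (GZ i j - GJW i j)
      + (\<Sum>a\<in>UNIV. G a j * (Q a i - R a i - (\<Sum>k\<in>UNIV. J a k * J k i)))
      + (\<Sum>b\<in>UNIV. G i b * (Q b j - R b j - (\<Sum>k\<in>UNIV. J b k * J k j)))"
proof -
  let ?sA1 = "\<Sum>a\<in>UNIV. A a j * J a i" and ?sA2 = "\<Sum>b\<in>UNIV. A i b * J b j"
  let ?g1 = "\<Sum>a\<in>UNIV. G a j * J a i" and ?g2 = "\<Sum>a\<in>UNIV. G i a * J a j"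
  let ?d = "\<Sum>a\<in>UNIV. \<Sum>b\<in>UNIV. G a b * J a i * J b j"
  let ?j1 = "\<Sum>a\<in>UNIV. G a j * (\<Sum>k\<in>UNIV. J a k * J k i)" and ?j2 = "\<Sum>b\<in>UNIV. G i b * (\<Sum>k\<in>UNIV. J b k * J k j)"
  let ?q1 = "\<Sum>a\<in>UNIV. G a j * Q a i" and ?q2 = "\<Sum>b\<in>UNIV. G i b * Q b j"
  let ?r1 = "\<Sum>a\<in>UNIV. G a j * R a i" and ?r2 = "\<Sum>b\<in>UNIV. G i b * R b j"
  \<comment> \<open>Hypothesis \<open>1\<close> at \<open>(a, j)\<close>, contracted with
    \<open>J a i\<close>; \<open>x2\<close> is the contraction of the other index. Together they
    eliminate the mixed terms and the double sum.\<close>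
  have x1: "?sA1 + ?j1 + ?d = 2 * l * ?g1"
  proof -
    have "(\<Sum>a\<in>UNIV. J a i * (A a j + (\<Sum>b\<in>UNIV. G b j * J b a) + (\<Sum>b\<in>UNIV. G a b * J b j))) = 2 * l * ?g1"
      by (simp add: 1 sum_distrib_left mult_ac)
    moreover have "(\<Sum>a\<in>UNIV. J a i * (\<Sum>b\<in>UNIV. G b j * J b a)) = ?j1"
      unfolding sum_distrib_left by (subst sum.swap) (simp add: mult_ac)
    moreover have "(\<Sum>a\<in>UNIV. J a i * (\<Sum>b\<in>UNIV. G a b * J b j)) = ?d"
      by (simp add: sum_distrib_left mult_ac)
    moreover have "(\<Sum>a\<in>UNIV. J a i * A a j) = ?sA1" by (simp add: mult_ac)
    ultimately show ?thesis by (simp add: distrib_left sum.distrib)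
  qed
  have x2: "?sA2 + ?d + ?j2 = 2 * l * ?g2"
  proof -
    have "(\<Sum>b\<in>UNIV. J b j * (A i b + (\<Sum>a\<in>UNIV. G a b * J a i) + (\<Sum>a\<in>UNIV. G i a * J a b))) = 2 * l * ?g2"
      by (simp add: 1 sum_distrib_left mult_ac)
    moreover have "(\<Sum>b\<in>UNIV. J b j * (\<Sum>a\<in>UNIV. G a b * J a i)) = ?d"
      unfolding sum_distrib_left by (subst sum.swap) (simp add: mult_ac)
    moreover have "(\<Sum>b\<in>UNIV. J b j * (\<Sum>a\<in>UNIV. G i a * J a b)) = ?j2"
      unfolding sum_distrib_left by (subst sum.swap) (simp add: mult_ac)
    moreover have "(\<Sum>b\<in>UNIV. J b j * A i b) = ?sA2" by (simp add: mult_ac)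
    ultimately show ?thesis by (simp add: distrib_left sum.distrib)
  qed
  have two: "S i j + GJW i j + ?r1 + ?sA1 + ?r2 + ?sA2 = 2 * wl * G i j + 2 * l * A i j"
    using 2[of i j] by (simp add: sum.distrib mult.commute add.assoc)
  \<comment> \<open>Hypothesis \<open>1\<close> times \<open>2 * l\<close>: the source of the term
    \<open>4 * l\<^sup>2\<close>.\<close>
  have one: "2 * l * A i j + 2 * l * ?g1 + 2 * l * ?g2 = 4 * l\<^sup>2 * G i j"
    using arg_cong[OF 1[of i j], of "\<lambda>y. 2 * l * y"] by (simp add: distrib_left power2_eq_square)
  have "(\<Sum>a\<in>UNIV. G a j * (Q a i - R a i - (\<Sum>k\<in>UNIV. J a k * J k i))) = ?q1 - ?r1 - ?j1"
    "(\<Sum>b\<in>UNIV. G i b * (Q b j - R b j - (\<Sum>k\<in>UNIV. J b k * J k j))) = ?q2 - ?r2 - ?j2"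
    by (simp_all add: right_diff_distrib sum_subtractf)
  moreover have "(2 * wl + 4 * l\<^sup>2) * G i j = 2 * wl * G i j + 4 * l\<^sup>2 * G i j" by (rule distrib_right)
  ultimately show ?thesis using x1 x2 two one by linarith
qed

section \<open>Vanishing integrals of coordinate derivatives\<close>

lemma integral_partial_deriv_compact_support:
  fixes h :: "real^'n::finite \<Rightarrow> real"
  assumes U: "open U" and K: "compact K" "K \<subseteq> U" and h: "smooth_on U h" "\<And>x. x \<in> U \<Longrightarrow> x \<notin> K \<Longrightarrow> h x = 0"
  shows "integrable lborel (\<lambda>x. indicator U x * partial_deriv k h x)"
    and "(LINT x|lborel. indicator U x * partial_deriv k h x) = 0"
proof -
  \<comment> \<open>With the extension by zero the integrals run over the whole space, where
    Lebesgue measure is translation invariant: every difference quotient has integral 0, and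
    dominated convergence passes this on to the derivative.\<close>
  define H where "H = (\<lambda>x. if x \<in> U then h x else 0)"
  have HK: "H x = 0" if "x \<notin> K" for x using that h(2) by (simp add: H_def)
  have oK: "open (- K)" using K compact_imp_closed by blast
  have "smooth_on UNIV H"
  proof (rule smooth_on_local)
    fix x
    have "smooth_on U H" using h(1) by (subst smooth_on_cong[OF U, of H h]) (auto simp: H_def)
    moreover have "smooth_on (- K) H"
      by (subst smooth_on_cong[OF oK, of H "\<lambda>_. 0"]) (auto simp: HK smooth_on_const)
    ultimately show "\<exists>T. open T \<and> x \<in> T \<and> smooth_on T H" using U oK K(2) by blast
  qed
  then have pd: "(H has_derivative frechet_derivative H (at x)) (at x)" and spd: "smooth_on UNIV (partial_deriv k H)" for x
    by (auto intro: smooth_on_has_derivative partial_deriv_smooth)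
  have contH: "continuous_on UNIV H" and contP: "continuous_on UNIV (partial_deriv k H)"
    using smooth_on_continuous_on \<open>smooth_on UNIV H\<close> spd by blast+
  have PK: "partial_deriv k H x = 0" if "x \<notin> K" for x
    using partial_deriv_cong[OF oK, of x H "\<lambda>_. 0" k] that HK
    by (simp add: partial_deriv_def)
  have eq: "indicator U x * partial_deriv k h x = partial_deriv k H x" for x
  proof (cases "x \<in> U")
    case True
    then show ?thesis using partial_deriv_cong[OF U True, of H h k] by (simp add: H_def)
  next
    case False
    then show ?thesis using K PK by auto
  qed
  have int: "integrable lborel f" if "continuous_on UNIV f" "\<And>x. x \<notin> K \<Longrightarrow> f x = 0" for f :: "real^'n \<Rightarrow> real"
  proof -
    have "integrable lborel (\<lambda>x. indicator K x *\<^sub>R f x)"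
      using borel_integrable_compact[OF K(1) continuous_on_subset[OF that(1)]] by simp
    moreover have "(\<lambda>x. indicator K x *\<^sub>R f x) = f" using that(2) by (auto simp: fun_eq_iff indicator_def)
    ultimately show ?thesis by simp
  qed
  show "integrable lborel (\<lambda>x. indicator U x * partial_deriv k h x)"
    unfolding eq by (rule int[OF contP PK])
  let ?e = "axis k (1::real) :: real^'n"
  have "bounded (partial_deriv k H ` K)"
    by (rule compact_imp_bounded[OF compact_continuous_image[OF continuous_on_subset[OF contP] K(1)]]) simp
  then obtain B where B: "B > 0" "\<And>x. \<bar>partial_deriv k H x\<bar> \<le> B"
    using bounded_pos[of "partial_deriv k H ` K"] PK by (metis abs_zero image_eqI less_imp_le real_norm_def)
  have line: "((\<lambda>r. H (x + r *\<^sub>R ?e)) has_real_derivative partial_deriv k H (x + r *\<^sub>R ?e)) (at r)" for x r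
    unfolding partial_deriv_def
    by (rule has_real_derivative_along[where c = "\<lambda>r. x + r *\<^sub>R ?e", OF pd])
      (auto intro!: derivative_eq_intros simp: has_vector_derivative_def)
  have lip: "\<bar>H (x + r *\<^sub>R ?e) - H x\<bar> \<le> B * \<bar>r\<bar>" for x r
  proof -
    have "norm (H (x + r *\<^sub>R ?e) - H (x + 0 *\<^sub>R ?e)) \<le> B * norm (r - 0)"
      by (rule field_differentiable_bound[of UNIV]) (use line B in \<open>auto intro: has_field_derivative_at_within\<close>)
    then show ?thesis by simp
  qed
  obtain b where b: "b > 0" "\<And>x. x \<in> K \<Longrightarrow> norm x \<le> b"
    using compact_imp_bounded[OF K(1)] bounded_pos by blast
  define X where "X = (\<lambda>n. inverse (real (Suc n)))"
  have X: "X \<longlonglongrightarrow> 0" "X n \<noteq> 0" "\<bar>X n\<bar> \<le> 1" for n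
    unfolding X_def using LIMSEQ_inverse_real_of_nat by (auto simp: inverse_le_1_iff)
  define Q where "Q = (\<lambda>n x. (H (x + X n *\<^sub>R ?e) - H x) / X n)"
  have Hint: "integrable lborel H" by (rule int[OF contH HK])
  have shift: "integrable lborel (\<lambda>x. H (x + r *\<^sub>R ?e))" "(LINT x|lborel. H (x + r *\<^sub>R ?e)) = (LINT x|lborel. H x)" for r
  proof -
    have d: "distr lborel borel (\<lambda>x. r *\<^sub>R ?e + x) = lborel" by (rule lborel_distr_plus)
    have m: "(\<lambda>x. r *\<^sub>R ?e + x) \<in> measurable lborel borel" "H \<in> borel_measurable borel"
      using borel_measurable_continuous_onI[OF contH] by auto
    have "integrable (distr lborel borel (\<lambda>x. r *\<^sub>R ?e + x)) H" using Hint by (simp only: d)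
    then show "integrable lborel (\<lambda>x. H (x + r *\<^sub>R ?e))"
      by (subst (asm) integrable_distr_eq[OF m]) (simp add: add.commute)
    have "(LINT x|lborel. H x) = (LINT x|distr lborel borel (\<lambda>x. r *\<^sub>R ?e + x). H x)" by (simp only: d)
    also have "\<dots> = (LINT x|lborel. H (r *\<^sub>R ?e + x))" by (rule integral_distr[OF m])
    finally show "(LINT x|lborel. H (x + r *\<^sub>R ?e)) = (LINT x|lborel. H x)" by (simp add: add.commute)
  qed
  have "(\<lambda>n. LINT x|lborel. Q n x) \<longlonglongrightarrow> (LINT x|lborel. partial_deriv k H x)"
  \<comment> \<open>\<open>K\<close> lies in the ball of radius \<open>b\<close> and the shifts have
    length at most 1, so outside the ball of radius \<open>b + 1\<close> the quotients
    vanish.\<close>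
  proof (rule integral_dominated_convergence[where w = "\<lambda>x. B * indicator (cball 0 (b + 1)) x"])
    show "partial_deriv k H \<in> borel_measurable lborel"
      using borel_measurable_continuous_onI[OF contP] by simp
    show "Q n \<in> borel_measurable lborel" for n
      unfolding Q_def
      by (intro borel_measurable_divide borel_measurable_diff borel_measurable_integrable[OF shift(1)]
          borel_measurable_integrable[OF Hint] borel_measurable_const)
    show "integrable lborel (\<lambda>x. B * indicator (cball 0 (b + 1)) x)"
      by (intro integrable_mult_right integrable_real_indicator) (use emeasure_compact_finite[OF compact_cball] in auto)
    show "AE x in lborel. (\<lambda>n. Q n x) \<longlonglongrightarrow> partial_deriv k H x"
    proof (rule AE_I2)
      fix x
      have "((\<lambda>r. (H (x + r *\<^sub>R ?e) - H (x + 0 *\<^sub>R ?e)) / (r - 0)) \<longlongrightarrow> partial_deriv k H (x + 0 *\<^sub>R ?e)) (at 0)"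
        using line[of x 0] by (simp add: has_field_derivative_iff)
      then show "(\<lambda>n. Q n x) \<longlonglongrightarrow> partial_deriv k H x"
        using X unfolding tendsto_at_iff_sequentially Q_def o_def by simp
    qed
    show "AE x in lborel. norm (Q n x) \<le> B * indicator (cball 0 (b + 1)) x" for n
    proof (rule AE_I2)
      fix x
      show "norm (Q n x) \<le> B * indicator (cball 0 (b + 1)) x"
      proof (cases "x \<in> cball 0 (b + 1)")
        case True
        then show ?thesis using lip[of x "X n"] X(2)[of n] by (simp add: Q_def abs_divide divide_le_eq)
      next
        case False
        have "norm x \<le> norm (x + X n *\<^sub>R ?e) + norm (X n *\<^sub>R ?e)"
          by (metis add_diff_cancel_right' norm_triangle_ineq4)
        then have "norm (x + X n *\<^sub>R ?e) > b" "norm x > b" using False X(3)[of n] by auto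
        then have "x \<notin> K" "x + X n *\<^sub>R ?e \<notin> K" using b(2) by force+
        then show ?thesis using HK B by (simp add: Q_def)
      qed
    qed
  qed
  moreover have "(LINT x|lborel. Q n x) = 0" for n
    unfolding Q_def using shift[of "X n"] Hint by simp
  ultimately have "(\<lambda>n. 0) \<longlonglongrightarrow> (LINT x|lborel. partial_deriv k H x)" by simp
  then have "(LINT x|lborel. partial_deriv k H x) = 0" using LIMSEQ_unique tendsto_const by blast
  then show "(LINT x|lborel. indicator U x * partial_deriv k h x) = 0" unfolding eq .
qed

section \<open>Bookkeeping for the jet of the pulled back metric\<close>

lemma has_jet_cmult: "has_jet a a0 a1 a2 a12 \<Longrightarrow> has_jet (\<lambda>u. c * a u) (c * a0) (c * a1) (c * a2) (c * a12)"
  using has_jet_mult[OF has_jet_const[of c]] by simp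

lemma sum_sum_delta:
  fixes f :: "'n::finite \<Rightarrow> 'n \<Rightarrow> real"
  shows "(\<Sum>a\<in>UNIV. \<Sum>b\<in>UNIV. (if a = i then 1 else 0) * f a b) = (\<Sum>b\<in>UNIV. f i b)"
    and "(\<Sum>a\<in>UNIV. \<Sum>b\<in>UNIV. (if b = i then 1 else 0) * f a b) = (\<Sum>a\<in>UNIV. f a i)"
  by (simp_all only: sum_distrib_left[symmetric] sum_delta_mult)

text \<open>The left hand sides have the exact shape that \<open>has_jet_mult\<close> produces for
  the metric times two Jacobian entries; \<open>d\<close> is the Jacobian of the identity, whose
  Kronecker deltas collapse the double sums.\<close>

lemma pullback_jet_sums:
  fixes G A S J Q :: "'n::finite \<Rightarrow> 'n \<Rightarrow> real" and i j :: 'n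
  defines "d \<equiv> \<lambda>a b. (if a = b then 1 else 0 :: real)"
  shows "(\<Sum>a\<in>UNIV. \<Sum>b\<in>UNIV. G a b * d a j * d b i) = G j i"
    and "(\<Sum>a\<in>UNIV. \<Sum>b\<in>UNIV. (G a b * d a j) * J b i + (G a b * J a j + A a b * d a j) * d b i)
      = A j i + (\<Sum>a\<in>UNIV. G a i * J a j) + (\<Sum>b\<in>UNIV. G j b * J b i)"
    and "(\<Sum>a\<in>UNIV. \<Sum>b\<in>UNIV. (G a b * d a j) * Q b i + (G a b * J a j + A a b * d a j) * J b i
        + (G a b * J a j + A a b * d a j) * J b i + (G a b * Q a j + A a b * J a j + A a b * J a j + S a b * d a j) * d b i)
      = S j i + 2 * (\<Sum>a\<in>UNIV. A a i * J a j) + 2 * (\<Sum>b\<in>UNIV. A j b * J b i)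
        + (\<Sum>a\<in>UNIV. G a i * Q a j) + (\<Sum>b\<in>UNIV. G j b * Q b i) + 2 * (\<Sum>a\<in>UNIV. \<Sum>b\<in>UNIV. G a b * J a j * J b i)"
proof -
  have "(\<Sum>a\<in>UNIV. \<Sum>b\<in>UNIV. G a b * d a j * d b i) = (\<Sum>a\<in>UNIV. \<Sum>b\<in>UNIV. d a j * (d b i * G a b))"
    by (intro sum.cong refl) (simp add: mult_ac)
  then show "(\<Sum>a\<in>UNIV. \<Sum>b\<in>UNIV. G a b * d a j * d b i) = G j i"
    by (simp add: d_def sum_sum_delta sum_delta_mult)
  have "(\<Sum>a\<in>UNIV. \<Sum>b\<in>UNIV. (G a b * d a j) * J b i + (G a b * J a j + A a b * d a j) * d b i)
      = (\<Sum>a\<in>UNIV. \<Sum>b\<in>UNIV. d a j * (d b i * A a b) + d b i * (G a b * J a j) + d a j * (G a b * J b i))"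
    by (intro sum.cong refl) (simp add: algebra_simps)
  then show "(\<Sum>a\<in>UNIV. \<Sum>b\<in>UNIV. (G a b * d a j) * J b i + (G a b * J a j + A a b * d a j) * d b i)
      = A j i + (\<Sum>a\<in>UNIV. G a i * J a j) + (\<Sum>b\<in>UNIV. G j b * J b i)"
    by (simp add: d_def sum.distrib sum_sum_delta sum_delta_mult)
  have "(\<Sum>a\<in>UNIV. \<Sum>b\<in>UNIV. (G a b * d a j) * Q b i + (G a b * J a j + A a b * d a j) * J b i
        + (G a b * J a j + A a b * d a j) * J b i + (G a b * Q a j + A a b * J a j + A a b * J a j + S a b * d a j) * d b i)
      = (\<Sum>a\<in>UNIV. \<Sum>b\<in>UNIV. d a j * (d b i * S a b) + d b i * (2 * (A a b * J a j)) + d a j * (2 * (A a b * J b i))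
        + d b i * (G a b * Q a j) + d a j * (G a b * Q b i) + 2 * (G a b * J a j * J b i))"
    by (intro sum.cong refl) (simp add: algebra_simps)
  then show "(\<Sum>a\<in>UNIV. \<Sum>b\<in>UNIV. (G a b * d a j) * Q b i + (G a b * J a j + A a b * d a j) * J b i
        + (G a b * J a j + A a b * d a j) * J b i + (G a b * Q a j + A a b * J a j + A a b * J a j + S a b * d a j) * d b i)
      = S j i + 2 * (\<Sum>a\<in>UNIV. A a i * J a j) + 2 * (\<Sum>b\<in>UNIV. A j b * J b i)
        + (\<Sum>a\<in>UNIV. G a i * Q a j) + (\<Sum>b\<in>UNIV. G j b * Q b i) + 2 * (\<Sum>a\<in>UNIV. \<Sum>b\<in>UNIV. G a b * J a j * J b i)"
    by (simp add: d_def sum.distrib sum_sum_delta sum_delta_mult sum_distrib_left)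
qed

section \<open>Second variation along a conformal field\<close>

lemma vector_derivative_nth:
  fixes f :: "real \<Rightarrow> real^'n::finite"
  assumes "(f has_vector_derivative v) (at t)"
  shows "((\<lambda>t. f t $ k) has_real_derivative v $ k) (at t)"
proof -
  have "((\<lambda>t. f t $ k) has_derivative (\<lambda>h. (h *\<^sub>R v) $ k)) (at t)"
    using bounded_linear.has_derivative[OF bounded_linear_vec_nth assms[unfolded has_vector_derivative_def]] .
  then show ?thesis
    unfolding has_field_derivative_def
    by (rule has_derivative_eq_rhs) (simp add: fun_eq_iff mult.commute[of "v $ k"])
qed

locale conformal_variation = compact_riemannian_manifold A g
  for A :: "('a::{t2_space,second_countable_topology}, 'm::finite) chart set"
    and g :: "('a, 'm) metric" +
  fixes W :: "'a \<Rightarrow> ('a, 'm) tangent" and l :: "'a \<Rightarrow> real"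
    and \<Psi> :: "real \<times> real \<Rightarrow> 'a \<Rightarrow> 'a" and T :: "(real \<times> real) set"
  assumes conf: "conformal_field A g W l"
    and fam: "smooth_family T \<Psi>" and T0: "0 \<in> T" and \<Psi>0: "\<And>p. \<Psi> 0 p = p"
    and vel1: "has_initial_velocity A (\<lambda>t. \<Psi> (t, 0)) W"
    and vel2: "has_initial_velocity A (\<lambda>s. \<Psi> (0, s)) W"
begin

definition G :: "('a, 'm) chart \<Rightarrow> 'm \<Rightarrow> 'm \<Rightarrow> real^'m \<Rightarrow> real" where
  "G c i j x = g (param c x) c $ i $ j"

definition Ginv :: "('a, 'm) chart \<Rightarrow> 'm \<Rightarrow> 'm \<Rightarrow> real^'m \<Rightarrow> real" where
  "Ginv c i j x = matrix_inv (g (param c x) c) $ i $ j"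

definition w :: "('a, 'm) chart \<Rightarrow> 'm \<Rightarrow> real^'m \<Rightarrow> real" where
  "w c k x = W (param c x) c $ k"

definition R :: "('a, 'm) chart \<Rightarrow> 'm \<Rightarrow> (real \<times> real) \<times> (real^'m) \<Rightarrow> real" where
  "R c k z = family_rep \<Psi> c c z $ k"

definition Dw :: "('a, 'm) chart \<Rightarrow> (real^'m \<Rightarrow> real) \<Rightarrow> real^'m \<Rightarrow> real" where
  "Dw c f x = (\<Sum>k\<in>UNIV. partial_deriv k f x * w c k x)"

text \<open>\<open>Z\<close> is the acceleration of the variation in the chart, and \<open>Y\<close> its excess over the
  acceleration of the flow of \<open>W\<close>; the latter is a vector field, the former is not.\<close>
definition Z :: "('a, 'm) chart \<Rightarrow> 'm \<Rightarrow> real^'m \<Rightarrow> real" where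
  "Z c k x = frechet_derivative (\<lambda>z. frechet_derivative (R c k) (at z) ((0, 1), 0)) (at (0, x)) ((1, 0), 0)"

definition Y :: "('a, 'm) chart \<Rightarrow> 'm \<Rightarrow> real^'m \<Rightarrow> real" where
  "Y c k x = Z c k x - Dw c (w c k) x"

text \<open>The trace of the Lie derivative of the metric along \<open>X\<close>, which is twice the
  divergence of \<open>X\<close>. It is stated for coefficient functions in one chart, so no
  transformation law is presupposed.\<close>

definition tr_lie :: "('a, 'm) chart \<Rightarrow> ('m \<Rightarrow> real^'m \<Rightarrow> real) \<Rightarrow> real^'m \<Rightarrow> real" where
  "tr_lie c X x = (\<Sum>i\<in>UNIV. \<Sum>j\<in>UNIV. Ginv c i j x * (\<Sum>k\<in>UNIV. partial_deriv k (G c j i) x * X k x))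
     + 2 * (\<Sum>k\<in>UNIV. partial_deriv k (X k) x)"

lemma vf: "vector_field A W" and smooth_l: "smooth_fun A l"
  using conf by (auto simp: conformal_field_def)

lemma smooth_G: "c \<in> A \<Longrightarrow> smooth_on (chart_img c) (G c i j)"
  unfolding G_def[abs_def] by (rule metric_smooth_nth)

lemma smooth_w: "c \<in> A \<Longrightarrow> smooth_on (chart_img c) (w c k)"
  unfolding w_def[abs_def] by (intro smooth_on_vec_nth vector_field_smooth[OF vf]) auto

lemma smooth_lc: "c \<in> A \<Longrightarrow> smooth_on (chart_img c) (\<lambda>x. l (param c x))"
  by (rule smooth_funD[OF smooth_l])

lemma open_D: "c \<in> A \<Longrightarrow> open (family_dom T \<Psi> c c)"
  by (rule open_family_dom[OF fam])

lemma D_0: "c \<in> A \<Longrightarrow> x \<in> chart_img c \<Longrightarrow> (0, x) \<in> family_dom T \<Psi> c c"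
  using T0 by (simp add: family_dom_def \<Psi>0)

lemma smooth_R: "c \<in> A \<Longrightarrow> smooth_on (family_dom T \<Psi> c c) (R c k)"
  unfolding R_def[abs_def] by (intro smooth_on_vec_nth smooth_familyD(3)[OF fam] open_D)

lemma R_0: "c \<in> A \<Longrightarrow> x \<in> chart_img c \<Longrightarrow> R c k (0, x) = x $ k"
  by (simp add: R_def family_rep_def \<Psi>0)

lemma R_velocity:
  assumes c: "c \<in> A" "x \<in> chart_img c"
  shows "frechet_derivative (R c k) (at (0, x)) ((1, 0), 0) = w c k x"
    and "frechet_derivative (R c k) (at (0, x)) ((0, 1), 0) = w c k x"
proof -
  let ?D = "frechet_derivative (R c k) (at (0, x))"
  have d: "(R c k has_derivative ?D) (at (0, x))"
    by (rule smooth_on_has_derivative[OF smooth_R D_0]) (use c in auto)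
  have lin: "linear ?D" by (rule has_derivative_linear[OF d])
  have key: "?D (v, 0) = w c k x"
    if v: "((\<lambda>t. coord c (\<Psi> (t *\<^sub>R v) (param c x))) has_vector_derivative W (param c x) c) (at 0)" for v
  proof -
    have "((\<lambda>t. (t *\<^sub>R v, x)) has_vector_derivative (v, 0)) (at 0)"
      by (auto intro!: derivative_eq_intros simp: has_vector_derivative_def)
    from has_real_derivative_along[where c = "\<lambda>t. (t *\<^sub>R v, x)", OF _ this, of "R c k" ?D]
    have "((\<lambda>t. R c k (t *\<^sub>R v, x)) has_real_derivative ?D (v, 0)) (at 0)"
      using d by (simp add: zero_prod_def)
    moreover have "((\<lambda>t. R c k (t *\<^sub>R v, x)) has_real_derivative w c k x) (at 0)"
      using vector_derivative_nth[OF v, of k] by (simp add: R_def family_rep_def w_def)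
    ultimately show ?thesis by (rule DERIV_unique)
  qed
  show "?D ((1, 0), 0) = w c k x"
    by (rule key) (use vel1 c \<Psi>0 in \<open>auto simp: has_initial_velocity_def zero_prod_def\<close>)
  show "?D ((0, 1), 0) = w c k x"
    by (rule key) (use vel2 c \<Psi>0 in \<open>auto simp: has_initial_velocity_def zero_prod_def\<close>)
qed

lemma smooth_Z:
  assumes c: "c \<in> A" shows "smooth_on (chart_img c) (Z c k)"
  unfolding Z_def[abs_def]
proof (rule smooth_on_compose[OF _ open_D[OF c], where g = "\<lambda>x. (0, x)"])
  show "smooth_on (family_dom T \<Psi> c c)
     (\<lambda>z. frechet_derivative (\<lambda>z. frechet_derivative (R c k) (at z) ((0, 1), 0)) (at z) ((1, 0), 0))"
    by (intro smooth_on_frechet_derivative smooth_R c)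
  show "smooth_on (chart_img c) (\<lambda>x. (0 :: real \<times> real, x))"
    using c smooth_on_Pair[of "chart_img c" "\<lambda>_. 0" "\<lambda>x. x"] by (simp add: smooth_on_const smooth_on_ident)
  show "(\<lambda>x. (0, x)) ` chart_img c \<subseteq> family_dom T \<Psi> c c"
    by (rule image_subsetI) (rule D_0[OF c])
qed (use c in auto)

lemma smooth_Dw: "c \<in> A \<Longrightarrow> smooth_on (chart_img c) f \<Longrightarrow> smooth_on (chart_img c) (Dw c f)"
  unfolding Dw_def[abs_def] by (intro smooth_on_sum smooth_on_mult partial_deriv_smooth smooth_w) auto

lemma smooth_Y: "c \<in> A \<Longrightarrow> smooth_on (chart_img c) (Y c k)"
  unfolding Y_def[abs_def] by (intro smooth_on_diff smooth_Z smooth_Dw smooth_w) auto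

lemma Dw_mult:
  assumes "smooth_on (chart_img c) f" "smooth_on (chart_img c) h" "x \<in> chart_img c"
  shows "Dw c (\<lambda>x. f x * h x) x = Dw c f x * h x + f x * Dw c h x"
  by (simp add: Dw_def partial_deriv_mult[OF assms] distrib_left distrib_right sum.distrib sum_distrib_left
      sum_distrib_right mult_ac)

lemma Dw_add:
  assumes "smooth_on (chart_img c) f" "smooth_on (chart_img c) h" "x \<in> chart_img c"
  shows "Dw c (\<lambda>x. f x + h x) x = Dw c f x + Dw c h x"
  by (simp add: Dw_def partial_deriv_add[OF assms] distrib_right sum.distrib)

lemma Dw_sum:
  assumes "\<And>i. smooth_on (chart_img c) (f i)" "x \<in> chart_img c"
  shows "Dw c (\<lambda>x. \<Sum>i\<in>(UNIV::'m set). f i x) x = (\<Sum>i\<in>UNIV. Dw c (f i) x)"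
proof -
  have "Dw c (\<lambda>x. \<Sum>i\<in>UNIV. f i x) x = (\<Sum>k\<in>UNIV. \<Sum>i\<in>UNIV. partial_deriv k (f i) x * w c k x)"
    unfolding Dw_def by (simp add: partial_deriv_sum[where S = "chart_img c", OF assms] sum_distrib_right)
  also have "\<dots> = (\<Sum>i\<in>UNIV. Dw c (f i) x)" unfolding Dw_def by (rule sum.swap)
  finally show ?thesis .
qed

lemma conformal_eq:
  assumes c: "c \<in> A" "x \<in> chart_img c"
  shows "Dw c (G c i j) x + (\<Sum>a\<in>UNIV. G c a j x * partial_deriv i (w c a) x)
    + (\<Sum>a\<in>UNIV. G c i a x * partial_deriv j (w c a) x) = 2 * l (param c x) * G c i j x"
proof -
  have "lie_derivative_metric g W (param c x) c = (2 * l (param c x)) *\<^sub>R g (param c x) c"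
    using conf c by (auto simp: conformal_field_def)
  from arg_cong[OF this, of "\<lambda>M. M $ i $ j"] show ?thesis
    using c by (simp add: lie_derivative_metric_def G_def[abs_def] w_def[abs_def] Dw_def sum.distrib mult_ac)
qed

text \<open>The coordinate form of the conformal equation differentiated along \<open>W\<close>: the
  second hypothesis of \<open>conformal_hessian_algebra\<close>.\<close>

lemma conformal_eq_derivative:
  assumes c: "c \<in> A" "x \<in> chart_img c"
  shows "(\<Sum>k\<in>UNIV. Dw c (partial_deriv k (G c i j)) x * w c k x)
    + (\<Sum>k\<in>UNIV. partial_deriv k (G c i j) x * Dw c (w c k) x)
    + (\<Sum>a\<in>UNIV. Dw c (partial_deriv i (w c a)) x * G c a j x + partial_deriv i (w c a) x * Dw c (G c a j) x)
    + (\<Sum>a\<in>UNIV. G c i a x * Dw c (partial_deriv j (w c a)) x + Dw c (G c i a) x * partial_deriv j (w c a) x)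
    = 2 * Dw c (\<lambda>x. l (param c x)) x * G c i j x + 2 * l (param c x) * Dw c (G c i j) x"
proof -
  note sm = smooth_on_mult smooth_on_add smooth_on_sum smooth_G[OF c(1)] smooth_w[OF c(1)]
    partial_deriv_smooth smooth_lc[OF c(1)] smooth_on_const smooth_Dw[OF c(1)] open_chart_img[OF c(1)]
  let ?E1 = "\<lambda>x. \<Sum>k\<in>UNIV. partial_deriv k (G c i j) x * w c k x"
  let ?E2 = "\<lambda>x. \<Sum>a\<in>UNIV. G c a j x * partial_deriv i (w c a) x"
  let ?E3 = "\<lambda>x. \<Sum>a\<in>UNIV. G c i a x * partial_deriv j (w c a) x"
  have "Dw c (\<lambda>x. ?E1 x + ?E2 x + ?E3 x) x = Dw c (\<lambda>x. 2 * l (param c x) * G c i j x) x"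
    unfolding Dw_def[of c "\<lambda>x. ?E1 x + ?E2 x + ?E3 x"] Dw_def[of c "\<lambda>x. 2 * l (param c x) * G c i j x"]
  proof (intro sum.cong refl)
    fix k
    have "partial_deriv k (\<lambda>x. ?E1 x + ?E2 x + ?E3 x) x = partial_deriv k (\<lambda>x. 2 * l (param c x) * G c i j x) x"
      by (rule partial_deriv_cong[OF open_chart_img[OF c(1)] c(2)])
        (use conformal_eq[OF c(1)] in \<open>simp add: Dw_def\<close>)
    then show "partial_deriv k (\<lambda>x. ?E1 x + ?E2 x + ?E3 x) x * w c k x
        = partial_deriv k (\<lambda>x. 2 * l (param c x) * G c i j x) x * w c k x" by (rule arg_cong)
  qed
  moreover have "Dw c (\<lambda>x. ?E1 x + ?E2 x + ?E3 x) x = Dw c ?E1 x + Dw c ?E2 x + Dw c ?E3 x"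
  proof -
    have s: "smooth_on (chart_img c) ?E1" "smooth_on (chart_img c) ?E2" "smooth_on (chart_img c) ?E3"
      by (intro sm)+
    show ?thesis
      unfolding Dw_add[of c "\<lambda>x. ?E1 x + ?E2 x" ?E3 x, OF smooth_on_add[OF open_chart_img[OF c(1)] s(1,2)] s(3) c(2)]
        Dw_add[of c ?E1 ?E2 x, OF s(1,2) c(2)] ..
  qed
  moreover have "Dw c ?E1 x = (\<Sum>k\<in>UNIV. Dw c (partial_deriv k (G c i j)) x * w c k x)
      + (\<Sum>k\<in>UNIV. partial_deriv k (G c i j) x * Dw c (w c k) x)"
    by (subst Dw_sum[OF _ c(2)], intro sm) (subst Dw_mult[OF _ _ c(2)], (intro sm)+, simp add: sum.distrib)
  moreover have "Dw c ?E2 x = (\<Sum>a\<in>UNIV. Dw c (partial_deriv i (w c a)) x * G c a j x + partial_deriv i (w c a) x * Dw c (G c a j) x)"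
    by (subst Dw_sum[OF _ c(2)], intro sm) (subst Dw_mult[OF _ _ c(2)], (intro sm)+, simp add: sum.distrib mult_ac add.commute)
  moreover have "Dw c ?E3 x = (\<Sum>a\<in>UNIV. G c i a x * Dw c (partial_deriv j (w c a)) x + Dw c (G c i a) x * partial_deriv j (w c a) x)"
    by (subst Dw_sum[OF _ c(2)], intro sm) (subst Dw_mult[OF _ _ c(2)], (intro sm)+, simp add: sum.distrib mult_ac add.commute)
  moreover have "Dw c (\<lambda>x. 2 * l (param c x) * G c i j x) x = 2 * Dw c (\<lambda>x. l (param c x)) x * G c i j x + 2 * l (param c x) * Dw c (G c i j) x"
  proof -
    have "Dw c (\<lambda>x. 2 * l (param c x)) x = 2 * Dw c (\<lambda>x. l (param c x)) x"
      by (subst Dw_mult[OF _ _ c(2)], (intro sm)+) (simp add: Dw_def partial_deriv_def)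
    then show ?thesis
      by (subst Dw_mult[OF _ _ c(2)], (intro sm)+) simp
  qed
  ultimately show ?thesis by presburger
qed

lemma jet_position:
  assumes c: "c \<in> A" "x \<in> chart_img c"
  shows "has_jet (\<lambda>u. R c k (u, x)) (x $ k) (w c k x) (w c k x) (Z c k x)"
  using has_jet_slice[OF open_D[OF c(1)] D_0[OF c] smooth_R[OF c(1), of k]]
  by (simp add: R_0[OF c] R_velocity[OF c] Z_def)

lemma curve_dom:
  assumes c: "c \<in> A" "x \<in> chart_img c"
  defines "S \<equiv> (\<lambda>u. (u, x)) -` family_dom T \<Psi> c c"
  shows "open S" "0 \<in> S" "smooth_on S (\<lambda>u. family_rep \<Psi> c c (u, x))"
    "(\<lambda>u. family_rep \<Psi> c c (u, x)) ` S \<subseteq> chart_img c"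
proof -
  show S: "open S"
    unfolding S_def by (rule open_vimage[OF open_D[OF c(1)]]) (intro continuous_intros)
  show "0 \<in> S" using D_0[OF c] by (simp add: S_def)
  show "smooth_on S (\<lambda>u. family_rep \<Psi> c c (u, x))"
    by (rule smooth_on_compose[OF S open_D[OF c(1)] smooth_familyD(3)[OF fam c(1) c(1)]
          smooth_on_Pair[OF S smooth_on_ident smooth_on_const]]) (auto simp: S_def)
  show "(\<lambda>u. family_rep \<Psi> c c (u, x)) ` S \<subseteq> chart_img c"
    using family_rep_in[OF c(1) c(1), of _ T \<Psi>] by (auto simp: S_def)
qed

text \<open>The first sum of the mixed term is the coordinate Hessian of \<open>f\<close> at
  \<open>(W, W)\<close>; \<open>W\<close> is not differentiated in it. This is where a variation
  with acceleration \<open>Z\<close> differs from the iterated derivative along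
  \<open>W\<close>.\<close>

lemma jet_function:
  assumes c: "c \<in> A" "x \<in> chart_img c" and f: "smooth_on (chart_img c) f"
  shows "has_jet (\<lambda>u. f (family_rep \<Psi> c c (u, x))) (f x) (Dw c f x) (Dw c f x)
    ((\<Sum>k\<in>UNIV. Dw c (partial_deriv k f) x * w c k x) + (\<Sum>k\<in>UNIV. partial_deriv k f x * Z c k x))"
proof -
  have jet: "has_jet (\<lambda>u. family_rep \<Psi> c c (u, x) $ k) (x $ k) ((\<chi> k. w c k x) $ k) ((\<chi> k. w c k x) $ k) ((\<chi> k. Z c k x) $ k)" for k
    using jet_position[OF c, of k] by (simp add: R_def)
  show ?thesis
    using has_jet_compose[OF open_chart_img[OF c(1)] f curve_dom[OF c] jet]
    by (simp add: Dw_def sum.distrib add.commute)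
qed

text \<open>Parameter derivatives commute with spatial ones, so the jet of the Jacobian consists of
  the spatial derivatives of position, velocity and acceleration.\<close>

lemma jet_jacobian:
  assumes c: "c \<in> A" "x \<in> chart_img c"
  shows "has_jet (\<lambda>u. family_jac \<Psi> c c (u, x) $ a $ i) (if a = i then 1 else 0)
    (partial_deriv i (w c a) x) (partial_deriv i (w c a) x) (partial_deriv i (Z c a) x)"
proof -
  let ?D = "family_dom T \<Psi> c c"
  let ?F = "\<lambda>z. frechet_derivative (R c a) (at z) (0, axis i 1)"
  note oD = open_D[OF c(1)] and sR = smooth_R[OF c(1), of a]
  have sF: "smooth_on ?D ?F" by (rule smooth_on_frechet_derivative[OF sR])
  have img: "open (chart_img c)" using c by simp
  have 0: "?F (0, x) = (if a = i then 1 else 0)"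
  proof -
    have "?F (0, x) = partial_deriv i (\<lambda>y. R c a (0, y)) x"
      by (rule partial_deriv_slice[OF sR D_0[OF c]])
    also have "\<dots> = partial_deriv i (\<lambda>y. y $ a) x"
      by (rule partial_deriv_cong[OF img c(2)]) (simp add: R_0 c)
    also have "\<dots> = axis i 1 $ a"
      by (rule partial_deriv_has_derivative[OF bounded_linear_imp_has_derivative[OF bounded_linear_vec_nth]])
    finally show ?thesis by (simp add: axis_def eq_commute)
  qed
  have comm: "frechet_derivative ?F (at z) v = frechet_derivative (\<lambda>z. frechet_derivative (R c a) (at z) v) (at z) (0, axis i 1)"
    if "z \<in> ?D" for z v
    by (rule symmetric_second_derivative[OF oD that sR])
  have first: "frechet_derivative ?F (at (0, x)) v = partial_deriv i (w c a) x"
    if v: "\<And>y. y \<in> chart_img c \<Longrightarrow> frechet_derivative (R c a) (at (0, y)) v = w c a y" for v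
  proof -
    have "frechet_derivative ?F (at (0, x)) v = partial_deriv i (\<lambda>y. frechet_derivative (R c a) (at (0, y)) v) x"
      unfolding comm[OF D_0[OF c]] by (rule partial_deriv_slice[OF smooth_on_frechet_derivative[OF sR] D_0[OF c]])
    also have "\<dots> = partial_deriv i (w c a) x"
      by (rule partial_deriv_cong[OF img c(2) v])
    finally show ?thesis .
  qed
  have second: "frechet_derivative (\<lambda>z. frechet_derivative ?F (at z) ((0, 1), 0)) (at (0, x)) ((1, 0), 0) = partial_deriv i (Z c a) x"
  proof -
    let ?H = "\<lambda>z. frechet_derivative (R c a) (at z) ((0, 1), 0)"
    have "frechet_derivative (\<lambda>z. frechet_derivative ?F (at z) ((0, 1), 0)) (at (0, x))
        = frechet_derivative (\<lambda>z. frechet_derivative ?H (at z) (0, axis i 1)) (at (0, x))"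
      by (rule frechet_derivative_cong[OF oD D_0[OF c] comm])
    then have "frechet_derivative (\<lambda>z. frechet_derivative ?F (at z) ((0, 1), 0)) (at (0, x)) ((1, 0), 0)
        = frechet_derivative (\<lambda>z. frechet_derivative ?H (at z) ((1, 0), 0)) (at (0, x)) (0, axis i 1)"
      using symmetric_second_derivative[OF oD D_0[OF c] smooth_on_frechet_derivative[OF sR, of "((0, 1), 0)"], of "(0, axis i 1)" "((1, 0), 0)"]
      by simp
    also have "\<dots> = partial_deriv i (\<lambda>y. frechet_derivative ?H (at (0, y)) ((1, 0), 0)) x"
      by (rule partial_deriv_slice[OF smooth_on_frechet_derivative[OF smooth_on_frechet_derivative[OF sR]] D_0[OF c]])
    also have "\<dots> = partial_deriv i (Z c a) x"
      unfolding Z_def[abs_def] ..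
    finally show ?thesis .
  qed
  have F: "family_jac \<Psi> c c z $ a $ i = ?F z" for z
    by (simp add: family_jac_def R_def[abs_def])
  show ?thesis
    unfolding F using has_jet_slice[OF oD D_0[OF c] sF] R_velocity[OF c(1)]
    by (simp add: 0 first second)
qed

lemma Y_derivative:
  assumes c: "c \<in> A" "x \<in> chart_img c"
  shows "partial_deriv i (Y c a) x = partial_deriv i (Z c a) x - Dw c (partial_deriv i (w c a)) x
    - (\<Sum>k\<in>UNIV. partial_deriv k (w c a) x * partial_deriv i (w c k) x)"
proof -
  note img = open_chart_img[OF c(1)]
  note sw = smooth_w[OF c(1)]
  have "partial_deriv i (Dw c (w c a)) x = (\<Sum>k\<in>UNIV. partial_deriv i (\<lambda>x. partial_deriv k (w c a) x * w c k x) x)"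
    unfolding Dw_def[abs_def]
    by (rule partial_deriv_sum[OF _ c(2)]) (intro smooth_on_mult img partial_deriv_smooth sw)
  also have "\<dots> = (\<Sum>k\<in>UNIV. partial_deriv k (partial_deriv i (w c a)) x * w c k x + partial_deriv k (w c a) x * partial_deriv i (w c k) x)"
    by (intro sum.cong refl)
      (simp add: partial_deriv_mult[OF partial_deriv_smooth[OF sw] sw c(2)] partial_deriv_commute[OF img c(2) sw, of i])
  also have "\<dots> = Dw c (partial_deriv i (w c a)) x + (\<Sum>k\<in>UNIV. partial_deriv k (w c a) x * partial_deriv i (w c k) x)"
    by (simp add: Dw_def sum.distrib)
  finally show ?thesis
    unfolding Y_def[abs_def]
    by (simp add: partial_deriv_diff[OF smooth_Z[OF c(1)] smooth_Dw[OF c(1) sw] c(2)])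
qed

text \<open>Component \<open>(j, i)\<close> of the metric pulled back by \<open>\<Psi> u\<close>.
  The index order is that of \<open>energy_expand\<close>, so contraction with
  \<open>Ginv c i j\<close> gives the squared norm of the differential.\<close>

definition pullback :: "('a, 'm) chart \<Rightarrow> 'm \<Rightarrow> 'm \<Rightarrow> real^'m \<Rightarrow> real \<times> real \<Rightarrow> real" where
  "pullback c i j x u = (\<Sum>a\<in>UNIV. \<Sum>b\<in>UNIV. G c a b (family_rep \<Psi> c c (u, x))
     * family_jac \<Psi> c c (u, x) $ a $ j * family_jac \<Psi> c c (u, x) $ b $ i)"

text \<open>For the flow of \<open>W\<close> the pulled back metric would have first derivative 2
  \<lambda> g and second derivative (2 W(\<lambda>) + 4 \<lambda>^2) g. The excess acceleration
  \<open>Y\<close> contributes its Lie derivative of the metric and nothing else.\<close>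

lemma jet_pullback:
  assumes c: "c \<in> A" "x \<in> chart_img c"
  shows "has_jet (pullback c i j x) (G c j i x) (2 * l (param c x) * G c j i x) (2 * l (param c x) * G c j i x)
    ((2 * Dw c (\<lambda>x. l (param c x)) x + 4 * (l (param c x))\<^sup>2) * G c j i x
      + (\<Sum>k\<in>UNIV. partial_deriv k (G c j i) x * Y c k x)
      + (\<Sum>a\<in>UNIV. G c a i x * partial_deriv j (Y c a) x) + (\<Sum>b\<in>UNIV. G c j b x * partial_deriv i (Y c b) x))"
proof -
  let ?G = "\<lambda>a b. G c a b x" and ?A = "\<lambda>a b. Dw c (G c a b) x" and ?J = "\<lambda>a i. partial_deriv i (w c a) x"
    and ?Q = "\<lambda>a i. partial_deriv i (Z c a) x" and ?d = "\<lambda>a b. (if a = b then 1 else 0 :: real)"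
    and ?R = "\<lambda>a i. Dw c (partial_deriv i (w c a)) x"
    and ?B = "\<lambda>a b. \<Sum>k\<in>UNIV. Dw c (partial_deriv k (G c a b)) x * w c k x"
    and ?GZ = "\<lambda>a b. \<Sum>k\<in>UNIV. partial_deriv k (G c a b) x * Z c k x"
    and ?GJW = "\<lambda>a b. \<Sum>k\<in>UNIV. partial_deriv k (G c a b) x * Dw c (w c k) x"
    and ?l = "l (param c x)" and ?wl = "Dw c (\<lambda>x. l (param c x)) x"
  let ?S = "\<lambda>a b. ?B a b + ?GZ a b"
  note jG = jet_function[OF c smooth_G[OF c(1)]] and jJ = jet_jacobian[OF c]
  have "has_jet (pullback c i j x) (\<Sum>a\<in>UNIV. \<Sum>b\<in>UNIV. ?G a b * ?d a j * ?d b i)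
     (\<Sum>a\<in>UNIV. \<Sum>b\<in>UNIV. (?G a b * ?d a j) * ?J b i + (?G a b * ?J a j + ?A a b * ?d a j) * ?d b i)
     (\<Sum>a\<in>UNIV. \<Sum>b\<in>UNIV. (?G a b * ?d a j) * ?J b i + (?G a b * ?J a j + ?A a b * ?d a j) * ?d b i)
     (\<Sum>a\<in>UNIV. \<Sum>b\<in>UNIV. (?G a b * ?d a j) * ?Q b i + (?G a b * ?J a j + ?A a b * ?d a j) * ?J b i
        + (?G a b * ?J a j + ?A a b * ?d a j) * ?J b i + (?G a b * ?Q a j + ?A a b * ?J a j + ?A a b * ?J a j + ?S a b * ?d a j) * ?d b i)"
    unfolding pullback_def[abs_def] by (intro has_jet_sum has_jet_mult jG jJ)
  then have raw: "has_jet (pullback c i j x) (?G j i)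
      (?A j i + (\<Sum>a\<in>UNIV. ?G a i * ?J a j) + (\<Sum>b\<in>UNIV. ?G j b * ?J b i))
      (?A j i + (\<Sum>a\<in>UNIV. ?G a i * ?J a j) + (\<Sum>b\<in>UNIV. ?G j b * ?J b i))
      (?S j i + 2 * (\<Sum>a\<in>UNIV. ?A a i * ?J a j) + 2 * (\<Sum>b\<in>UNIV. ?A j b * ?J b i)
        + (\<Sum>a\<in>UNIV. ?G a i * ?Q a j) + (\<Sum>b\<in>UNIV. ?G j b * ?Q b i) + 2 * (\<Sum>a\<in>UNIV. \<Sum>b\<in>UNIV. ?G a b * ?J a j * ?J b i))"
    unfolding pullback_jet_sums(1) pullback_jet_sums(2)[where G = ?G and j = j and J = ?J and i = i and A = ?A]
      pullback_jet_sums(3)[where G = ?G and j = j and J = ?J and i = i and A = ?A and Q = ?Q and S = ?S] .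
  have one: "?A j i + (\<Sum>a\<in>UNIV. ?G a i * ?J a j) + (\<Sum>b\<in>UNIV. ?G j b * ?J b i) = 2 * ?l * ?G j i" for i j
    by (rule conformal_eq[OF c])
  have two: "?S j i + 2 * (\<Sum>a\<in>UNIV. ?A a i * ?J a j) + 2 * (\<Sum>b\<in>UNIV. ?A j b * ?J b i)
        + (\<Sum>a\<in>UNIV. ?G a i * ?Q a j) + (\<Sum>b\<in>UNIV. ?G j b * ?Q b i) + 2 * (\<Sum>a\<in>UNIV. \<Sum>b\<in>UNIV. ?G a b * ?J a j * ?J b i)
      = (2 * ?wl + 4 * ?l\<^sup>2) * ?G j i + (?GZ j i - ?GJW j i)
        + (\<Sum>a\<in>UNIV. ?G a i * (?Q a j - ?R a j - (\<Sum>k\<in>UNIV. ?J a k * ?J k j)))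
        + (\<Sum>b\<in>UNIV. ?G j b * (?Q b i - ?R b i - (\<Sum>k\<in>UNIV. ?J b k * ?J k i)))"
    by (rule conformal_hessian_algebra[where G = ?G and A = ?A and S = ?B and J = ?J and Q = ?Q and R = ?R
          and GZ = ?GZ and GJW = ?GJW and l = ?l and wl = ?wl and i = j and j = i])
      (rule one, rule conformal_eq_derivative[OF c])
  have three: "?GZ j i - ?GJW j i = (\<Sum>k\<in>UNIV. partial_deriv k (G c j i) x * Y c k x)"
    by (simp add: Y_def right_diff_distrib sum_subtractf)
  show ?thesis
    using raw unfolding one two three Y_derivative[OF c, symmetric] .
qed

end

context riemannian_manifold
begin

lemma smooth_param_compose:
  assumes h: "smooth_fun A h" and \<Psi>: "smooth_family T \<Psi>"
  shows "smooth_param T (\<lambda>u p. h (\<Psi> u p))"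
  unfolding smooth_param_def
proof (intro conjI ballI smooth_familyD(1)[OF \<Psi>])
  fix c assume c: "c \<in> A"
  show "smooth_on (T \<times> chart_img c) (\<lambda>z. h (\<Psi> (fst z) (param c (snd z))))"
  proof (rule smooth_on_local)
    fix z assume z: "z \<in> T \<times> chart_img c"
    define d where "d = chart_at A (\<Psi> (fst z) (param c (snd z)))"
    have d: "d \<in> A" "\<Psi> (fst z) (param c (snd z)) \<in> chart_dom d"
      using chart_at by (auto simp: d_def)
    let ?D = "family_dom T \<Psi> c d"
    have o: "open ?D" by (rule open_family_dom[OF \<Psi> c d(1)])
    have "smooth_on ?D (\<lambda>z. h (param d (family_rep \<Psi> c d z)))"
      by (rule smooth_on_compose[OF o open_chart_img[OF d(1)] smooth_funD[OF h d(1)] smooth_familyD(3)[OF \<Psi> c d(1)]])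
        (use family_rep_in[OF c d(1)] in blast)
    then have "smooth_on ?D (\<lambda>z. h (\<Psi> (fst z) (param c (snd z))))"
      by (subst smooth_on_cong[OF o, of _ "\<lambda>z. h (param d (family_rep \<Psi> c d z))"])
        (simp_all add: family_rep_in[OF c d(1)])
    moreover have "z \<in> ?D" using z d by (auto simp: family_dom_def)
    ultimately show "\<exists>S. open S \<and> z \<in> S \<and> smooth_on S (\<lambda>z. h (\<Psi> (fst z) (param c (snd z))))"
      using o by blast
  qed
qed

lemma smooth_param_at:
  assumes F: "smooth_param T F" and u: "u \<in> T"
  shows "smooth_fun A (F u)"
  unfolding smooth_fun_def o_def
proof
  fix c assume c: "c \<in> A"
  have "smooth_on (chart_img c) (\<lambda>x. (u, x))"
    using smooth_on_Pair[OF open_chart_img[OF c] smooth_on_const smooth_on_ident, of u] by simp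
  moreover have "smooth_on (T \<times> chart_img c) (\<lambda>z. F (fst z) (param c (snd z)))"
    using F c by (simp add: smooth_param_def)
  ultimately show "smooth_on (chart_img c) (\<lambda>x. F u (param c x))"
    using smooth_on_compose[OF open_chart_img[OF c] open_param_dom[OF F c], of "\<lambda>z. F (fst z) (param c (snd z))" "\<lambda>x. (u, x)"] u
    by auto
qed

lemma param_deriv_cong:
  assumes "open S" "u \<in> S" "\<And>u. u \<in> S \<Longrightarrow> F u p = H u p"
  shows "param_deriv v F u p = param_deriv v H u p"
  unfolding param_deriv_def using frechet_derivative_cong[OF assms(1,2), of "\<lambda>u. F u p" "\<lambda>u. H u p"] assms(3) by simp

lemma param_deriv_const [simp]: "param_deriv v (\<lambda>u p. c) u p = 0"
  by (simp add: param_deriv_def)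

lemma param_deriv_sum:
  assumes "\<And>i. i \<in> I \<Longrightarrow> smooth_param T (F i)" "u \<in> T"
  shows "param_deriv v (\<lambda>u p. \<Sum>i\<in>I. F i u p) u p = (\<Sum>i\<in>I. param_deriv v (F i) u p)"
proof -
  have "((\<lambda>u. \<Sum>i\<in>I. F i u p) has_derivative (\<lambda>v. \<Sum>i\<in>I. param_deriv v (F i) u p)) (at u)"
    by (rule has_derivative_sum) (rule smooth_param_has_derivative[OF assms])
  then show ?thesis by (simp add: param_deriv_def[of _ "\<lambda>u p. \<Sum>i\<in>I. F i u p"] frechet_derivative_eqI)
qed

end

section \<open>Traces, divergences and the jet of the squared norm\<close>

context conformal_variation
begin

abbreviation N :: "real \<times> real \<Rightarrow> 'a \<Rightarrow> real" where
  "N u p \<equiv> norm_sq_differential A g A g (\<Psi> u) p"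

lemma metric_inverse:
  assumes c: "c \<in> A" "x \<in> chart_img c"
  shows "(\<Sum>j\<in>UNIV. Ginv c i j x * G c j b x) = (if i = b then 1 else 0)"
    and "(\<Sum>i\<in>UNIV. G c a i x * Ginv c i j x) = (if a = j then 1 else 0)"
proof -
  have nz: "det (g (param c x) c) \<noteq> 0"
    using det_metric_pos[OF c(1) param_in[OF c]] by simp
  show "(\<Sum>j\<in>UNIV. Ginv c i j x * G c j b x) = (if i = b then 1 else 0)"
    using arg_cong[OF matrix_inv_left[OF nz], of "\<lambda>M. M $ i $ b"]
    by (simp add: matrix_matrix_mult_def mat_def Ginv_def G_def)
  show "(\<Sum>i\<in>UNIV. G c a i x * Ginv c i j x) = (if a = j then 1 else 0)"
    using arg_cong[OF matrix_inv_right[OF nz], of "\<lambda>M. M $ a $ j"]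
    by (simp add: matrix_matrix_mult_def mat_def Ginv_def G_def)
qed

lemma trace_metric:
  assumes c: "c \<in> A" "x \<in> chart_img c"
  shows "(\<Sum>i\<in>UNIV. \<Sum>j\<in>UNIV. Ginv c i j x * (r * G c j i x)) = r * real CARD('m)"
proof -
  have "(\<Sum>i\<in>UNIV. \<Sum>j\<in>UNIV. Ginv c i j x * (r * G c j i x)) = r * (\<Sum>i\<in>(UNIV::'m set). \<Sum>j\<in>UNIV. Ginv c i j x * G c j i x)"
    by (simp add: sum_distrib_left mult_ac)
  then show ?thesis by (simp add: metric_inverse[OF c])
qed

lemma trace_lie_derivative:
  assumes c: "c \<in> A" "x \<in> chart_img c"
  shows "(\<Sum>i\<in>UNIV. \<Sum>j\<in>UNIV. Ginv c i j x * ((\<Sum>k\<in>UNIV. partial_deriv k (G c j i) x * X k x)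
      + (\<Sum>a\<in>UNIV. G c a i x * partial_deriv j (X a) x) + (\<Sum>b\<in>UNIV. G c j b x * partial_deriv i (X b) x)))
    = tr_lie c X x"
proof -
  have "(\<Sum>i\<in>UNIV. \<Sum>j\<in>UNIV. Ginv c i j x * (\<Sum>a\<in>UNIV. G c a i x * partial_deriv j (X a) x))
      = (\<Sum>k\<in>UNIV. partial_deriv k (X k) x)"
  proof -
    have "(\<Sum>i\<in>UNIV. \<Sum>j\<in>UNIV. Ginv c i j x * (\<Sum>a\<in>UNIV. G c a i x * partial_deriv j (X a) x))
        = (\<Sum>j\<in>UNIV. \<Sum>i\<in>UNIV. \<Sum>a\<in>UNIV. G c a i x * Ginv c i j x * partial_deriv j (X a) x)"
      unfolding sum_distrib_left by (subst sum.swap) (simp add: mult_ac)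
    also have "\<dots> = (\<Sum>j\<in>UNIV. \<Sum>a\<in>UNIV. (\<Sum>i\<in>UNIV. G c a i x * Ginv c i j x) * partial_deriv j (X a) x)"
      unfolding sum_distrib_right by (intro sum.cong refl sum.swap)
    also have "\<dots> = (\<Sum>j\<in>UNIV. \<Sum>a\<in>UNIV. (if a = j then 1 else 0) * partial_deriv j (X a) x)"
      by (simp only: metric_inverse[OF c])
    also have "\<dots> = (\<Sum>k\<in>UNIV. partial_deriv k (X k) x)" by (simp only: sum_delta_mult)
    finally show ?thesis .
  qed
  moreover have "(\<Sum>i\<in>UNIV. \<Sum>j\<in>UNIV. Ginv c i j x * (\<Sum>b\<in>UNIV. G c j b x * partial_deriv i (X b) x))
      = (\<Sum>k\<in>UNIV. partial_deriv k (X k) x)"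
  proof -
    have "(\<Sum>i\<in>UNIV. \<Sum>j\<in>UNIV. Ginv c i j x * (\<Sum>b\<in>UNIV. G c j b x * partial_deriv i (X b) x))
        = (\<Sum>i\<in>UNIV. \<Sum>j\<in>UNIV. \<Sum>b\<in>UNIV. Ginv c i j x * G c j b x * partial_deriv i (X b) x)"
      by (simp add: sum_distrib_left mult_ac)
    also have "\<dots> = (\<Sum>i\<in>UNIV. \<Sum>b\<in>UNIV. (\<Sum>j\<in>UNIV. Ginv c i j x * G c j b x) * partial_deriv i (X b) x)"
      unfolding sum_distrib_right by (intro sum.cong refl sum.swap)
    also have "\<dots> = (\<Sum>i\<in>UNIV. \<Sum>b\<in>UNIV. (if i = b then 1 else 0) * partial_deriv i (X b) x)"
      by (simp only: metric_inverse[OF c])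
    also have "\<dots> = (\<Sum>i\<in>UNIV. \<Sum>b\<in>UNIV. (if b = i then 1 else 0) * partial_deriv i (X b) x)"
      by (simp only: eq_commute)
    also have "\<dots> = (\<Sum>k\<in>UNIV. partial_deriv k (X k) x)" by (simp only: sum_delta_mult)
    finally show ?thesis .
  qed
  ultimately show ?thesis
    by (simp add: tr_lie_def distrib_left sum.distrib)
qed

lemma norm_sq_pullback:
  assumes c: "c \<in> A" "x \<in> chart_img c" and u: "(u, x) \<in> family_dom T \<Psi> c c"
  shows "N u (param c x) = (\<Sum>i\<in>UNIV. \<Sum>j\<in>UNIV. Ginv c i j x * pullback c i j x u)"
  using family_norm_sq[OF fam c(1) c(1) u] family_rep_in[OF c(1) c(1) u]
  by (simp add: energy_expand Ginv_def pullback_def G_def)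

text \<open>The inverse metric at the base point does not depend on the parameters, so the jet of
  the pulled back metric is merely contracted: multiples of the metric yield the factor m, the Lie
  derivative along \<open>Y\<close> yields \<open>tr_lie\<close>.\<close>

lemma jet_norm_sq:
  assumes c: "c \<in> A" "x \<in> chart_img c"
  shows "has_jet (\<lambda>u. N u (param c x)) (real CARD('m)) (2 * l (param c x) * real CARD('m)) (2 * l (param c x) * real CARD('m))
    ((2 * Dw c (\<lambda>x. l (param c x)) x + 4 * (l (param c x))\<^sup>2) * real CARD('m) + tr_lie c (Y c) x)"
proof -
  let ?k = "2 * Dw c (\<lambda>x. l (param c x)) x + 4 * (l (param c x))\<^sup>2"
  let ?L = "\<lambda>i j. (\<Sum>k\<in>UNIV. partial_deriv k (G c j i) x * Y c k x)
      + (\<Sum>a\<in>UNIV. G c a i x * partial_deriv j (Y c a) x) + (\<Sum>b\<in>UNIV. G c j b x * partial_deriv i (Y c b) x)"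
  have J: "has_jet (pullback c i j x) (1 * G c j i x) (2 * l (param c x) * G c j i x) (2 * l (param c x) * G c j i x)
      (?k * G c j i x + ?L i j)" for i j
    using jet_pullback[OF c, of i j] by (simp add: add.assoc)
  have "has_jet (\<lambda>u. \<Sum>i\<in>UNIV. \<Sum>j\<in>UNIV. Ginv c i j x * pullback c i j x u)
      (\<Sum>i\<in>UNIV. \<Sum>j\<in>UNIV. Ginv c i j x * (1 * G c j i x))
      (\<Sum>i\<in>UNIV. \<Sum>j\<in>UNIV. Ginv c i j x * (2 * l (param c x) * G c j i x))
      (\<Sum>i\<in>UNIV. \<Sum>j\<in>UNIV. Ginv c i j x * (2 * l (param c x) * G c j i x))
      (\<Sum>i\<in>UNIV. \<Sum>j\<in>UNIV. Ginv c i j x * (?k * G c j i x + ?L i j))"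
    by (intro has_jet_sum has_jet_cmult J)
  moreover have "(\<Sum>i\<in>UNIV. \<Sum>j\<in>UNIV. Ginv c i j x * (?k * G c j i x + ?L i j)) = ?k * real CARD('m) + tr_lie c (Y c) x"
  proof -
    have "(\<Sum>i\<in>UNIV. \<Sum>j\<in>UNIV. Ginv c i j x * (?k * G c j i x + ?L i j))
        = (\<Sum>i\<in>UNIV. \<Sum>j\<in>UNIV. Ginv c i j x * (?k * G c j i x)) + (\<Sum>i\<in>UNIV. \<Sum>j\<in>UNIV. Ginv c i j x * ?L i j)"
      by (simp only: distrib_left[of _ "?k * _"] sum.distrib)
    then show ?thesis by (simp only: trace_metric[OF c] trace_lie_derivative[OF c, of "Y c"])
  qed
  ultimately have J2: "has_jet (\<lambda>u. \<Sum>i\<in>UNIV. \<Sum>j\<in>UNIV. Ginv c i j x * pullback c i j x u)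
      (1 * real CARD('m)) (2 * l (param c x) * real CARD('m)) (2 * l (param c x) * real CARD('m)) (?k * real CARD('m) + tr_lie c (Y c) x)"
    by (simp only: trace_metric[OF c])
  show ?thesis
    by (rule has_jet_cong[OF curve_dom(1,2)[OF c] _ J2[unfolded mult_1_left]])
      (rule norm_sq_pullback[OF c, symmetric], simp)
qed

lemma N_0: "N 0 p = real CARD('m)"
proof -
  let ?c = "chart_at A p"
  note c = chart_at[of p]
  have "has_jet (\<lambda>u. N u (param ?c (coord ?c p))) (real CARD('m)) (2 * l p * real CARD('m)) (2 * l p * real CARD('m))
    ((2 * Dw ?c (\<lambda>x. l (param ?c x)) (coord ?c p) + 4 * (l p)\<^sup>2) * real CARD('m) + tr_lie ?c (Y ?c) (coord ?c p))"
    using jet_norm_sq[OF c(1) coord_in[OF c(2)]] c by simp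
  then show ?thesis using c by (auto simp: has_jet_def)
qed

text \<open>The trace of the conformal equation. It says that \<open>W\<close> has divergence m
  \<lambda>, which lets the integral of W(\<lambda>) be converted into one of \<lambda>^2.\<close>

lemma tr_lie_w:
  assumes c: "c \<in> A" "x \<in> chart_img c"
  shows "tr_lie c (w c) x = 2 * l (param c x) * real CARD('m)"
proof -
  have "(\<Sum>k\<in>UNIV. partial_deriv k (G c j i) x * w c k x)
      + (\<Sum>a\<in>UNIV. G c a i x * partial_deriv j (w c a) x) + (\<Sum>b\<in>UNIV. G c j b x * partial_deriv i (w c b) x)
      = 2 * l (param c x) * G c j i x" for i j
    using conformal_eq[OF c, of j i] by (simp add: Dw_def)
  then show ?thesis
    unfolding trace_lie_derivative[OF c, symmetric] by (simp only: trace_metric[OF c])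
qed

lemma tr_lie_add:
  assumes "\<And>k. smooth_on (chart_img c) (X k)" "\<And>k. smooth_on (chart_img c) (V k)" "x \<in> chart_img c"
  shows "tr_lie c (\<lambda>k x. X k x + V k x) x = tr_lie c X x + tr_lie c V x"
  by (simp add: tr_lie_def partial_deriv_add[OF assms] distrib_left sum.distrib)

lemma tr_lie_mult:
  assumes f: "smooth_on (chart_img c) f" and X: "\<And>k. smooth_on (chart_img c) (X k)" and x: "x \<in> chart_img c"
  shows "tr_lie c (\<lambda>k x. f x * X k x) x = f x * tr_lie c X x + 2 * (\<Sum>k\<in>UNIV. partial_deriv k f x * X k x)"
  by (simp add: tr_lie_def partial_deriv_mult[OF f X x] distrib_left sum.distrib sum_distrib_left mult_ac)

text \<open>The coordinate formula for the divergence. By Jacobi's formula the logarithmic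
  derivative of the density is half the trace of the derivative of the metric, which supplies the
  first sum in \<open>tr_lie\<close>.\<close>

lemma dens_tr_lie:
  assumes c: "c \<in> A" "x \<in> chart_img c" and X: "\<And>k. smooth_on (chart_img c) (X k)"
  shows "dens c x * tr_lie c X x = 2 * (\<Sum>k\<in>UNIV. partial_deriv k (\<lambda>y. dens c y * X k y) x)"
proof -
  have pos: "det (g (param c x) c) > 0" by (rule det_metric_pos) (use c in auto)
  have d1: "((\<lambda>x. det (g (param c x) c)) has_derivative (\<lambda>h. det (g (param c x) c) *
      (\<Sum>i\<in>UNIV. \<Sum>j\<in>UNIV. frechet_derivative (G c i j) (at x) h * matrix_inv (g (param c x) c) $ j $ i))) (at x)"
  proof (rule det_has_derivative)
    show "((\<lambda>x. g (param c x) c $ i $ j) has_derivative frechet_derivative (G c i j) (at x)) (at x)" for i j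
      using smooth_on_has_derivative[OF smooth_G[OF c(1)] c(2)] by (simp add: G_def[abs_def])
  qed (use pos in simp)
  have d2: "(sqrt has_derivative (\<lambda>h. h * (inverse (sqrt (det (g (param c x) c))) / 2))) (at (det (g (param c x) c)))"
    using DERIV_real_sqrt[OF pos] unfolding has_field_derivative_def
    by (rule has_derivative_eq_rhs) (simp add: fun_eq_iff)
  have "det (g (param c x) c) * inverse (sqrt (det (g (param c x) c))) = dens c x"
    using pos by (simp add: dens_def real_div_sqrt[unfolded divide_inverse])
  then have "(det (g (param c x) c) * y) * (inverse (sqrt (det (g (param c x) c))) / 2) = dens c x / 2 * y" for y
    by (simp add: mult_ac)
  with has_derivative_compose[OF d1 d2]
  have "(dens c has_derivative (\<lambda>h. dens c x / 2 *
      (\<Sum>i\<in>UNIV. \<Sum>j\<in>UNIV. frechet_derivative (G c i j) (at x) h * matrix_inv (g (param c x) c) $ j $ i))) (at x)"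
    by (simp only: dens_def[abs_def])
  from partial_deriv_has_derivative[OF this]
  have "partial_deriv k (dens c) x = dens c x / 2 * (\<Sum>i\<in>UNIV. \<Sum>j\<in>UNIV. partial_deriv k (G c i j) x * Ginv c j i x)" for k
    by (simp add: partial_deriv_def Ginv_def)
  then have pd: "2 * partial_deriv k (dens c) x = dens c x * (\<Sum>i\<in>UNIV. \<Sum>j\<in>UNIV. Ginv c i j x * partial_deriv k (G c j i) x)" for k
    by (subst sum.swap) (simp add: mult.commute)
  have "(\<Sum>i\<in>UNIV. \<Sum>j\<in>UNIV. Ginv c i j x * (\<Sum>k\<in>UNIV. partial_deriv k (G c j i) x * X k x))
      = (\<Sum>k\<in>UNIV. (\<Sum>i\<in>UNIV. \<Sum>j\<in>UNIV. Ginv c i j x * partial_deriv k (G c j i) x) * X k x)"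
  proof -
    have "(\<Sum>i\<in>UNIV. \<Sum>j\<in>UNIV. Ginv c i j x * (\<Sum>k\<in>UNIV. partial_deriv k (G c j i) x * X k x))
        = (\<Sum>i\<in>UNIV. \<Sum>j\<in>UNIV. \<Sum>k\<in>UNIV. Ginv c i j x * partial_deriv k (G c j i) x * X k x)"
      by (simp add: sum_distrib_left mult.assoc)
    also have "\<dots> = (\<Sum>i\<in>UNIV. \<Sum>k\<in>UNIV. \<Sum>j\<in>UNIV. Ginv c i j x * partial_deriv k (G c j i) x * X k x)"
      by (intro sum.cong refl sum.swap)
    also have "\<dots> = (\<Sum>k\<in>UNIV. \<Sum>i\<in>UNIV. \<Sum>j\<in>UNIV. Ginv c i j x * partial_deriv k (G c j i) x * X k x)"
      by (rule sum.swap)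
    finally show ?thesis by (simp add: sum_distrib_right)
  qed
  then have "dens c x * tr_lie c X x
      = (\<Sum>k\<in>UNIV. (dens c x * (\<Sum>i\<in>UNIV. \<Sum>j\<in>UNIV. Ginv c i j x * partial_deriv k (G c j i) x)) * X k x)
        + 2 * (\<Sum>k\<in>UNIV. dens c x * partial_deriv k (X k) x)"
    unfolding tr_lie_def by (simp add: distrib_left sum_distrib_left mult_ac)
  also have "\<dots> = 2 * (\<Sum>k\<in>UNIV. partial_deriv k (dens c) x * X k x + dens c x * partial_deriv k (X k) x)"
    unfolding pd[symmetric] by (simp add: sum.distrib sum_distrib_left mult_ac)
  also have "\<dots> = 2 * (\<Sum>k\<in>UNIV. partial_deriv k (\<lambda>y. dens c y * X k y) x)"
    by (simp add: partial_deriv_mult[OF smooth_dens[OF c(1)] X c(2)])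
  finally show ?thesis .
qed

text \<open>\<open>along h\<close> is the derivative of \<open>h\<close> in the direction \<open>W\<close>, and \<open>excess h\<close> the derivative in the
  direction \<open>Y + m \<lambda> W\<close>, both expressed without charts.\<close>
definition along :: "('a \<Rightarrow> real) \<Rightarrow> 'a \<Rightarrow> real" where
  "along h = param_deriv (0, 1) (\<lambda>u p. h (\<Psi> u p)) 0"

definition excess :: "('a \<Rightarrow> real) \<Rightarrow> 'a \<Rightarrow> real" where
  "excess h p = param_deriv (1, 0) (param_deriv (0, 1) (\<lambda>u p. h (\<Psi> u p))) 0 p
     - param_deriv (1, 0) (\<lambda>u p. along h (\<Psi> u p)) 0 p + real CARD('m) * l p * along h p"

text \<open>The second summand is chosen so that its \<open>tr_lie\<close> contains 2 m
  W(\<lambda>), the very term that occurs in the jet of the squared norm; the by-product is 2 m^2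
  \<lambda>^2.\<close>

definition X :: "('a, 'm) chart \<Rightarrow> 'm \<Rightarrow> real^'m \<Rightarrow> real" where
  "X c k x = Y c k x + (real CARD('m) * l (param c x)) * w c k x"

lemma smooth_X: "c \<in> A \<Longrightarrow> smooth_on (chart_img c) (X c k)"
  unfolding X_def[abs_def]
  by (intro smooth_on_add smooth_on_mult smooth_on_const smooth_Y smooth_w smooth_lc) auto

lemma smooth_compose: "smooth_fun A h \<Longrightarrow> smooth_param T (\<lambda>u p. h (\<Psi> u p))"
  by (rule smooth_param_compose[OF _ fam])

lemma smooth_along: "smooth_fun A h \<Longrightarrow> smooth_fun A (along h)"
  unfolding along_def by (rule smooth_param_at[OF smooth_param_deriv[OF smooth_compose] T0])

lemma compose_chart:
  assumes h: "smooth_fun A h" and c: "c \<in> A" "x \<in> chart_img c"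
  defines "f \<equiv> \<lambda>y. h (param c y)"
  shows "param_deriv (1, 0) (\<lambda>u p. h (\<Psi> u p)) 0 (param c x) = Dw c f x"
    and "along h (param c x) = Dw c f x"
    and "param_deriv (1, 0) (param_deriv (0, 1) (\<lambda>u p. h (\<Psi> u p))) 0 (param c x)
      = (\<Sum>k\<in>UNIV. Dw c (partial_deriv k f) x * w c k x) + (\<Sum>k\<in>UNIV. partial_deriv k f x * Z c k x)"
proof -
  have "has_jet (\<lambda>u. f (family_rep \<Psi> c c (u, x))) (f x) (Dw c f x) (Dw c f x)
    ((\<Sum>k\<in>UNIV. Dw c (partial_deriv k f) x * w c k x) + (\<Sum>k\<in>UNIV. partial_deriv k f x * Z c k x))"
    unfolding f_def by (rule jet_function[OF c smooth_funD[OF h c(1)]])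
  then have "has_jet (\<lambda>u. h (\<Psi> u (param c x))) (f x) (Dw c f x) (Dw c f x)
    ((\<Sum>k\<in>UNIV. Dw c (partial_deriv k f) x * w c k x) + (\<Sum>k\<in>UNIV. partial_deriv k f x * Z c k x))"
    by (rule has_jet_cong[OF curve_dom(1,2)[OF c], rotated])
      (use family_rep_in[OF c(1) c(1), of _ T \<Psi>] in \<open>simp add: f_def\<close>)
  then show "param_deriv (1, 0) (\<lambda>u p. h (\<Psi> u p)) 0 (param c x) = Dw c f x"
    "along h (param c x) = Dw c f x"
    "param_deriv (1, 0) (param_deriv (0, 1) (\<lambda>u p. h (\<Psi> u p))) 0 (param c x)
      = (\<Sum>k\<in>UNIV. Dw c (partial_deriv k f) x * w c k x) + (\<Sum>k\<in>UNIV. partial_deriv k f x * Z c k x)"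
    unfolding has_jet_def param_deriv_def along_def by blast+
qed

text \<open>The mixed derivative of \<open>h\<close> along the variation is Hess h(W, W) + dh(Z),
  the iterated derivative along \<open>W\<close> is Hess h(W, W) + dh of the derivative of
  \<open>W\<close> along itself. The Hessians cancel and the difference is dh(Y).\<close>

lemma excess_chart:
  assumes h: "smooth_fun A h" and c: "c \<in> A" "x \<in> chart_img c"
  defines "f \<equiv> \<lambda>y. h (param c y)"
  shows "excess h (param c x) = (\<Sum>k\<in>UNIV. partial_deriv k f x * X c k x)"
proof -
  have sf: "smooth_on (chart_img c) f" unfolding f_def by (rule smooth_funD[OF h c(1)])
  have "param_deriv (1, 0) (\<lambda>u p. along h (\<Psi> u p)) 0 (param c x) = Dw c (\<lambda>y. along h (param c y)) x"
    by (rule compose_chart(1)[OF smooth_along[OF h] c])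
  also have "\<dots> = Dw c (\<lambda>y. \<Sum>k\<in>UNIV. partial_deriv k f y * w c k y) x"
    unfolding Dw_def[of c "\<lambda>y. along h (param c y)"] Dw_def[of c "\<lambda>y. \<Sum>k\<in>UNIV. partial_deriv k f y * w c k y"]
    by (intro sum.cong refl arg_cong2[where f = "(*)"] partial_deriv_cong[OF open_chart_img[OF c(1)] c(2)])
      (simp add: compose_chart(2)[OF h c(1)] Dw_def f_def)
  also have "\<dots> = (\<Sum>k\<in>UNIV. Dw c (partial_deriv k f) x * w c k x + partial_deriv k f x * Dw c (w c k) x)"
    by (subst Dw_sum[OF _ c(2)])
      (intro smooth_on_mult partial_deriv_smooth sf smooth_w c open_chart_img,
        simp add: Dw_mult[OF partial_deriv_smooth[OF sf] smooth_w[OF c(1)] c(2)])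
  finally have 1: "param_deriv (1, 0) (\<lambda>u p. along h (\<Psi> u p)) 0 (param c x)
    = (\<Sum>k\<in>UNIV. Dw c (partial_deriv k f) x * w c k x + partial_deriv k f x * Dw c (w c k) x)" .
  have 2: "along h (param c x) = (\<Sum>k\<in>UNIV. partial_deriv k f x * w c k x)"
    using compose_chart(2)[OF h c] by (simp add: Dw_def f_def)
  show ?thesis
    unfolding excess_def 1 2 compose_chart(3)[OF h c, folded f_def]
    by (simp add: X_def Y_def sum.distrib sum_subtractf distrib_left right_diff_distrib sum_distrib_left mult_ac)
qed

text \<open>Parameter derivatives of the constant 1. The chart-free form of \<open>excess\<close>
  matters here, because the pieces of a partition of unity are computed in different charts.\<close>

lemma excess_sum:
  assumes I: "finite I" and h: "\<And>i. i \<in> I \<Longrightarrow> smooth_fun A (h i)" and one: "\<And>p. (\<Sum>i\<in>I. h i p) = 1"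
  shows "(\<Sum>i\<in>I. excess (h i) p) = 0"
proof -
  have oT: "open T" by (rule smooth_familyD(1)[OF fam])
  have first: "(\<Sum>i\<in>I. param_deriv v (\<lambda>u p. h i (\<Psi> u p)) u p) = 0" if "u \<in> T" for v u p
    using param_deriv_sum[of I T "\<lambda>i u p. h i (\<Psi> u p)" u v p] smooth_compose h that by (simp add: one)
  have al: "(\<Sum>i\<in>I. along (h i) p) = 0" for p
    unfolding along_def by (rule first[OF T0])
  have "(\<Sum>i\<in>I. param_deriv (1, 0) (param_deriv (0, 1) (\<lambda>u p. h i (\<Psi> u p))) 0 p)
      = param_deriv (1, 0) (\<lambda>u p. \<Sum>i\<in>I. param_deriv (0, 1) (\<lambda>u p. h i (\<Psi> u p)) u p) 0 p"
    by (rule param_deriv_sum[OF _ T0, symmetric]) (intro smooth_param_deriv smooth_compose h)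
  also have "\<dots> = param_deriv (1, 0) (\<lambda>(u :: real \<times> real) p. 0) 0 p"
    by (rule param_deriv_cong[OF oT T0]) (rule first)
  finally have 1: "(\<Sum>i\<in>I. param_deriv (1, 0) (param_deriv (0, 1) (\<lambda>u p. h i (\<Psi> u p))) 0 p) = 0" by simp
  have "(\<Sum>i\<in>I. param_deriv (1, 0) (\<lambda>u p. along (h i) (\<Psi> u p)) 0 p) = 0"
    using param_deriv_sum[of I T "\<lambda>i u p. along (h i) (\<Psi> u p)" 0 "(1, 0)" p] smooth_compose[OF smooth_along] h T0
    by (simp add: al)
  then show ?thesis
    by (simp add: excess_def sum.distrib sum_subtractf 1 sum_distrib_left[symmetric] al)
qed

text \<open>A point off the closed set \<open>K\<close> stays off it under \<open>\<Psi> u\<close>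
  for all small \<open>u\<close>, so only zeros are differentiated. Hence the corrected integrands
  of \<open>second_variation\<close> keep their support in one chart.\<close>

lemma excess_support:
  assumes K: "compact K" and h: "\<And>p. p \<notin> K \<Longrightarrow> h p = 0" and p: "p \<notin> K"
  shows "excess h p = 0"
proof -
  have nbhd: "\<exists>S. open S \<and> 0 \<in> S \<and> (\<forall>u\<in>S. \<Psi> u q \<notin> K)" if "q \<notin> K" for q
  proof -
    let ?c = "chart_at A q"
    note c = chart_at[of q]
    have "open {z. fst z \<in> T \<and> snd z \<in> chart_img ?c \<and> \<Psi> (fst z) (param ?c (snd z)) \<in> - K}"
      by (rule open_family_vimage[OF fam c(1)]) (use K compact_imp_closed in auto)
    then have "open ((\<lambda>u. (u, coord ?c q)) -` {z. fst z \<in> T \<and> snd z \<in> chart_img ?c \<and> \<Psi> (fst z) (param ?c (snd z)) \<in> - K})"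
      by (rule open_vimage) (intro continuous_intros)
    then show ?thesis
      using T0 that c by (intro exI conjI) (assumption, auto simp: \<Psi>0)
  qed
  have van: "param_deriv v (\<lambda>u p. f (\<Psi> u p)) u q = 0"
    if "open S" "u \<in> S" "\<And>u. u \<in> S \<Longrightarrow> \<Psi> u q \<notin> K" "\<And>p. p \<notin> K \<Longrightarrow> f p = 0" for v f S u q
    using param_deriv_cong[OF that(1,2), of "\<lambda>u p. f (\<Psi> u p)" q "\<lambda>u p. 0"] that(3,4) by simp
  have al: "along h q = 0" if q: "q \<notin> K" for q
  proof -
    obtain S where "open S" "0 \<in> S" "\<forall>u\<in>S. \<Psi> u q \<notin> K" using nbhd[OF q] by blast
    then show ?thesis unfolding along_def by (intro van h) auto
  qed
  obtain S where S: "open S" "0 \<in> S" "\<And>u. u \<in> S \<Longrightarrow> \<Psi> u p \<notin> K" using nbhd[OF p] by blast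
  have "param_deriv (1, 0) (param_deriv (0, 1) (\<lambda>u p. h (\<Psi> u p))) 0 p = param_deriv (1, 0) (\<lambda>(u :: real \<times> real) p. 0) 0 p"
    by (rule param_deriv_cong[OF S(1,2)]) (rule van[OF S(1) _ S(3) h], assumption)
  moreover have "param_deriv (1, 0) (\<lambda>u p. along h (\<Psi> u p)) 0 p = 0"
    by (rule van[OF S al])
  ultimately show ?thesis by (simp add: excess_def al[OF p])
qed

lemma excess_continuous:
  assumes "smooth_fun A h" shows "continuous_on UNIV (excess h)"
  unfolding excess_def[abs_def]
  by (intro continuous_intros smooth_fun_continuous smooth_along smooth_l assms
      smooth_param_slice_continuous[OF smooth_param_deriv T0] smooth_param_deriv smooth_compose)

text \<open>The second derivative \<open>E\<close> of the density differs from a constant multiple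
  of \<lambda>^2 by a multiple of a divergence. That divergence integrates to 0 after localisation,
  so the value involves the variation only through \<lambda>.\<close>

lemma second_variation:
  fixes \<alpha> :: real
  defines "C1 \<equiv> \<alpha> * (1 + real CARD('m)) powr (\<alpha> - 1)" and "C2 \<equiv> \<alpha> * (\<alpha> - 1) * (1 + real CARD('m)) powr (\<alpha> - 2)"
  shows "deriv (\<lambda>t. deriv (\<lambda>s. alpha_energy \<alpha> A g A g (\<Psi> (t, s))) 0) 0
    = (4 * real CARD('m) * C1 - 2 * (real CARD('m))\<^sup>2 * C1 + 4 * (real CARD('m))\<^sup>2 * C2) * (LINT p|vol. (l p)\<^sup>2)"
proof -
  let ?m = "real CARD('m)"
  \<comment> \<open>The coefficient of \<lambda>^2 left after \<open>C1 * tr_lie c (X c) x\<close>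
    is subtracted from \<open>E\<close>: the middle term is the by-product of absorbing
    W(\<lambda>), the last one comes from the second derivative of the power.\<close>
  define \<kappa> where "\<kappa> = 4 * ?m * C1 - 2 * ?m\<^sup>2 * C1 + 4 * ?m\<^sup>2 * C2"
  have sN: "smooth_param T N" by (rule smooth_norm_sq[OF fam])
  \<comment> \<open>At parameter 0 the squared norm is m, hence above -1; on a smaller neighbourhood
    this persists at all points and the density is smooth.\<close>
  obtain S where S: "open S" "0 \<in> S" "S \<subseteq> T" "\<And>u p. u \<in> S \<Longrightarrow> N u p \<in> {-1<..}"
    using param_tube[OF smooth_familyD(1)[OF fam] T0 smooth_param_continuous[OF sN], of "{-1<..}"] by (auto simp: N_0)
  define F where "F = (\<lambda>u p. (1 + N u p) powr \<alpha>)"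
  have sF: "smooth_param S F"
    unfolding smooth_param_def F_def
  proof (intro conjI ballI S(1))
    fix c assume c: "c \<in> A"
    have o: "open (S \<times> chart_img c)" using S(1) c by (auto intro!: open_Times)
    have "smooth_on (S \<times> chart_img c) (\<lambda>z. N (fst z) (param c (snd z)))"
      by (rule smooth_on_subset[of "T \<times> chart_img c"]) (use sN c S(3) in \<open>auto simp: smooth_param_def\<close>)
    moreover have "1 + N (fst z) (param c (snd z)) > 0" if "z \<in> S \<times> chart_img c" for z
      using S(4)[of "fst z" "param c (snd z)"] that by auto
    ultimately show "smooth_on (S \<times> chart_img c) (\<lambda>z. (1 + N (fst z) (param c (snd z))) powr \<alpha>)"
      by (intro smooth_on_powr_compose smooth_on_add smooth_on_const o)
  qed
  define E where "E = param_deriv (1, 0) (param_deriv (0, 1) F) 0"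
  have E: "deriv (\<lambda>t. deriv (\<lambda>s. alpha_energy \<alpha> A g A g (\<Psi> (t, s))) 0) 0 = (LINT p|vol. E p)"
    using second_deriv_integral[OF sF S(2)] by (simp add: alpha_energy_def F_def E_def)
  have contE: "continuous_on UNIV E"
    unfolding E_def by (rule smooth_param_slice_continuous[OF smooth_param_deriv[OF smooth_param_deriv[OF sF]] S(2)])
  have chart: "E (param c x) - \<kappa> * (l (param c x))\<^sup>2 = C1 * tr_lie c (X c) x" if c: "c \<in> A" "x \<in> chart_img c" for c x
  proof -
    let ?l = "l (param c x)" and ?d = "Dw c (\<lambda>x. l (param c x)) x"
    have "has_jet (\<lambda>u. F u (param c x)) ((1 + ?m) powr \<alpha>) (C1 * (2 * ?l * ?m)) (C1 * (2 * ?l * ?m))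
        (C1 * ((2 * ?d + 4 * ?l\<^sup>2) * ?m + tr_lie c (Y c) x) + C2 * (2 * ?l * ?m) * (2 * ?l * ?m))"
      unfolding F_def C1_def C2_def by (rule has_jet_powr[OF jet_norm_sq[OF c]]) simp
    then have "E (param c x) = C1 * ((2 * ?d + 4 * ?l\<^sup>2) * ?m + tr_lie c (Y c) x) + C2 * (2 * ?l * ?m) * (2 * ?l * ?m)"
      unfolding has_jet_def E_def param_deriv_def by blast
    moreover have "tr_lie c (X c) x = tr_lie c (Y c) x + (?m * ?l * (2 * ?l * ?m) + 2 * (?m * ?d))"
    proof -
      have sl: "smooth_on (chart_img c) (\<lambda>x. ?m * l (param c x))"
        by (intro smooth_on_mult smooth_on_const smooth_lc) (use c in auto)
      have pl: "partial_deriv k (\<lambda>x. ?m * l (param c x)) x = ?m * partial_deriv k (\<lambda>x. l (param c x)) x" for k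
        by (subst partial_deriv_mult[OF smooth_on_const smooth_lc[OF c(1)] c(2)]) (simp add: partial_deriv_def)
      have "tr_lie c (X c) x = tr_lie c (Y c) x + tr_lie c (\<lambda>k x. (?m * l (param c x)) * w c k x) x"
        unfolding X_def[abs_def]
        by (rule tr_lie_add[OF smooth_Y[OF c(1)] smooth_on_mult[OF open_chart_img[OF c(1)] sl smooth_w[OF c(1)]] c(2)])
      also have "tr_lie c (\<lambda>k x. (?m * l (param c x)) * w c k x) x = ?m * ?l * (2 * ?l * ?m) + 2 * (?m * ?d)"
        by (subst tr_lie_mult[OF sl smooth_w[OF c(1)] c(2)])
          (simp add: tr_lie_w[OF c] pl Dw_def sum_distrib_left mult_ac)
      finally show ?thesis .
    qed
    ultimately show ?thesis by (simp add: \<kappa>_def power2_eq_square algebra_simps)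
  qed
  obtain I :: "'a set" and \<rho> :: "'a \<Rightarrow> 'a \<Rightarrow> real" and ch K where
    P: "finite I" "\<And>i. i \<in> I \<Longrightarrow> ch i \<in> A" "\<And>i. i \<in> I \<Longrightarrow> compact (K i)"
    "\<And>i. i \<in> I \<Longrightarrow> K i \<subseteq> chart_dom (ch i)" "\<And>i. i \<in> I \<Longrightarrow> smooth_fun A (\<rho> i)"
    "\<And>i p. i \<in> I \<Longrightarrow> p \<notin> K i \<Longrightarrow> \<rho> i p = 0" "\<And>p. (\<Sum>i\<in>I. \<rho> i p) = 1"
    by (rule partition_of_unity) (rule that)
  \<comment> \<open>The correction turns \<rho> times the divergence of \<open>X\<close> into the
    divergence of \<rho> \<open>X\<close>, by the product rule \<open>tr_lie_mult\<close>. Summed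
    over \<open>i\<close> the corrections vanish by \<open>excess_sum\<close>.\<close>
  define H where "H = (\<lambda>i p. \<rho> i p * (E p - \<kappa> * (l p)\<^sup>2) + 2 * C1 * excess (\<rho> i) p)"
  have contH: "continuous_on UNIV (H i)" if "i \<in> I" for i
    unfolding H_def
    by (intro continuous_intros contE smooth_fun_continuous smooth_l P(5) that excess_continuous)
  have "(LINT p|vol. H i p) = 0" if i: "i \<in> I" for i
  proof -
    let ?c = "ch i" and ?K = "coord (ch i) ` K i"
    note c = P(2)[OF i]
    let ?f = "\<lambda>x. \<rho> i (param ?c x)"
    let ?v = "\<lambda>k x. dens ?c x * (?f x * X ?c k x)"
    have sf: "smooth_on (chart_img ?c) ?f" by (rule smooth_funD[OF P(5)[OF i] c])
    have sv: "smooth_on (chart_img ?c) (?v k)" for k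
      by (intro smooth_on_mult smooth_dens sf smooth_X c open_chart_img)
    have K: "compact ?K" "?K \<subseteq> chart_img ?c"
      using compact_continuous_image[OF continuous_on_subset[OF continuous_coord[OF c] P(4)[OF i]] P(3)[OF i]] P(4)[OF i] by auto
    have v0: "?v k x = 0" if "x \<in> chart_img ?c" "x \<notin> ?K" for k x
    proof -
      have "param ?c x \<notin> K i" using that c by (metis coord_param imageI)
      then show ?thesis using P(6)[OF i] by simp
    qed
    have "(LINT p|vol. H i p) = (LINT x|lborel. indicator (chart_img ?c) x * (dens ?c x * H i (param ?c x)))"
    proof (rule integral_vol_chart[OF c])
      show "H i \<in> borel_measurable borel" by (rule borel_measurable_continuous_onI[OF contH[OF i]])
      fix p assume "p \<notin> chart_dom ?c"
      then have "p \<notin> K i" using P(4)[OF i] by auto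
      then show "H i p = 0" using P(6)[OF i] excess_support[OF P(3)[OF i]] by (simp add: H_def)
    qed
    also have "\<dots> = (LINT x|lborel. (\<Sum>k\<in>UNIV. 2 * C1 * (indicator (chart_img ?c) x * partial_deriv k (?v k) x)))"
    proof (rule Bochner_Integration.integral_cong[OF refl])
      fix x
      show "indicator (chart_img ?c) x * (dens ?c x * H i (param ?c x))
          = (\<Sum>k\<in>UNIV. 2 * C1 * (indicator (chart_img ?c) x * partial_deriv k (?v k) x))"
      \<comment> \<open>In the chart, \<open>dens_tr_lie\<close> makes the integrand a sum of
        coordinate derivatives of compactly supported functions.\<close>
      proof (cases "x \<in> chart_img ?c")
        case x: True
        have "H i (param ?c x) = C1 * (?f x * tr_lie ?c (X ?c) x + 2 * (\<Sum>k\<in>UNIV. partial_deriv k ?f x * X ?c k x))"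
          unfolding H_def chart[OF c x] excess_chart[OF P(5)[OF i] c x] by (simp add: algebra_simps)
        also have "\<dots> = C1 * tr_lie ?c (\<lambda>k x. ?f x * X ?c k x) x"
          by (simp only: tr_lie_mult[OF sf smooth_X[OF c] x])
        finally have "dens ?c x * H i (param ?c x) = C1 * (dens ?c x * tr_lie ?c (\<lambda>k x. ?f x * X ?c k x) x)"
          by simp
        also have "\<dots> = C1 * (2 * (\<Sum>k\<in>UNIV. partial_deriv k (?v k) x))"
          by (subst dens_tr_lie[OF c x]) (intro smooth_on_mult sf smooth_X c open_chart_img refl)+
        finally show ?thesis using x by (simp add: sum_distrib_left mult_ac)
      qed simp
    qed
    also have "\<dots> = (\<Sum>k\<in>UNIV. LINT x|lborel. 2 * C1 * (indicator (chart_img ?c) x * partial_deriv k (?v k) x))"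
      by (rule Bochner_Integration.integral_sum)
        (intro integrable_mult_right integral_partial_deriv_compact_support(1)[OF open_chart_img[OF c] K sv v0])
    also have "\<dots> = 0"
      by (simp add: integral_partial_deriv_compact_support(2)[OF open_chart_img[OF c] K sv v0])
    finally show ?thesis .
  qed
  then have "(\<Sum>i\<in>I. LINT p|vol. H i p) = 0" by simp
  moreover have "(\<Sum>i\<in>I. LINT p|vol. H i p) = (LINT p|vol. (\<Sum>i\<in>I. H i p))"
    by (rule Bochner_Integration.integral_sum[symmetric]) (rule integrable_vol_continuous[OF contH])
  moreover have "(\<Sum>i\<in>I. H i p) = E p - \<kappa> * (l p)\<^sup>2" for p
    by (simp add: H_def sum.distrib sum_distrib_left[symmetric] sum_distrib_right[symmetric] P(7)
        excess_sum[OF P(1,5,7)])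
  moreover have "(LINT p|vol. E p - \<kappa> * (l p)\<^sup>2) = (LINT p|vol. E p) - \<kappa> * (LINT p|vol. (l p)\<^sup>2)"
    using integrable_vol_continuous[OF contE]
      integrable_vol_continuous[of "\<lambda>p. (l p)\<^sup>2"] continuous_on_power[OF smooth_fun_continuous[OF smooth_l]]
    by simp
  ultimately show ?thesis using E by (simp add: \<kappa>_def)
qed

end

lemma (in riemannian_manifold) two_param_variation_family:
  assumes "smooth_two_param_variation A A id \<Psi>"
  shows "\<exists>T. 0 \<in> T \<and> smooth_family T (\<lambda>u. \<Psi> (fst u) (snd u))"
proof -
  obtain \<epsilon> where \<epsilon>: "\<epsilon> > 0"
    "continuous_on ({-\<epsilon><..<\<epsilon>} \<times> {-\<epsilon><..<\<epsilon>} \<times> UNIV) (\<lambda>(t, s, p). \<Psi> t s p)"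
    "\<And>c d. c \<in> A \<Longrightarrow> d \<in> A \<Longrightarrow> smooth_on
           {(t, s, x). t \<in> {-\<epsilon><..<\<epsilon>} \<and> s \<in> {-\<epsilon><..<\<epsilon>} \<and> x \<in> chart_img c \<and> \<Psi> t s (param c x) \<in> chart_dom d}
           (\<lambda>(t, s, x). coord d (\<Psi> t s (param c x)))"
    using assms unfolding smooth_two_param_variation_def by blast
  let ?I = "{-\<epsilon><..<\<epsilon>}"
  let ?T = "?I \<times> ?I"
  have oT: "open ?T" by (intro open_Times) auto
  have "continuous_on (?T \<times> (UNIV :: 'a set)) (\<lambda>z. (fst (fst z), snd (fst z), snd z))"
    by (intro continuous_intros)
  moreover have "(\<lambda>z. (fst (fst z), snd (fst z), snd z)) ` (?T \<times> (UNIV :: 'a set)) \<subseteq> ?I \<times> ?I \<times> UNIV"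
    by auto
  ultimately have cont: "continuous_on (?T \<times> UNIV) (\<lambda>z. \<Psi> (fst (fst z)) (snd (fst z)) (snd z))"
    using continuous_on_compose2[OF \<epsilon>(2)] by fastforce
  have "smooth_family ?T (\<lambda>u. \<Psi> (fst u) (snd u))"
    unfolding smooth_family_def
  proof (intro conjI ballI oT cont)
    fix c d assume c: "c \<in> A" and d: "d \<in> A"
    let ?D = "family_dom ?T (\<lambda>u. \<Psi> (fst u) (snd u)) c d"
    define B where "B = {(t, s, x). t \<in> ?I \<and> s \<in> ?I \<and> x \<in> chart_img c \<and> \<Psi> t s (param c x) \<in> chart_dom d}"
    define L :: "(real \<times> real) \<times> (real^'m) \<Rightarrow> real \<times> real \<times> (real^'m)" where "L = (\<lambda>z. (fst (fst z), snd (fst z), snd z))"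
    have L: "bounded_linear L"
      unfolding L_def
      by (intro bounded_linear_Pair bounded_linear_compose[OF bounded_linear_fst bounded_linear_fst]
          bounded_linear_compose[OF bounded_linear_snd bounded_linear_fst] bounded_linear_snd)
    have oB: "open B"
    proof -
      have "continuous_on (?I \<times> ?I \<times> chart_img c) (\<lambda>z. (fst z, fst (snd z), param c (snd (snd z))))"
        by (intro continuous_intros continuous_on_compose2[OF continuous_param[OF c]]) auto
      moreover have "(\<lambda>z. (fst z, fst (snd z), param c (snd (snd z)))) ` (?I \<times> ?I \<times> chart_img c) \<subseteq> ?I \<times> ?I \<times> UNIV"
        by auto
      ultimately have *: "continuous_on (?I \<times> ?I \<times> chart_img c) (\<lambda>z. \<Psi> (fst z) (fst (snd z)) (param c (snd (snd z))))"
        using continuous_on_compose2[OF \<epsilon>(2)] by fastforce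
      have "open (?I \<times> ?I \<times> chart_img c)" using c by (intro open_Times) auto
      from continuous_open_preimage[OF * this open_chart_dom[OF d]]
      show ?thesis by (rule back_subst[where P = "open"]) (auto simp: B_def)
    qed
    have D: "?D = L -` B" by (auto simp: family_dom_def L_def B_def)
    have oD: "open ?D"
      unfolding D by (rule open_vimage[OF oB linear_continuous_on[OF L]])
    have "smooth_on ?D (\<lambda>z. (\<lambda>(t, s, x). coord d (\<Psi> t s (param c x))) (L z))"
      by (rule smooth_on_compose[OF oD oB \<epsilon>(3)[OF c d, folded B_def] smooth_on_linear[OF L]]) (auto simp: D)
    then show "smooth_on ?D (family_rep (\<lambda>u. \<Psi> (fst u) (snd u)) c d)"
      by (simp add: family_rep_def[abs_def] L_def)
  qed
  moreover have "0 \<in> ?T" using \<epsilon>(1) by (simp add: zero_prod_def)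
  ultimately show ?thesis by (intro exI[of _ ?T] conjI)
qed

section \<open>Instability along the conformal field\<close>

theorem proposition14:
  fixes A :: "('a::{t2_space,second_countable_topology}, 'm::finite) chart set"
    and g :: "('a, 'm) metric"
    and \<alpha> :: real
  assumes "smooth_atlas A"
    and "riemannian_metric A g"
    and "compact (UNIV :: 'a set)"
    and "orientable A"
    and "\<alpha> > 2"
    and "\<exists>W l. conformal_field A g W l \<and> \<not> killing_field A g W"
    and "2 * \<alpha> < real CARD('m) - 1"
  shows "alpha_unstable \<alpha> A g"
proof -
  interpret compact_riemannian_manifold A g
    by unfold_locales (use assms in auto)
  obtain W l where conf: "conformal_field A g W l" and nk: "\<not> killing_field A g W"
    using assms(6) by blast
  have W: "vector_field A W" and l: "smooth_fun A l"
    using conf by (auto simp: conformal_field_def)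
  let ?m = "real CARD('m)"
  define C1 where "C1 = \<alpha> * (1 + ?m) powr (\<alpha> - 1)"
  define C2 where "C2 = \<alpha> * (\<alpha> - 1) * (1 + ?m) powr (\<alpha> - 2)"
  define r where "r = (4 * ?m * C1 - 2 * ?m\<^sup>2 * C1 + 4 * ?m\<^sup>2 * C2) * (LINT p|vol. (l p)\<^sup>2)"
  have second_deriv: "deriv (\<lambda>t. deriv (\<lambda>s. alpha_energy \<alpha> A g A g (\<Psi> t s)) 0) 0 = r"
    if \<Psi>: "smooth_two_param_variation A A id \<Psi>" "has_initial_velocity A (\<lambda>t. \<Psi> t 0) W"
      "has_initial_velocity A (\<lambda>s. \<Psi> 0 s) W" for \<Psi>
  proof -
    obtain T where T: "0 \<in> T" "smooth_family T (\<lambda>u. \<Psi> (fst u) (snd u))"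
      using two_param_variation_family[OF \<Psi>(1)] by blast
    interpret conformal_variation A g W l "\<lambda>u. \<Psi> (fst u) (snd u)" T
    proof
      show "\<Psi> (fst 0) (snd 0) p = p" for p
        using \<Psi>(1) by (simp add: smooth_two_param_variation_def)
    qed (use conf T \<Psi> in simp_all)
    show ?thesis
      using second_variation[of \<alpha>] by (simp add: r_def C1_def C2_def)
  qed
  have index: "alpha_index_form \<alpha> A g A g id W W = r"
    unfolding alpha_index_form_def
  \<comment> \<open>The description needs existence as well as uniqueness:
    \<open>two_param_variation\<close> supplies a variation with both velocities \<open>W\<close>,
    and \<open>second_deriv\<close> evaluates any such variation to \<open>r\<close>.\<close>
  proof (rule the_equality)
    show "\<exists>\<Psi>. smooth_two_param_variation A A id \<Psi> \<and> has_initial_velocity A (\<lambda>t. \<Psi> t 0) W \<and>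
        has_initial_velocity A (\<lambda>s. \<Psi> 0 s) W \<and>
        r = deriv (\<lambda>t. deriv (\<lambda>s. alpha_energy \<alpha> A g A g (\<Psi> t s)) 0) 0"
      using two_param_variation[OF W] second_deriv by metis
  qed (use second_deriv in blast)
  obtain p where "l p \<noteq> 0"
  proof -
    \<comment> \<open>Being Killing is being conformal with potential 0, so \<lambda> is nonzero
      somewhere, and by continuity its square has positive integral.\<close>
    have "l \<noteq> (\<lambda>_. 0)" using conf nk by (auto simp: killing_field_def)
    then show ?thesis using that by auto
  qed
  then have "(LINT p|vol. (l p)\<^sup>2) > 0"
    by (rule integral_square_pos[OF smooth_fun_continuous[OF l]])
  moreover have "4 * ?m * C1 - 2 * ?m\<^sup>2 * C1 + 4 * ?m\<^sup>2 * C2 < 0"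
  proof -
    define b where "b = (1 + ?m) powr (\<alpha> - 2)"
    have m: "?m \<ge> 1" by (simp add: Suc_leI)
    have b: "b > 0" using m by (simp add: b_def)
    \<comment> \<open>Both powers of 1 + m are reduced to the common positive factor
      \<open>b\<close>, leaving a polynomial whose sign decides.\<close>
    have "(1 + ?m) powr (\<alpha> - 1) = (1 + ?m) powr ((\<alpha> - 2) + 1)" by simp
    also have "\<dots> = b * (1 + ?m)" unfolding powr_add b_def using m by simp
    finally have "4 * ?m * C1 - 2 * ?m\<^sup>2 * C1 + 4 * ?m\<^sup>2 * C2 = (2 * \<alpha> * ?m * b) * (2 + 2 * \<alpha> * ?m - ?m - ?m\<^sup>2)"
      by (simp add: C1_def C2_def b_def[symmetric] power2_eq_square algebra_simps)
    moreover have "2 + 2 * \<alpha> * ?m - ?m - ?m\<^sup>2 < 0"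
    proof -
      \<comment> \<open>The bound on \<alpha>, multiplied by m, gives 2 + 2 \<alpha> m - m - m^2 < 2
        - 2 m, and this is at most 0 because m is at least 1.\<close>
      have "(2 * \<alpha>) * ?m < (?m - 1) * ?m" using assms(7) m by (intro mult_strict_right_mono) auto
      then have "2 * \<alpha> * ?m < ?m * ?m - ?m" by (simp add: left_diff_distrib)
      then show ?thesis unfolding power2_eq_square using m by linarith
    qed
    moreover have "2 * \<alpha> * ?m * b > 0" using assms(5) m b by simp
    ultimately show ?thesis by (simp add: mult_pos_neg)
  qed
  ultimately have "r < 0" unfolding r_def by (simp add: mult_neg_pos)
  then show ?thesis
    using W index by (auto simp: alpha_stable_def alpha_stable_map_def not_le)
qed

end
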